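(* Fix $n\ge1$ and $k\ge3$. There exist positive functions $\psi_1,\psi_2,\psi_3,d,M,N,\eta$ of $(K,\varepsilon)$ such that the following holds. Let $f_0:\overline{\mathbf{B}}^n\to\mathbb{R}$ be a $C^k$-function with $\|f_0\|_{C^k}\le K$. Then for any given $\varepsilon>0$ we can find $h:\overline{\mathbf{B}}^n\to\mathbb{R}$ of class $C^k$ with $\|h\|_{C^k}\le\varepsilon$ such that $f=f_0+h$ satisfies the following conditions: (i) At each critical point $x_i$ of $f$, $\sigma_n(Hf(x_i))\ge\psi_1(K,\varepsilon)$. (ii) For any two different critical points $x_i$ and $x_j$ of $f$, $\|x_i-x_j\|\ge d(K,\varepsilon)$. Consequently, the number of critical points does not exceed $N(K,\varepsilon)$. (iii) For any two different critical points $x_i$ and $x_j$ of $f$, $|f(x_i)-f(x_j)|\ge\psi_2(K,\varepsilon)$. (iv) For each critical point $x_i$ of $f$, there exists a $C^{k-1}$ coordinate transformation $\varphi:\mathbf{B}^n_\delta(x_i)\to\mathbb{R}^n$ such that $$f\circ\varphi^{-1}(y_1,\ldots,y_n)=y_1^2+\cdots+y_l^2-y_{l+1}^2-\cdots-y_n^2+\mathrm{const},$$ where $\delta=\psi_3(K,\varepsilon)$ and $\|\varphi\|_{C^{k-1}}\le M(K,\varepsilon)$. (v) If $\|Df(x)\|\le\eta(K,\varepsilon)$, then $x\in\mathbf{B}^n_\delta(x_i)$ for some critical point $x_i$ of $f$, where $\delta=\psi_3(K,\varepsilon)$.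
   Context: $\overline{\mathbf{B}}^n$ is the closed unit ball of $\mathbb{R}^n$ (Euclidean norm) and $\mathbf{B}^n_\delta(x)$ is the ball of radius $\delta$ centered at $x$. For a $C^k$ mapping $f$ on a domain $U$, $\|f\|_{C^k}=\max_{1\le p\le k}\sup_{x\in U}\|D^pf(x)\|$, with operator norms (the values of $f$ itself are not included). A critical point of $f$ is a point $x$ with $Df(x)=0$; $Hf(x)$ is the Hessian of $f$ at $x$, and $\sigma_n(L)=\min_{\|x\|=1}\|Lx\|$ is the smallest singular value of an $n\times n$ matrix $L$. A $C^{k-1}$ coordinate transformation is a $C^{k-1}$ diffeomorphism onto its image. In (iv), $l$ is an integer between $0$ and $n$, depending on the critical point, and const is a real constant. *)

theory Defs
  imports "HOL-Analysis.Analysis"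
begin

text \<open>\<open>nderiv U f [v\<^sub>1, \<dots>, v\<^sub>p] x\<close> is the value \<open>D\<^sup>pf(x)(v\<^sub>1, \<dots>, v\<^sub>p)\<close> of the \<open>p\<close>-linear map \<open>D\<^sup>pf(x)\<close>,
  where \<open>D\<^sup>p\<^sup>+\<^sup>1f(x)(v, v\<^sub>1, \<dots>, v\<^sub>p) = D(D\<^sup>pf)(x)(v)(v\<^sub>1, \<dots>, v\<^sub>p)\<close>. All derivatives are taken within \<open>U\<close>;
  this is used for open sets and for closed balls, on both of which they are unique.\<close>

primrec nderiv ::
  "'a::euclidean_space set \<Rightarrow> ('a \<Rightarrow> 'b::real_normed_vector) \<Rightarrow> 'a list \<Rightarrow> 'a \<Rightarrow> 'b" where
  "nderiv U f [] = f"
| "nderiv U f (v # vs) = (\<lambda>x. frechet_derivative (nderiv U f vs) (at x within U) v)"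

text \<open>As the domain is finite-dimensional, differentiability (continuity) of \<open>D\<^sup>pf\<close> as a map into
  the normed space of \<open>p\<close>-linear maps is the same as differentiability (continuity) of
  \<open>x \<mapsto> D\<^sup>pf(x)(v\<^sub>1, \<dots>, v\<^sub>p)\<close> for all \<open>v\<^sub>1, \<dots>, v\<^sub>p\<close>.\<close>

definition Ck_on ::
  "nat \<Rightarrow> 'a::euclidean_space set \<Rightarrow> ('a \<Rightarrow> 'b::real_normed_vector) \<Rightarrow> bool" where
  "Ck_on k U f \<longleftrightarrow>
     (\<forall>vs. length vs < k \<longrightarrow> nderiv U f vs differentiable_on U) \<and>
     (\<forall>vs. length vs \<le> k \<longrightarrow> continuous_on U (nderiv U f vs))"

definition multi_onorm :: "nat \<Rightarrow> ('a::real_normed_vector list \<Rightarrow> 'b::real_normed_vector) \<Rightarrow> ereal" where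
  "multi_onorm p L = (SUP vs \<in> {vs. length vs = p \<and> (\<forall>v\<in>set vs. norm v \<le> 1)}. ereal (norm (L vs)))"

text \<open>The norm is extended-real-valued, so that it is \<open>\<infinity>\<close> if some derivative is unbounded on \<open>U\<close>.
  The term \<open>p = 0\<close> is not included. It is only meaningful for \<open>k \<ge> 1\<close> and nonempty \<open>U\<close>.\<close>

definition Ck_norm ::
  "nat \<Rightarrow> 'a::euclidean_space set \<Rightarrow> ('a \<Rightarrow> 'b::real_normed_vector) \<Rightarrow> ereal" where
  "Ck_norm k U f = (MAX p\<in>{1..k}. SUP x\<in>U. multi_onorm p (\<lambda>vs. nderiv U f vs x))"

definition critical_points :: "'a::euclidean_space set \<Rightarrow> ('a \<Rightarrow> real) \<Rightarrow> 'a set" where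
  "critical_points U f = {x \<in> U. frechet_derivative f (at x within U) = (\<lambda>v. 0)}"

definition Hessian :: "(real ^ 'n) set \<Rightarrow> (real ^ 'n \<Rightarrow> real) \<Rightarrow> real ^ 'n \<Rightarrow> real ^ 'n ^ 'n" where
  "Hessian U f x = (\<chi> i j. nderiv U f [axis i 1, axis j 1] x)"

text \<open>The infimum is attained, the unit sphere being compact.\<close>

definition sigma_min :: "real ^ 'n ^ 'n \<Rightarrow> real" where
  "sigma_min L = (INF x\<in>sphere 0 1. norm (L *v x))"

definition Ck_diffeo_onto_image ::
  "nat \<Rightarrow> 'a::euclidean_space set \<Rightarrow> ('a \<Rightarrow> 'a) \<Rightarrow> bool" where
  "Ck_diffeo_onto_image k U \<phi> \<longleftrightarrow>
     Ck_on k U \<phi> \<and> inj_on \<phi> U \<and> open (\<phi> ` U) \<and> Ck_on k (\<phi> ` U) (inv_into U \<phi>)"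

text \<open>\<open>e\<close> enumerates the coordinates as \<open>y\<^sub>1, \<dots>, y\<^sub>n\<close>, the index type \<open>'n\<close> having no order of its own.\<close>

definition morse_form :: "(nat \<Rightarrow> 'n) \<Rightarrow> nat \<Rightarrow> real ^ 'n \<Rightarrow> real" where
  "morse_form e l y = (\<Sum>i=1..l. (y $ e i)\<^sup>2) - (\<Sum>i=l+1..CARD('n). (y $ e i)\<^sup>2)"

end

theory Submission
  imports Defs
begin

text \<open>For a tilt \<open>a\<close> on a grid of mesh \<open>m\<^sup>-\<^sup>2\<close>, call \<open>a\<close> bad if \<open>\<nabla>f\<^sub>0 - a\<close> is tiny at some point where the
  Hessian is nearly singular or which is close to the sphere. On a cell of size \<open>1 / m\<close> around a point
  with nearly singular Hessian, \<open>\<nabla>f\<^sub>0\<close> takes values in a slab of thickness of order \<open>m\<^sup>-\<^sup>2\<close>, so that all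
  cells together produce only \<open>O(m\<^sup>2\<^sup>n\<^sup>-\<^sup>1)\<close> bad tilts, out of about \<open>m\<^sup>2\<^sup>n\<close>; the cells close to the sphere
  are so few that they do no more harm. A good tilt makes all critical points nondegenerate with an
  explicit constant. Small bumps centred at the critical points then separate the critical values
  without moving the points.

  Given nondegeneracy, only the normal form is not a direct consequence of a \<open>C\<^sup>3\<close> bound. Solving
  \<open>\<partial>\<^sub>jf = 0\<close> for \<open>x\<^sub>j\<close> gives a \<open>C\<^sup>k\<^sup>-\<^sup>1\<close> function \<open>Y\<^sub>j\<close> of the other coordinates, and
  \<open>f = F + (x\<^sub>j - Y\<^sub>j)\<^sup>2 u\<close>. Here \<open>F\<close> is again of class \<open>C\<^sup>k\<close>, as its partial derivatives are those of
  \<open>f\<close> at the solution. While \<open>u\<close> is only \<open>C\<^sup>k\<^sup>-\<^sup>2\<close>, the product \<open>(x\<^sub>j - Y\<^sub>j) u\<close> is \<open>C\<^sup>k\<^sup>-\<^sup>1\<close>, and this suffices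
  for \<open>(x\<^sub>j - Y\<^sub>j) \<bar>u\<bar>\<^sup>1\<^sup>/\<^sup>2\<close> to be \<open>C\<^sup>k\<^sup>-\<^sup>1\<close>. Eliminating the coordinates one by one, in a basis that
  diagonalizes the Hessian, yields the Morse coordinates without the loss of a second derivative.\<close>

section \<open>Uniformly bounded families of smooth functions\<close>

text \<open>The mesh m^-2 is the size of the second-order Taylor error on a cell of size 1/m. Up to
  O(1) mesh steps the gradient is therefore linear on a cell: its image is O(m) steps wide, but only
  O(1) steps in the direction of a vector that the Hessian almost annihilates. So each of the O(m^n)
  cells yields O(m^(n-1)) bad tilts, while the O(m^(n-1)) cells near the sphere yield O(m^n) each.
  Both totals fall short of the grid by a factor m.

  Critical points have to stay off the sphere for two reasons. Symmetry of second derivatives taken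
  within the closed ball is at hand only at interior points. Both the Morse chart and the Newton
  iteration, which finds a critical point wherever the gradient is small, need a full ball around
  the point.

  The C^k norm ignores the values of f, so uniform bounds on families apply only after subtracting
  the value at the critical point. For the same reason gaps between critical values cannot be
  estimated and must be created: the bump heights are assigned by rank.\<close>

abbreviation fderiv ::
  "('i \<Rightarrow> 'a \<Rightarrow> 'b) \<Rightarrow> 'i \<Rightarrow> 'a::real_normed_vector \<Rightarrow> 'a \<Rightarrow> 'b::real_normed_vector" where
  "fderiv F i x \<equiv> frechet_derivative (F i) (at x)"

text \<open>Uniformity in \<open>f\<close> of the radius and of the norm of the Morse coordinates is expressed by treating
  all admissible data as the index \<open>i\<close> of one family: the bounds must not depend on \<open>i\<close>. Inadmissible
  indices get the domain \<open>{}\<close>.\<close>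

primrec unif_C ::
  "nat \<Rightarrow> ('i \<Rightarrow> 'a::euclidean_space set) \<Rightarrow> ('i \<Rightarrow> 'a \<Rightarrow> 'b::real_normed_vector) \<Rightarrow> bool" where
  "unif_C 0 U F \<longleftrightarrow> (\<forall>i. open (U i)) \<and> (\<forall>i. continuous_on (U i) (F i)) \<and>
     (\<exists>C. \<forall>i. \<forall>x\<in>U i. norm (F i x) \<le> C)"
| "unif_C (Suc m) U F \<longleftrightarrow> (\<forall>i. open (U i)) \<and> (\<forall>i. \<forall>x\<in>U i. F i differentiable (at x)) \<and>
     (\<exists>C. \<forall>i. \<forall>x\<in>U i. norm (F i x) \<le> C) \<and>
     (\<forall>v. unif_C m U (\<lambda>i x. fderiv F i x v))"

lemma unif_C_open: "unif_C m U F \<Longrightarrow> open (U i)"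
  by (cases m) auto

lemma unif_C_bounded:
  assumes "unif_C m U F"
  obtains C where "C > 0" "\<And>i x. x \<in> U i \<Longrightarrow> norm (F i x) \<le> C"
proof -
  obtain C where "\<And>i x. x \<in> U i \<Longrightarrow> norm (F i x) \<le> C"
  proof -
    have "\<exists>C. \<forall>i. \<forall>x\<in>U i. norm (F i x) \<le> C" using assms by (cases m) simp_all
    then show ?thesis using that by blast
  qed
  then have "\<And>i x. x \<in> U i \<Longrightarrow> norm (F i x) \<le> max C 1"
    by (meson max.coboundedI1)
  then show ?thesis using that[of "max C 1"] by auto
qed

lemma unif_C_has_derivative:
  assumes "unif_C (Suc m) U F" "x \<in> U i"
  shows "(F i has_derivative fderiv F i x) (at x)"
  using assms by (simp add: frechet_derivative_works[symmetric])

lemma unif_C_SucD: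
  "unif_C (Suc m) U F \<Longrightarrow> unif_C m U (\<lambda>i x. fderiv F i x v)"
  by simp

lemma unif_C_continuous: "unif_C m U F \<Longrightarrow> continuous_on (U i) (F i)"
  by (cases m)
     (auto simp: continuous_on_eq_continuous_at intro!: differentiable_imp_continuous_within)

lemma unif_C_cong:
  assumes "unif_C m U F" "\<And>i x. x \<in> U i \<Longrightarrow> F i x = G i x"
  shows "unif_C m U G"
  using assms
proof (induction m arbitrary: F G)
  case 0
  then show ?case
    by (auto simp: continuous_on_cong[of "U _" "U _" "F _" "G _"])
next
  case (Suc m)
  have der: "(G i has_derivative fderiv F i x) (at x)" if "x \<in> U i" for i x
    by (rule has_derivative_transform_within_open[OF unif_C_has_derivative[OF Suc.prems(1) that]])
       (use that Suc.prems unif_C_open in auto)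
  have "unif_C m U (\<lambda>i x. fderiv G i x v)" for v
    by (rule Suc.IH[OF unif_C_SucD[OF Suc.prems(1), of v]])
       (use der frechet_derivative_at in metis)
  moreover have "G i differentiable (at x)" if "x \<in> U i" for i x
    using der[OF that] by (auto simp: differentiable_def)
  ultimately show ?case using Suc.prems unfolding unif_C.simps(2) by metis
qed

text \<open>Lets any known derivative \<open>F'\<close> stand in for \<open>fderiv\<close>; the
  closure proofs below rest on this rule.\<close>

lemma unif_C_SucI:
  assumes "\<And>i. open (U i)" "\<And>i x. x \<in> U i \<Longrightarrow> (F i has_derivative F' i x) (at x)"
    and "\<And>v. unif_C m U (\<lambda>i x. F' i x v)" and "\<And>i x. x \<in> U i \<Longrightarrow> norm (F i x) \<le> C"
  shows "unif_C (Suc m) U F"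
proof -
  have "unif_C m U (\<lambda>i x. fderiv F i x v)" for v
    by (rule unif_C_cong[OF assms(3)[of v]]) (use assms(2) frechet_derivative_at in metis)
  then show ?thesis using assms(1,2,4) unfolding unif_C.simps(2) differentiable_def by blast
qed

lemma unif_C_Suc_imp: "unif_C (Suc m) U F \<Longrightarrow> unif_C m U F"
proof (induction m arbitrary: F)
  case 0
  then have "continuous_on (U i) (F i)" for i by (rule unif_C_continuous)
  then show ?case using 0 by simp
next
  case (Suc m)
  have "unif_C m U (\<lambda>i x. fderiv F i x v)" for v
    by (rule Suc.IH[OF unif_C_SucD[OF Suc.prems]])
  then show ?case using Suc.prems unfolding unif_C.simps(2) by blast
qed

lemma unif_C_le: "unif_C m U F \<Longrightarrow> m' \<le> m \<Longrightarrow> unif_C m' U F"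
proof (induction m)
  case (Suc m)
  then show ?case using unif_C_Suc_imp le_Suc_eq by blast
qed auto

lemma unif_C_subset:
  assumes "unif_C m U F" "\<And>i. open (V i)" "\<And>i. V i \<subseteq> U i"
  shows "unif_C m V F"
  using assms(1)
proof (induction m arbitrary: F)
  case 0
  then show ?case using assms(2,3) by (simp) (meson continuous_on_subset subsetD)
next
  case (Suc m)
  then show ?case using assms(2,3) by simp (meson subsetD)
qed

section \<open>Closure of families under algebraic operations, composition and real powers\<close>

lemma unif_C_0I:
  assumes "\<And>i. open (U i)" "\<And>i. continuous_on (U i) (F i)" "\<And>i x. x \<in> U i \<Longrightarrow> norm (F i x) \<le> C"
  shows "unif_C 0 U F"
  unfolding unif_C.simps(1) using assms by blast

text \<open>The bound is asked for only where the domain is nonempty, so that inadmissible indices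
  may carry arbitrary data.\<close>

lemma unif_C_const:
  assumes "\<And>i. open (U i)" "\<And>i. U i \<noteq> {} \<Longrightarrow> norm (c i) \<le> C"
  shows "unif_C m U (\<lambda>i x. c i)"
  using assms(2)
proof (induction m arbitrary: c C)
  case 0
  then show ?case using assms(1) by (intro unif_C_0I[where C=C]) auto
next
  case (Suc m)
  show ?case
    by (rule unif_C_SucI[where F' = "\<lambda>i x v. 0" and C = C])
       (use Suc.IH[of "\<lambda>i. 0" 0] Suc.prems assms(1) in auto)
qed

text \<open>The linear part may vary with the index: this is how the orthogonal changes of basis,
  one for each admissible function, enter as a single family.\<close>

lemma unif_C_affine:
  assumes "\<And>i. open (U i)" "\<And>i. bounded_linear (T i)"
    and "\<And>i v. U i \<noteq> {} \<Longrightarrow> norm (T i v) \<le> C * norm v"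
    and "\<And>i x. x \<in> U i \<Longrightarrow> norm (c i + T i x) \<le> D"
  shows "unif_C m U (\<lambda>i x. c i + T i x)"
proof (cases m)
  case 0
  show ?thesis unfolding 0
    by (rule unif_C_0I[where C=D])
       (use assms in \<open>simp_all add: continuous_on_add linear_continuous_on\<close>)
next
  case (Suc m')
  show ?thesis unfolding Suc
  proof (rule unif_C_SucI[where F' = "\<lambda>i x v. T i v"])
    show "unif_C m' U (\<lambda>i x. T i v)" for v
      by (rule unif_C_const[where C = "C * norm v"]) (use assms in auto)
    show "((\<lambda>x. c i + T i x) has_derivative T i) (at x)" for i x
      using assms(2) by (auto intro!: derivative_eq_intros bounded_linear_imp_has_derivative)
  qed (use assms in auto)
qed

lemma unif_C_add:
  assumes "unif_C m U F" "unif_C m U G"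
  shows "unif_C m U (\<lambda>i x. F i x + G i x)"
proof -
  have bd: "\<exists>C. \<forall>i. \<forall>x\<in>U i. norm (F i x + G i x) \<le> C" if FG: "unif_C m U F" "unif_C m U G" for m F G
  proof -
    from unif_C_bounded[OF FG(1)] unif_C_bounded[OF FG(2)] obtain C D where
      "\<And>i x. x \<in> U i \<Longrightarrow> norm (F i x) \<le> C" "\<And>i x. x \<in> U i \<Longrightarrow> norm (G i x) \<le> D" by metis
    then show ?thesis using norm_triangle_mono by metis
  qed
  from assms show ?thesis
  proof (induction m arbitrary: F G)
    case 0
    obtain C where "\<And>i x. x \<in> U i \<Longrightarrow> norm (F i x + G i x) \<le> C" using bd[OF 0] by auto
    then show ?case using 0 by (intro unif_C_0I[where C=C]) (auto intro!: continuous_intros)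
  next
    case (Suc m)
    obtain C where C: "\<And>i x. x \<in> U i \<Longrightarrow> norm (F i x + G i x) \<le> C" using bd[OF Suc.prems] by auto
    show ?case
    proof (rule unif_C_SucI[OF _ _ _ C])
      show "unif_C m U (\<lambda>i x. fderiv F i x v + fderiv G i x v)" for v
        by (rule Suc.IH[OF unif_C_SucD[OF Suc.prems(1)] unif_C_SucD[OF Suc.prems(2)]])
      show "((\<lambda>x. F i x + G i x) has_derivative (\<lambda>v. fderiv F i x v + fderiv G i x v)) (at x)"
        if "x \<in> U i" for i x
        by (intro has_derivative_add unif_C_has_derivative[OF Suc.prems(1)] unif_C_has_derivative[OF Suc.prems(2)] that)
    qed (use unif_C_open[OF Suc.prems(1)] in auto)
  qed
qed

lemma (in bounded_bilinear) unif_C: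
  assumes "unif_C m U F" "unif_C m U G"
  shows "unif_C m U (\<lambda>i x. prod (F i x) (G i x))"
proof -
  have bd: "\<exists>C. \<forall>i. \<forall>x\<in>U i. norm (prod (F i x) (G i x)) \<le> C" if FG: "unif_C m U F" "unif_C m U G" for m F G
  proof -
    from unif_C_bounded[OF FG(1)] unif_C_bounded[OF FG(2)] obtain C D where
      CD: "\<And>i x. x \<in> U i \<Longrightarrow> norm (F i x) \<le> C" "\<And>i x. x \<in> U i \<Longrightarrow> norm (G i x) \<le> D" "C > 0" "D > 0" by metis
    obtain K where K: "K > 0" "\<And>a b. norm (prod a b) \<le> norm a * norm b * K" using pos_bounded by metis
    have "norm (prod (F i x) (G i x)) \<le> C * D * K" if "x \<in> U i" for i x
      using K(2)[of "F i x" "G i x"] mult_mono[OF CD(1)[OF that] CD(2)[OF that]] K(1) CD(3)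
      by (smt (verit) mult_right_mono norm_ge_zero)
    then show ?thesis by blast
  qed
  from assms show ?thesis
  proof (induction m arbitrary: F G)
    case 0
    obtain C where "\<And>i x. x \<in> U i \<Longrightarrow> norm (prod (F i x) (G i x)) \<le> C" using bd[OF 0] by auto
    then show ?case using 0 by (intro unif_C_0I[where C=C]) (auto intro!: continuous_on)
  next
    case (Suc m)
    obtain C where C: "\<And>i x. x \<in> U i \<Longrightarrow> norm (prod (F i x) (G i x)) \<le> C" using bd[OF Suc.prems] by auto
    show ?case
    proof (rule unif_C_SucI[OF _ _ _ C])
      show "unif_C m U (\<lambda>i x. prod (F i x) (fderiv G i x v) + prod (fderiv F i x v) (G i x))" for v
        by (rule unif_C_add[OF Suc.IH[OF unif_C_Suc_imp[OF Suc.prems(1)] unif_C_SucD[OF Suc.prems(2)]]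
              Suc.IH[OF unif_C_SucD[OF Suc.prems(1)] unif_C_Suc_imp[OF Suc.prems(2)]]])
      show "((\<lambda>x. prod (F i x) (G i x)) has_derivative (\<lambda>v. prod (F i x) (fderiv G i x v) + prod (fderiv F i x v) (G i x))) (at x)"
        if "x \<in> U i" for i x
        by (intro FDERIV unif_C_has_derivative[OF Suc.prems(1)] unif_C_has_derivative[OF Suc.prems(2)] that)
    qed (use unif_C_open[OF Suc.prems(1)] in auto)
  qed
qed

lemmas unif_C_scaleR = bounded_bilinear.unif_C[OF bounded_bilinear_scaleR]
lemmas unif_C_inner = bounded_bilinear.unif_C[OF bounded_bilinear_inner]
lemma unif_C_mult:
  fixes F G :: "'i \<Rightarrow> 'a::euclidean_space \<Rightarrow> real"
  shows "unif_C m U F \<Longrightarrow> unif_C m U G \<Longrightarrow> unif_C m U (\<lambda>i x. F i x * G i x)"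
  by (rule bounded_bilinear.unif_C[OF bounded_bilinear_mult])

text \<open>Reading \<open>T (F i x)\<close> as the bilinear expression
  \<open>1 *\<^sub>R T (F i x)\<close> reuses the product rule in place of a further
  induction.\<close>

lemma unif_C_linear:
  assumes T: "bounded_linear T" and "unif_C m U F"
  shows "unif_C m U (\<lambda>i x. T (F i x))"
proof -
  interpret T: bounded_linear T by fact
  interpret bounded_bilinear "\<lambda>(r::real) a. r *\<^sub>R T a"
    by (rule bounded_bilinear.comp[OF bounded_bilinear_scaleR bounded_linear_ident T])
  have "unif_C m U (\<lambda>i x. 1 *\<^sub>R T (F i x))"
    by (rule unif_C[OF unif_C_const[of U "\<lambda>i. 1" 1] assms(2)]) (use unif_C_open[OF assms(2)] in auto)
  then show ?thesis by simp
qed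

lemma unif_C_minus:
  assumes "unif_C m U F" "unif_C m U G"
  shows "unif_C m U (\<lambda>i x. F i x - G i x)"
  using unif_C_add[OF assms(1) unif_C_linear[OF bounded_linear_minus[OF bounded_linear_ident] assms(2)]] by simp

lemma unif_C_sum:
  assumes "finite S" "\<And>i. open (U i)" "\<And>s. s \<in> S \<Longrightarrow> unif_C m U (F s)"
  shows "unif_C m U (\<lambda>i x. \<Sum>s\<in>S. F s i x)"
  using assms(1,3)
proof (induction S rule: finite_induct)
  case empty
  show ?case using unif_C_const[of U "\<lambda>i. 0" 0] assms(2) by simp
next
  case (insert s S)
  then show ?case using unif_C_add[of m U "F s"] by simp
qed

lemma unif_C_prod:
  fixes F :: "'s \<Rightarrow> 'i \<Rightarrow> 'a::euclidean_space \<Rightarrow> real"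
  assumes "finite S" "\<And>i. open (U i)" "\<And>s. s \<in> S \<Longrightarrow> unif_C m U (F s)"
  shows "unif_C m U (\<lambda>i x. \<Prod>s\<in>S. F s i x)"
  using assms(1,3)
proof (induction S rule: finite_induct)
  case empty
  have "unif_C m U (\<lambda>i x. 1::real)" by (rule unif_C_const[where C=1]) (use assms(2) in auto)
  then show ?case by simp
next
  case (insert s S)
  then show ?case using unif_C_mult[of m U "F s"] by simp
qed

lemma linear_eq_sum_Basis:
  fixes f :: "'a::euclidean_space \<Rightarrow> 'b::real_normed_vector"
  assumes "linear f"
  shows "f v = (\<Sum>b\<in>Basis. (v \<bullet> b) *\<^sub>R f b)"
proof -
  have "f v = f (\<Sum>b\<in>Basis. (v \<bullet> b) *\<^sub>R b)" by (simp add: euclidean_representation)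
  then show ?thesis by (simp add: linear_sum[OF assms] linear_scale[OF assms])
qed

lemma unif_C_compose:
  fixes G :: "'i \<Rightarrow> 'a::euclidean_space \<Rightarrow> 'c::euclidean_space"
  assumes "unif_C m V F" "unif_C m U G" "\<And>i x. x \<in> U i \<Longrightarrow> G i x \<in> V i"
  shows "unif_C m U (\<lambda>i x. F i (G i x))"
  using assms(1,2)
proof (induction m arbitrary: F)
  case 0
  then have "continuous_on (U i) (\<lambda>x. F i (G i x))" for i
    by (intro continuous_on_compose2[of "V i" "F i" "U i" "G i"]) (use assms(3) in auto)
  moreover obtain C where "\<And>i x. x \<in> V i \<Longrightarrow> norm (F i x) \<le> C" using unif_C_bounded[OF 0(1)] by metis
  ultimately show ?case using assms(3) unif_C_open[OF 0(2)] by (intro unif_C_0I[where C=C]) auto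
next
  case (Suc m)
  obtain C where C: "\<And>i x. x \<in> V i \<Longrightarrow> norm (F i x) \<le> C" using unif_C_bounded[OF Suc.prems(1)] by metis
  show ?case
  proof (rule unif_C_SucI[where F' = "\<lambda>i x v. fderiv F i (G i x) (fderiv G i x v)"])
    show "open (U i)" for i using unif_C_open[OF Suc.prems(2)] .
    show "x \<in> U i \<Longrightarrow> norm (F i (G i x)) \<le> C" for i x using C assms(3) by auto
    fix v
    \<comment> \<open>The definition of \<open>unif_C\<close> controls fixed directions only, while
      the chain rule differentiates \<open>F\<close> in the moving direction
      \<open>fderiv G i x v\<close>. Expanding that direction in the basis reduces to fixed
      ones.\<close>
    have "unif_C m U (\<lambda>i x. \<Sum>b\<in>Basis. (fderiv G i x v \<bullet> b) *\<^sub>R fderiv F i (G i x) b)"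
      by (intro unif_C_sum unif_C_scaleR Suc.IH unif_C_SucD unif_C_inner unif_C_const[where C=1] Suc.prems unif_C_Suc_imp)
         (use unif_C_open[OF Suc.prems(2)] in auto)
    then show "unif_C m U (\<lambda>i x. fderiv F i (G i x) (fderiv G i x v))"
    proof (rule unif_C_cong)
      show "(\<Sum>b\<in>Basis. (fderiv G i x v \<bullet> b) *\<^sub>R fderiv F i (G i x) b)
         = fderiv F i (G i x) (fderiv G i x v)" if "x \<in> U i" for i x
        by (rule linear_eq_sum_Basis[symmetric])
           (use unif_C_has_derivative[OF Suc.prems(1) assms(3)[OF that]] has_derivative_linear in blast)
    qed
  next
    show "((\<lambda>x. F i (G i x)) has_derivative (\<lambda>v. fderiv F i (G i x) (fderiv G i x v))) (at x)"
      if "x \<in> U i" for i x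
      using diff_chain_at[OF unif_C_has_derivative[OF Suc.prems(2) that] unif_C_has_derivative[OF Suc.prems(1) assms(3)[OF that]]]
      by (simp add: o_def)
  qed
qed

lemma unif_C_powr:
  fixes F :: "'i \<Rightarrow> 'a::euclidean_space \<Rightarrow> real"
  assumes "unif_C m U F" "c > 0" "\<And>i x. x \<in> U i \<Longrightarrow> F i x \<ge> c"
  shows "unif_C m U (\<lambda>i x. F i x powr a)"
proof -
  have "\<exists>C. \<forall>i. \<forall>x\<in>U i. norm (F i x powr a) \<le> C" for a
  proof -
    from unif_C_bounded[OF assms(1)] obtain C where
      C: "\<And>i x. x \<in> U i \<Longrightarrow> norm (F i x) \<le> C" by metis
    \<comment> \<open>The two summands cover the two signs of the exponent, so the induction may
      pass from \<open>a\<close> to \<open>a - 1\<close> freely.\<close>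
    have "norm (F i x powr a) \<le> C powr a + c powr a" if "x \<in> U i" for i x
    proof (cases "a \<ge> 0")
      case True
      then have "F i x powr a \<le> C powr a" using C[OF that] assms(2) assms(3)[OF that] by (intro powr_mono2) auto
      then show ?thesis by (simp add: add_increasing2)
    next
      case False
      then have "F i x powr a \<le> c powr a" using assms(2) assms(3)[OF that] by (intro powr_mono2') auto
      then show ?thesis by (simp add: add_increasing)
    qed
    then show ?thesis by blast
  qed
  note bd = this
  from assms(1) show ?thesis
  proof (induction m arbitrary: a)
    case 0
    have "F i x \<noteq> 0" if "x \<in> U i" for i x using assms(2) assms(3)[OF that] by linarith
    moreover obtain C where "\<And>i x. x \<in> U i \<Longrightarrow> norm (F i x powr a) \<le> C" using bd[of a] by auto
    ultimately show ?case using 0 by (intro unif_C_0I[where C=C]) (auto intro!: continuous_intros)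
  next
    case (Suc m)
    obtain C where C: "\<And>i x. x \<in> U i \<Longrightarrow> norm (F i x powr a) \<le> C" using bd[of a] by auto
    show ?case
    proof (rule unif_C_SucI[OF _ _ _ C])
      show "unif_C m U (\<lambda>i x. a * (F i x powr (a - 1) * fderiv F i x v))" for v
        by (intro unif_C_mult unif_C_SucD Suc.IH unif_C_const[where C="\<bar>a\<bar>"] Suc.prems unif_C_Suc_imp)
           (use unif_C_open[OF Suc.prems(1)] in auto)
      fix i x assume x: "x \<in> U i"
      have pos: "F i x > 0" using assms(3)[OF x] assms(2) by linarith
      show "((\<lambda>x. F i x powr a) has_derivative (\<lambda>v. a * (F i x powr (a - 1) * fderiv F i x v))) (at x)"
        using unif_C_has_derivative[OF Suc.prems x] pos
        by (auto intro!: derivative_eq_intros simp: powr_diff field_simps)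
    qed (use unif_C_open[OF Suc.prems(1)] in auto)
  qed
qed

text \<open>A real power wants a positive base, but \<open>F\<close> may have either sign; hence 1/F
  is written as F times the power -1 of F^2.\<close>

lemma unif_C_inverse:
  fixes F :: "'i \<Rightarrow> 'a::euclidean_space \<Rightarrow> real"
  assumes "unif_C m U F" "c > 0" "\<And>i x. x \<in> U i \<Longrightarrow> \<bar>F i x\<bar> \<ge> c"
  shows "unif_C m U (\<lambda>i x. inverse (F i x))"
proof -
  have sq: "c * c \<le> F i x * F i x" if "x \<in> U i" for i x
    using mult_mono[OF assms(3)[OF that] assms(3)[OF that]] assms(2) by simp
  have "unif_C m U (\<lambda>i x. F i x * (F i x * F i x) powr (-1))"
    by (intro unif_C_mult unif_C_powr[where c="c * c"] assms(1)) (use sq assms(2) in auto)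
  then show ?thesis
  proof (rule unif_C_cong)
    show "F i x * (F i x * F i x) powr (-1) = inverse (F i x)" if "x \<in> U i" for i x
      using sq[OF that] assms(2) by (auto simp: powr_minus field_simps)
  qed
qed

text \<open>\<open>unif_C\<close> bounds each directional derivative by a constant that depends on
  the direction. Adding the constants of the basis vectors gives one operator bound.\<close>

lemma unif_C_deriv_bounded:
  fixes F :: "'i \<Rightarrow> 'a::euclidean_space \<Rightarrow> 'b::real_normed_vector"
  assumes "unif_C (Suc m) U F"
  obtains L where "L > 0" "\<And>i x v. x \<in> U i \<Longrightarrow> norm (fderiv F i x v) \<le> L * norm v"
proof -
  have "\<forall>b. \<exists>C>0. \<forall>i. \<forall>x\<in>U i. norm (fderiv F i x b) \<le> C"
    using unif_C_bounded[OF unif_C_SucD[OF assms]] by metis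
  then obtain C where C: "\<And>b. C b > 0" "\<And>b i x. x \<in> U i \<Longrightarrow> norm (fderiv F i x b) \<le> C b"
    by metis
  define L where "L = (\<Sum>b\<in>(Basis::'a set). C b)"
  have "norm (fderiv F i x v) \<le> L * norm v" if "x \<in> U i" for i x v
  proof -
    have "fderiv F i x v = (\<Sum>b\<in>Basis. (v \<bullet> b) *\<^sub>R fderiv F i x b)"
      using linear_eq_sum_Basis unif_C_has_derivative[OF assms that] has_derivative_linear by blast
    also have "norm \<dots> \<le> (\<Sum>b\<in>Basis. C b * norm v)"
      using C(2)[OF that] Basis_le_norm[of _ v] less_imp_le[OF C(1)]
      by (intro sum_norm_le) (metis abs_ge_zero mult.commute mult_mono norm_scaleR)
    finally show ?thesis by (simp add: L_def sum_distrib_right)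
  qed
  moreover have "L > 0" unfolding L_def by (intro sum_pos) (use C(1) in auto)
  ultimately show ?thesis using that by blast
qed

lemma unif_C_lipschitz:
  fixes F :: "'i \<Rightarrow> 'a::euclidean_space \<Rightarrow> 'b::real_normed_vector"
  assumes "unif_C (Suc m) U F" "\<And>i. convex (U i)"
  obtains L where "L > 0" "\<And>i x y. x \<in> U i \<Longrightarrow> y \<in> U i \<Longrightarrow> norm (F i x - F i y) \<le> L * norm (x - y)"
proof -
  obtain L where L: "L > 0" "\<And>i x v. x \<in> U i \<Longrightarrow> norm (fderiv F i x v) \<le> L * norm v"
    using unif_C_deriv_bounded[OF assms(1)] by blast
  have "norm (F i x - F i y) \<le> L * norm (x - y)" if "x \<in> U i" "y \<in> U i" for i x y
    by (rule differentiable_bound[OF assms(2)[of i], where f' = "\<lambda>x. fderiv F i x"])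
       (use that L in \<open>auto intro!: onorm_le has_derivative_at_withinI unif_C_has_derivative[OF assms(1)]\<close>)
  then show ?thesis using that L(1) by blast
qed

declare unif_C.simps [simp del]

section \<open>Determinants, parameter integrals and the inverse function theorem for families\<close>

definition fam_ball :: "'i set \<Rightarrow> real \<Rightarrow> 'i \<Rightarrow> 'a::euclidean_space set" where
  "fam_ball V r i = (if i \<in> V then ball 0 r else {})"

lemma mem_fam_ball [simp]: "x \<in> fam_ball V r i \<longleftrightarrow> i \<in> V \<and> norm x < r"
  by (auto simp: fam_ball_def)

lemma open_fam_ball [simp, intro]: "open (fam_ball V r i)"
  by (auto simp: fam_ball_def)

lemma convex_fam_ball [simp, intro]: "convex (fam_ball V r i)"
  by (auto simp: fam_ball_def)

lemma fam_ball_mono: "r' \<le> r \<Longrightarrow> fam_ball V r' i \<subseteq> fam_ball V r i"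
  by auto

lemma unif_C_vec:
  assumes "\<And>k. unif_C m U (\<lambda>i x. X i x $ k)"
  shows "unif_C m U (X :: 'i \<Rightarrow> 'a::euclidean_space \<Rightarrow> real ^ 'n)"
proof -
  have "unif_C m U (\<lambda>i x. \<Sum>k\<in>UNIV. X i x $ k *\<^sub>R (axis k 1 :: real ^ 'n))"
    by (intro unif_C_sum unif_C_scaleR assms unif_C_const[where C = 1])
       (use unif_C_open[OF assms] in \<open>auto simp: norm_axis_1\<close>)
  then show ?thesis
    by (simp add: basis_expansion flip: scalar_mult_eq_scaleR)
qed

lemma unif_C_vec_nth:
  "unif_C m U (X :: 'i \<Rightarrow> 'a::euclidean_space \<Rightarrow> real ^ 'n) \<Longrightarrow> unif_C m U (\<lambda>i x. X i x $ k)"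
  by (rule unif_C_linear[OF bounded_linear_vec_nth])

lemma unif_C_det:
  fixes A :: "'i \<Rightarrow> 'a::euclidean_space \<Rightarrow> real ^ 'n ^ 'n"
  assumes "\<And>a b. unif_C m U (\<lambda>i x. A i x $ a $ b)"
  shows "unif_C m U (\<lambda>i x. det (A i x))"
  unfolding det_def
  by (intro unif_C_sum unif_C_mult unif_C_prod unif_C_const[where C = 1] assms)
     (use unif_C_open[OF assms] in \<open>auto simp: sign_def\<close>)

lemma abs_det_le:
  fixes B :: "real ^ 'n ^ 'n"
  assumes "\<And>a b. \<bar>B $ a $ b\<bar> \<le> D"
  shows "\<bar>det B\<bar> \<le> fact CARD('n) * D ^ CARD('n)"
proof -
  have "\<bar>of_int (sign p) * (\<Prod>i\<in>UNIV. B $ i $ p i)\<bar> \<le> D ^ CARD('n)" for p :: "'n \<Rightarrow> 'n"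
    using prod_mono[of UNIV "\<lambda>i. \<bar>B $ i $ p i\<bar>" "\<lambda>_. D"] assms
    by (auto simp: abs_mult abs_prod sign_def)
  then have "\<bar>det B\<bar> \<le> (\<Sum>p\<in>{p :: 'n \<Rightarrow> 'n. p permutes UNIV}. D ^ CARD('n))"
    unfolding det_def real_norm_def[symmetric] by (intro sum_norm_le) simp
  also have "\<dots> = fact CARD('n) * D ^ CARD('n)"
    using card_permutations[of "UNIV :: 'n set" "CARD('n)"] by simp
  finally show ?thesis .
qed

text \<open>The hypothesis bounds the entries of the inverse matrix by 1/c, hence its determinant
  from above, and the two determinants multiply to 1.\<close>

lemma abs_det_lower_bound:
  fixes A :: "real ^ 'n ^ 'n"
  assumes "c > 0" "\<And>v. c * norm v \<le> norm (A *v v)"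
  shows "1 / (fact CARD('n) * (1 / c) ^ CARD('n)) \<le> \<bar>det A\<bar>"
proof -
  have "inj ((*v) A)"
  proof (rule injI)
    fix v w assume "A *v v = A *v w"
    then show "v = w" using assms(2)[of "v - w"] assms(1)
      by (simp add: matrix_vector_mult_diff_distrib mult_le_0_iff)
  qed
  then obtain B where B: "B ** A = mat 1" using matrix_left_invertible_injective by blast
  then have B': "A ** B = mat 1" using matrix_left_right_inverse by blast
  have "norm (B *v w) \<le> (1 / c) * norm w" for w
    using assms(2)[of "B *v w"] assms(1) B' by (simp add: matrix_vector_mul_assoc field_simps)
  then have "norm (B *v axis b 1) \<le> 1 / c" for b using norm_axis_1[of b] by (metis mult.right_neutral)
  then have "\<bar>B $ a $ b\<bar> \<le> 1 / c" for a b
    using component_le_norm_cart[of "B *v axis b 1" a] order_trans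
    by (fastforce simp: matrix_vector_mult_basis column_def)
  then have "\<bar>det B\<bar> \<le> fact CARD('n) * (1 / c) ^ CARD('n)" by (rule abs_det_le)
  moreover have "\<bar>det A\<bar> * \<bar>det B\<bar> = 1"
    using B' by (metis abs_mult abs_one det_I det_mul)
  moreover have "(0::real) < fact CARD('n) * (1 / c) ^ CARD('n)" using assms(1) by simp
  ultimately show ?thesis
    by (smt (verit, ccfv_SIG) abs_ge_zero divide_le_eq mult.commute mult_left_mono)
qed

text \<open>No regularity of \<open>X\<close> is assumed: Cramer's rule exhibits each component as a
  quotient of determinants whose denominator is bounded away from 0.\<close>

lemma unif_C_solve:
  fixes A :: "'i \<Rightarrow> 'a::euclidean_space \<Rightarrow> real ^ 'n ^ 'n"
  assumes A: "\<And>a b. unif_C m U (\<lambda>i x. A i x $ a $ b)" and W: "unif_C m U W"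
    and c: "c > 0" "\<And>i x v. x \<in> U i \<Longrightarrow> c * norm v \<le> norm (A i x *v v)"
    and X: "\<And>i x. x \<in> U i \<Longrightarrow> A i x *v X i x = W i x"
  shows "unif_C m U X"
proof -
  define d where "d = 1 / (fact CARD('n) * (1 / c) ^ CARD('n))"
  have d: "d > 0" "\<And>i x. x \<in> U i \<Longrightarrow> d \<le> \<bar>det (A i x)\<bar>"
    using c by (auto simp: d_def intro!: abs_det_lower_bound)
  define N where "N k i x = (\<chi> a b. if b = k then W i x $ a else A i x $ a $ b)" for k i x
  have N: "unif_C m U (\<lambda>i x. N k i x $ a $ b)" for k a b
    using A[of a b] unif_C_vec_nth[OF W, of a] by (cases "b = k") (simp_all add: N_def)
  have "unif_C m U (\<lambda>i x. (\<chi> k. det (N k i x) * inverse (det (A i x))))"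
    by (rule unif_C_vec) (simp add: unif_C_mult unif_C_det[OF N] unif_C_inverse[OF unif_C_det[OF A] d])
  then show ?thesis
  proof (rule unif_C_cong)
    fix i x assume x: "x \<in> U i"
    then have "det (A i x) \<noteq> 0" using d(2)[OF x] d(1) by auto
    from cramer[OF this, of "X i x" "W i x"] X[OF x]
    show "(\<chi> k. det (N k i x) * inverse (det (A i x))) = X i x"
      by (simp add: N_def divide_inverse)
  qed
qed

lemma unif_C_deriv_lipschitz:
  fixes F :: "'i \<Rightarrow> 'a::euclidean_space \<Rightarrow> 'b::real_normed_vector"
  assumes "unif_C (Suc (Suc m)) U F" "\<And>i. convex (U i)"
  obtains L where "L > 0" "\<And>i x y v. x \<in> U i \<Longrightarrow> y \<in> U i \<Longrightarrow>
    norm (fderiv F i x v - fderiv F i y v) \<le> L * norm (x - y) * norm v"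
proof -
  have "\<forall>b. \<exists>C>0. \<forall>i. \<forall>x\<in>U i. \<forall>y\<in>U i.
     norm (fderiv F i x b - fderiv F i y b) \<le> C * norm (x - y)"
    using unif_C_lipschitz[OF unif_C_SucD[OF assms(1)] assms(2)] by metis
  then obtain C where C: "\<And>b. C b > 0" "\<And>b i x y. x \<in> U i \<Longrightarrow> y \<in> U i \<Longrightarrow>
     norm (fderiv F i x b - fderiv F i y b) \<le> C b * norm (x - y)"
    by metis
  define L where "L = (\<Sum>b\<in>(Basis::'a set). C b)"
  have "norm (fderiv F i x v - fderiv F i y v) \<le> L * norm (x - y) * norm v"
    if xy: "x \<in> U i" "y \<in> U i" for i x y v
  proof -
    have *: "fderiv F i x v = (\<Sum>b\<in>Basis. (v \<bullet> b) *\<^sub>R fderiv F i x b)"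
      if "x \<in> U i" for x
      using linear_eq_sum_Basis unif_C_has_derivative[OF assms(1) that] has_derivative_linear by blast
    have "fderiv F i x v - fderiv F i y v
      = (\<Sum>b\<in>Basis. (v \<bullet> b) *\<^sub>R (fderiv F i x b - fderiv F i y b))"
      using *[OF xy(1)] *[OF xy(2)] by (simp add: scaleR_diff_right sum_subtractf)
    also have "norm \<dots> \<le> (\<Sum>b\<in>Basis. C b * norm (x - y) * norm v)"
    proof (rule sum_norm_le)
      fix b :: 'a assume "b \<in> Basis"
      then have "norm v * (C b * norm (x - y)) \<ge> \<bar>v \<bullet> b\<bar> * norm (fderiv F i x b - fderiv F i y b)"
        using C(2)[OF xy, of b] Basis_le_norm[of b v] by (intro mult_mono) auto
      then show "norm ((v \<bullet> b) *\<^sub>R (fderiv F i x b - fderiv F i y b)) \<le> C b * norm (x - y) * norm v"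
        by (simp add: mult.commute)
    qed
    finally show ?thesis by (simp add: L_def sum_distrib_right)
  qed
  moreover have "L > 0" unfolding L_def by (intro sum_pos) (use C(1) in auto)
  ultimately show ?thesis using that by blast
qed

text \<open>The parameter interval is an open neighbourhood of [0, 1] because members of a family
  live on open sets. Each order is then obtained by differentiating under the integral sign.\<close>

lemma unif_C_integral:
  fixes P :: "'i \<Rightarrow> 'a::euclidean_space \<times> real \<Rightarrow> 'c::euclidean_space"
  assumes "unif_C m (\<lambda>i. U i \<times> {-1<..<2}) P" "\<And>i. open (U i)"
  shows "unif_C m U (\<lambda>i x. integral {0..1} (\<lambda>t. P i (x, t)))"
  using assms(1)
proof (induction m arbitrary: P)
  case (0 P)
  have cont: "continuous_on (U i \<times> cbox 0 1) (P i)" for i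
    by (rule continuous_on_subset[OF unif_C_continuous[OF 0]]) auto
  have cont1: "continuous_on {0..1} (\<lambda>t. P i (x, t))" if "x \<in> U i" for i x
    by (rule continuous_on_compose2[OF cont[of i]]) (use that in \<open>auto intro!: continuous_intros\<close>)
  obtain C where C: "\<And>i z. z \<in> U i \<times> {-1<..<2} \<Longrightarrow> norm (P i z) \<le> C" using unif_C_bounded[OF 0] by metis
  show ?case
  proof (rule unif_C_0I)
    show "continuous_on (U i) (\<lambda>x. integral {0..1} (\<lambda>t. P i (x, t)))" for i
      using integral_continuous_on_param[of "U i" 0 "1::real" "\<lambda>x t. P i (x, t)"] cont by simp
    show "norm (integral {0..1} (\<lambda>t. P i (x, t))) \<le> C" if "x \<in> U i" for i x
      using integral_bound[of 0 1 "\<lambda>t. P i (x, t)" C] cont1[OF that] C that by auto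
  qed (use assms(2) in auto)
next
  case (Suc m P)
  have cont: "continuous_on (U i \<times> cbox 0 1) (P i)" for i
    by (rule continuous_on_subset[OF unif_C_continuous[OF Suc.prems]]) auto
  have cont1: "continuous_on {0..1} (\<lambda>t. P i (x, t))" if "x \<in> U i" for i x
    by (rule continuous_on_compose2[OF cont[of i]]) (use that in \<open>auto intro!: continuous_intros\<close>)
  obtain C where C: "\<And>i z. z \<in> U i \<times> {-1<..<2} \<Longrightarrow> norm (P i z) \<le> C" using unif_C_bounded[OF Suc.prems] by metis
  show ?case
  proof (rule unif_C_SucI[where F' = "\<lambda>i x v. integral {0..1} (\<lambda>t. fderiv P i (x, t) (v, 0))"])
    show "norm (integral {0..1} (\<lambda>t. P i (x, t))) \<le> C" if "x \<in> U i" for i x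
      using integral_bound[of 0 1 "\<lambda>t. P i (x, t)" C] cont1[OF that] C that by auto
    show "unif_C m U (\<lambda>i x. integral {0..1} (\<lambda>t. fderiv P i (x, t) (v, 0)))" for v
      by (rule Suc.IH[OF unif_C_SucD[OF Suc.prems]])
    fix i x assume x: "x \<in> U i"
    obtain e where e: "e > 0" "ball x e \<subseteq> U i" using assms(2)[of i] x open_contains_ball by metis
    \<comment> \<open>The Leibniz rule takes the partial derivative as a continuous map into the
      space of bounded linear maps; evaluation at \<open>v\<close> recovers the directional
      derivative at the end.\<close>
    define fx where "fx y t = Blinfun (\<lambda>v. fderiv P i (y, t) (v, 0))" for y t
    have fx: "blinfun_apply (fx y t) = (\<lambda>v. fderiv P i (y, t) (v, 0))"
      "((\<lambda>y. P i (y, t)) has_derivative blinfun_apply (fx y t)) (at y)"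
      if "y \<in> U i" "t \<in> {0..1}" for y t
    proof -
      have d: "(P i has_derivative fderiv P i (y, t)) (at (y, t))"
        by (rule unif_C_has_derivative[OF Suc.prems]) (use that in auto)
      have "((\<lambda>y. (y, t)) has_derivative (\<lambda>v. (v, 0))) (at y)"
        by (auto intro!: derivative_eq_intros)
      from diff_chain_at[OF this d] have d2: "((\<lambda>y. P i (y, t)) has_derivative (\<lambda>v. fderiv P i (y, t) (v, 0))) (at y)"
        by (simp add: o_def)
      then show 1: "blinfun_apply (fx y t) = (\<lambda>v. fderiv P i (y, t) (v, 0))"
        unfolding fx_def by (intro bounded_linear_Blinfun_apply has_derivative_bounded_linear)
      show "((\<lambda>y. P i (y, t)) has_derivative blinfun_apply (fx y t)) (at y)" using d2 1 by simp
    qed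
    have contfx: "continuous_on (U i \<times> cbox 0 1) (\<lambda>(y, t). fx y t)"
    proof (rule continuous_on_blinfun_componentwise)
      fix b :: 'a assume "b \<in> Basis"
      have "continuous_on (U i \<times> cbox 0 1) (\<lambda>z. fderiv P i z (b, 0))"
        by (rule continuous_on_subset[OF unif_C_continuous[OF unif_C_SucD[OF Suc.prems]]]) auto
      then show "continuous_on (U i \<times> cbox 0 1) (\<lambda>z. blinfun_apply (case z of (y, t) \<Rightarrow> fx y t) b)"
        by (rule continuous_on_eq) (use fx(1) in auto)
    qed
    have "((\<lambda>y. integral (cbox 0 1) (\<lambda>t. P i (y, t))) has_derivative integral (cbox 0 1) (fx x)) (at x within ball x e)"
    proof (rule leibniz_rule)
      show "((\<lambda>y. P i (y, t)) has_derivative blinfun_apply (fx y t)) (at y within ball x e)"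
        if "y \<in> ball x e" "t \<in> cbox 0 1" for y t
        by (rule has_derivative_at_withinI[OF fx(2)]) (use that e(2) in auto)
      show "(\<lambda>t. P i (y, t)) integrable_on cbox 0 1" if "y \<in> ball x e" for y
        using cont1[of y i] that e(2) by (intro integrable_continuous) auto
      show "continuous_on (ball x e \<times> cbox 0 1) (\<lambda>(y, t). fx y t)"
        by (rule continuous_on_subset[OF contfx]) (use e(2) in auto)
    qed (use e(1) in auto)
    then have d3: "((\<lambda>y. integral {0..1} (\<lambda>t. P i (y, t))) has_derivative integral (cbox 0 1) (fx x)) (at x)"
      using e(1) by (simp add: at_within_open[of x "ball x e"])
    have "continuous_on (cbox 0 1) (\<lambda>t. case (x, t) of (y, t) \<Rightarrow> fx y t)"
      by (rule continuous_on_compose2[OF contfx]) (use x in \<open>auto intro!: continuous_intros\<close>)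
    then have "continuous_on (cbox 0 1) (fx x)" by simp
    then have "fx x integrable_on cbox 0 1" by (rule integrable_continuous)
    then have "blinfun_apply (integral (cbox 0 1) (fx x)) v = integral {0..1} (\<lambda>t. fderiv P i (x, t) (v, 0))" for v
      using fx(1)[OF x] by (auto simp: blinfun_apply_integral intro!: integral_cong)
    then have "blinfun_apply (integral (cbox 0 1) (fx x)) = (\<lambda>v. integral {0..1} (\<lambda>t. fderiv P i (x, t) (v, 0)))" by auto
    with d3 show "((\<lambda>x. integral {0..1} (\<lambda>t. P i (x, t))) has_derivative (\<lambda>v. integral {0..1} (\<lambda>t. fderiv P i (x, t) (v, 0)))) (at x)"
      by simp
  qed (use assms(2) in auto)
qed

text \<open>The radii are computed from \<open>c\<close> and a Lipschitz constant of the derivative.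
  Both are common to the whole family, so the radii do not depend on the index.\<close>

lemma unif_inverse_function:
  fixes \<Phi> :: "'i \<Rightarrow> real ^ 'n \<Rightarrow> real ^ 'n"
  assumes \<Phi>: "unif_C (Suc (Suc m)) (fam_ball V r) \<Phi>" and r: "r > 0" and c: "c > 0"
    and zero: "\<And>i. i \<in> V \<Longrightarrow> \<Phi> i 0 = 0"
    and der: "\<And>i v. i \<in> V \<Longrightarrow> c * norm v \<le> norm (fderiv \<Phi> i 0 v)"
  obtains \<rho> \<sigma> where "0 < \<rho>" "\<rho> \<le> r" "0 < \<sigma>" "\<And>i. i \<in> V \<Longrightarrow> inj_on (\<Phi> i) (ball 0 \<rho>)"
    "\<And>i. i \<in> V \<Longrightarrow> open (\<Phi> i ` ball 0 \<rho>)" "\<And>i. i \<in> V \<Longrightarrow> ball 0 \<sigma> \<subseteq> \<Phi> i ` ball 0 \<rho>"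
    "unif_C (Suc (Suc m)) (\<lambda>i. if i \<in> V then \<Phi> i ` ball 0 \<rho> else {}) (\<lambda>i. inv_into (ball 0 \<rho>) (\<Phi> i))"
proof -
  let ?D = "\<lambda>i x. fderiv \<Phi> i x"
  obtain L where L: "L > 0" "\<And>i x y v. x \<in> fam_ball V r i \<Longrightarrow> y \<in> fam_ball V r i \<Longrightarrow>
    norm (?D i x v - ?D i y v) \<le> L * norm (x - y) * norm v"
    using unif_C_deriv_lipschitz[OF \<Phi>] convex_fam_ball by metis
  \<comment> \<open>On this radius the derivative differs from the one at 0 by at most c/2, so
    \<open>\<Phi> i\<close> stretches distances by a factor of at least c/2
    (\<open>exp\<close>).\<close>
  define \<rho> where "\<rho> = min r (c / (2 * L))"
  \<comment> \<open>By the stretching estimate, a point of \<open>ball 0 \<sigma>\<close> with a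
    preimage in \<open>ball 0 \<rho>\<close> has it already in the compact ball of radius
    \<open>\<rho> / 2\<close>.\<close>
  define \<sigma> where "\<sigma> = c / 2 * (\<rho> / 2)"
  have \<rho>: "0 < \<rho>" "\<rho> \<le> r" using r c L by (auto simp: \<rho>_def)
  have "\<rho> \<le> c / (2 * L)" by (simp add: \<rho>_def)
  then have \<rho>L: "L * \<rho> \<le> c / 2" using L(1) by (simp add: field_simps)
  have \<sigma>: "0 < \<sigma>" using \<rho> c by (simp add: \<sigma>_def)
  have hd: "(\<Phi> i has_derivative ?D i x) (at x)" if "i \<in> V" "norm x < \<rho>" for i x
    by (rule unif_C_has_derivative[OF \<Phi>]) (use that \<rho> in auto)
  have lin: "linear (?D i x)" if "i \<in> V" "norm x < \<rho>" for i x
    using hd[OF that] has_derivative_linear by blast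
  have near: "norm (?D i x v - ?D i 0 v) \<le> c / 2 * norm v" if "i \<in> V" "norm x < \<rho>" for i x v
  proof -
    have "norm (?D i x v - ?D i 0 v) \<le> L * norm x * norm v"
      using L(2)[of x i 0 v] that \<rho> by simp
    also have "\<dots> \<le> c / 2 * norm v"
      using \<rho>L that(2) L(1) by (intro mult_right_mono) (smt (verit) mult_left_mono, simp)
    finally show ?thesis .
  qed
  have low: "c / 2 * norm v \<le> norm (?D i x v)" if "i \<in> V" "norm x < \<rho>" for i x v
    using near[OF that, of v] der[OF that(1), of v] norm_triangle_ineq2[of "?D i 0 v" "?D i x v"]
    by (simp add: norm_minus_commute)
  have exp: "c / 2 * norm (x - y) \<le> norm (\<Phi> i x - \<Phi> i y)" if i: "i \<in> V" and xy: "norm x < \<rho>" "norm y < \<rho>" for i x y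
  proof -
    have "norm ((\<Phi> i x - ?D i 0 x) - (\<Phi> i y - ?D i 0 y)) \<le> c / 2 * norm (x - y)"
    proof (rule differentiable_bound[of "ball 0 \<rho>" "\<lambda>x. \<Phi> i x - ?D i 0 x" "\<lambda>x v. ?D i x v - ?D i 0 v"])
      show "((\<lambda>x. \<Phi> i x - ?D i 0 x) has_derivative (\<lambda>v. ?D i z v - ?D i 0 v)) (at z within ball 0 \<rho>)" if "z \<in> ball 0 \<rho>" for z
        by (intro has_derivative_diff has_derivative_at_withinI[OF hd[OF i]]
              linear_imp_has_derivative lin i) (use that \<rho> in auto)
      show "onorm (\<lambda>v. ?D i z v - ?D i 0 v) \<le> c / 2" if "z \<in> ball 0 \<rho>" for z
        by (rule onorm_le) (use near[OF i, of z] that in auto)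
    qed (use xy in auto)
    then have "norm ((\<Phi> i x - \<Phi> i y) - ?D i 0 (x - y)) \<le> c / 2 * norm (x - y)"
      using lin[OF i, of 0] \<rho> by (simp add: linear_diff algebra_simps)
    then show ?thesis
      using der[OF i, of "x - y"] norm_triangle_ineq2[of "?D i 0 (x - y)" "\<Phi> i x - \<Phi> i y"]
      by (simp add: norm_minus_commute)
  qed
  have inj: "inj_on (\<Phi> i) (ball 0 \<rho>)" if "i \<in> V" for i
  proof (rule inj_onI)
    fix x y assume "x \<in> ball 0 \<rho>" "y \<in> ball 0 \<rho>" "\<Phi> i x = \<Phi> i y"
    then show "x = y" using exp[OF that, of x y] c by (simp add: mult_le_0_iff)
  qed
  have cont: "continuous_on (ball 0 \<rho>) (\<Phi> i)" if "i \<in> V" for i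
    by (intro continuous_at_imp_continuous_on ballI has_derivative_continuous[OF hd[OF that]]) simp
  have op: "open (\<Phi> i ` ball 0 s)" if "i \<in> V" "s \<le> \<rho>" for i s
    by (rule invariance_of_domain[OF continuous_on_subset[OF cont[OF that(1)]] open_ball inj_on_subset[OF inj[OF that(1)]]])
       (use that(2) in auto)
  have surj: "ball 0 \<sigma> \<subseteq> \<Phi> i ` ball 0 \<rho>" if i: "i \<in> V" for i
  proof -
    \<comment> \<open>This set is open in \<open>ball 0 \<sigma>\<close> by invariance of domain and
      closed because it is also the trace of a compact image; by connectedness it is the whole
      ball.\<close>
    let ?T = "\<Phi> i ` ball 0 \<rho> \<inter> ball 0 \<sigma>"
    have "?T = \<Phi> i ` cball 0 (\<rho> / 2) \<inter> ball 0 \<sigma>"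
    proof (intro equalityI subsetI)
      fix y assume "y \<in> ?T"
      then obtain x where x: "norm x < \<rho>" "y = \<Phi> i x" "norm y < \<sigma>" by auto
      have "c / 2 * norm x < c / 2 * (\<rho> / 2)"
        using exp[OF i x(1), of 0] zero[OF i] x \<rho> by (simp add: \<sigma>_def)
      then have "norm x \<le> \<rho> / 2" using c by (simp add: field_simps)
      then show "y \<in> \<Phi> i ` cball 0 (\<rho> / 2) \<inter> ball 0 \<sigma>" using x by auto
    qed (use \<rho> in auto)
    moreover have "compact (\<Phi> i ` cball 0 (\<rho> / 2))"
      by (rule compact_continuous_image[OF continuous_on_subset[OF cont[OF i]]]) (use \<rho> in auto)
    ultimately have "closedin (top_of_set (ball 0 \<sigma>)) ?T"
      by (metis closedin_closed_Int compact_imp_closed inf_commute)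
    moreover have "openin (top_of_set (ball 0 \<sigma>)) ?T"
      using op[OF i, of \<rho>] by (metis inf_commute openin_open_Int order_refl)
    moreover have "0 \<in> ?T" using zero[OF i] \<rho> \<sigma> by (force simp: image_iff)
    ultimately have "?T = ball 0 \<sigma>"
      using connected_clopen[of "ball (0::real^'n) \<sigma>"] connected_ball by blast
    then show ?thesis by blast
  qed
  define W where "W i = (if i \<in> V then \<Phi> i ` ball 0 \<rho> else {})" for i
  define \<Theta> where "\<Theta> i = inv_into (ball 0 \<rho>) (\<Phi> i)" for i
  have openW: "open (W i)" for i using op[of i \<rho>] by (auto simp: W_def)
  have \<Theta>: "i \<in> V" "norm (\<Theta> i y) < \<rho>" "\<Phi> i (\<Theta> i y) = y" if "y \<in> W i" for i y
    using that inv_into_into[of y "\<Phi> i" "ball 0 \<rho>"] f_inv_into_f[of y "\<Phi> i" "ball 0 \<rho>"]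
    by (auto simp: W_def \<Theta>_def split: if_splits)
  have cont\<Theta>: "continuous_on (W i) (\<Theta> i)" for i
  proof (rule continuous_onI)
    fix y e assume y: "y \<in> W i" and e: "0 < (e::real)"
    have "dist (\<Theta> i z) (\<Theta> i y) \<le> e" if "z \<in> W i" "dist z y < c / 2 * e" for z
    proof -
      have "c / 2 * norm (\<Theta> i z - \<Theta> i y) \<le> c / 2 * e"
        using exp[OF \<Theta>(1,2)[OF that(1)] \<Theta>(2)[OF y]] \<Theta>(3)[OF y] \<Theta>(3)[OF that(1)] that(2)
        by (simp add: dist_norm)
      then show ?thesis using c by (simp add: dist_norm)
    qed
    then show "\<exists>d>0. \<forall>x'\<in>W i. dist x' y < d \<longrightarrow> dist (\<Theta> i x') (\<Theta> i y) \<le> e"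
      using c e by (intro exI[of _ "c / 2 * e"]) auto
  qed
  define N where "N i x = inv (?D i x)" for i x
  have injD: "inj (?D i x)" if "i \<in> V" "norm x < \<rho>" for i x
  proof (rule injI)
    fix v w assume "?D i x v = ?D i x w"
    then show "v = w" using low[OF that, of "v - w"] lin[OF that] c by (simp add: linear_diff mult_le_0_iff)
  qed
  have DN: "?D i x (N i x v) = v" if "i \<in> V" "norm x < \<rho>" for i x v
    unfolding N_def using linear_injective_imp_surjective[OF lin[OF that] injD[OF that]] surj_f_inv_f by metis
  \<comment> \<open>\<open>N i x v\<close> solves a linear system whose matrix is the Jacobian, so
    it inherits the regularity of the Jacobian, one order below that of
    \<open>\<Phi>\<close>.\<close>
  have unifN: "unif_C (Suc m) (fam_ball V \<rho>) (\<lambda>i x. N i x v)" for v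
  proof (rule unif_C_solve[where A = "\<lambda>i x. matrix (?D i x)" and W = "\<lambda>i x. v" and c = "c / 2"])
    have "unif_C (Suc m) (fam_ball V \<rho>) (\<lambda>i x. ?D i x (axis b 1) $ a)" for a b
      by (rule unif_C_subset[OF unif_C_vec_nth[OF unif_C_SucD[OF \<Phi>]]]) (use \<rho> in auto)
    then show "unif_C (Suc m) (fam_ball V \<rho>) (\<lambda>i x. matrix (?D i x) $ a $ b)" for a b
      by (simp add: matrix_def)
    have "matrix (?D i x) *v w = ?D i x w" if "i \<in> V" "norm x < \<rho>" for i x w
      using matrix_works[of "?D i x"] lin[OF that] by (simp add: linear_matrix_vector_mul_eq)
    then show "c / 2 * norm w \<le> norm (matrix (?D i x) *v w)" "matrix (?D i x) *v N i x v = v"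
      if "x \<in> fam_ball V \<rho> i" for i x w
      using that low DN by auto
    show "unif_C (Suc m) (fam_ball V \<rho>) (\<lambda>i x. v)"
      by (rule unif_C_const[where C = "norm v"]) auto
  qed (use c in auto)
  have hd\<Theta>: "(\<Theta> i has_derivative N i (\<Theta> i y)) (at y)" if "y \<in> W i" for i y
  proof (rule has_derivative_inverse_basic[where f = "\<Phi> i" and f' = "?D i (\<Theta> i y)" and T = "W i"])
    show "(\<Phi> i has_derivative ?D i (\<Theta> i y)) (at (\<Theta> i y))" by (rule hd[OF \<Theta>(1,2)[OF that]])
    show "bounded_linear (N i (\<Theta> i y))"
      unfolding N_def using lin[OF \<Theta>(1,2)[OF that]] injD[OF \<Theta>(1,2)[OF that]]
      by (simp add: inj_linear_imp_inv_linear linear_conv_bounded_linear[symmetric])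
    show "N i (\<Theta> i y) \<circ> ?D i (\<Theta> i y) = id"
      unfolding N_def using injD[OF \<Theta>(1,2)[OF that]] by simp
    show "continuous (at y) (\<Theta> i)"
      using cont\<Theta> openW that continuous_on_eq_continuous_at by blast
  qed (use openW that \<Theta> in auto)
  \<comment> \<open>Bootstrapping: the derivative of the inverse is \<open>N i\<close> evaluated at
    the inverse, so each order of regularity of \<open>\<Theta>\<close> yields the next.\<close>
  have "m' \<le> Suc (Suc m) \<Longrightarrow> unif_C m' W \<Theta>" for m'
  proof (induction m')
    case 0
    show ?case by (rule unif_C_0I[where C = \<rho>]) (use openW cont\<Theta> \<Theta> in \<open>auto intro: less_imp_le\<close>)
  next
    case (Suc m')
    show ?case
    proof (rule unif_C_SucI[OF openW hd\<Theta>])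
      show "unif_C m' W (\<lambda>i y. N i (\<Theta> i y) v)" for v
        by (rule unif_C_compose[where F = "\<lambda>i x. N i x v" and V = "fam_ball V \<rho>"])
           (use Suc unif_C_le[OF unifN] \<Theta> in auto)
      show "norm (\<Theta> i y) \<le> \<rho>" if "y \<in> W i" for i y using \<Theta>(2)[OF that] by simp
    qed auto
  qed
  then have "unif_C (Suc (Suc m)) W \<Theta>" by simp
  then show ?thesis
    using that[of \<rho> \<sigma>] \<rho> \<sigma> inj op surj unfolding W_def \<Theta>_def by simp
qed

section \<open>Eliminating one variable\<close>

lemma unif_C_bounded_linear:
  assumes "\<And>i. open (U i)" "bounded_linear T" "\<And>i x. x \<in> U i \<Longrightarrow> norm x \<le> D"
  shows "unif_C m U (\<lambda>i x. T x)"
proof -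
  obtain C where C: "C \<ge> 0" "\<And>x. norm (T x) \<le> C * norm x"
    using bounded_linear.nonneg_bounded[OF assms(2)] by (metis mult.commute)
  have "norm (T x) \<le> C * D" if "x \<in> U i" for i x
    using C(2)[of x] mult_left_mono[OF assms(3)[OF that] C(1)] by linarith
  then have "unif_C m U (\<lambda>i x. 0 + T x)"
    by (intro unif_C_affine[where C = C and D = "C * D"]) (use assms C in auto)
  then show ?thesis by simp
qed

text \<open>No derivative is lost, because \<open>s Dw = D(s w) - w Ds\<close>.\<close>

lemma unif_C_mult_powr:
  fixes s w :: "'i \<Rightarrow> 'a::euclidean_space \<Rightarrow> real"
  assumes s: "unif_C (Suc (Suc m)) U s" and w: "unif_C (Suc m) U w"
    and sw: "unif_C (Suc (Suc m)) U (\<lambda>i x. s i x * w i x)"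
    and c: "c > 0" "\<And>i x. x \<in> U i \<Longrightarrow> w i x \<ge> c"
  shows "unif_C (Suc (Suc m)) U (\<lambda>i x. s i x * w i x powr a)"
proof -
  have op: "open (U i)" for i using unif_C_open[OF s] .
  have s': "unif_C (Suc m) U s" by (rule unif_C_Suc_imp[OF s])
  have p: "unif_C (Suc m) U (\<lambda>i x. w i x powr a)" for a by (rule unif_C_powr[OF w c])
  obtain C where C: "\<And>i x. x \<in> U i \<Longrightarrow> norm (s i x * w i x powr a) \<le> C"
    using unif_C_bounded[OF unif_C_mult[OF s' p]] by metis
  show ?thesis
  proof (rule unif_C_SucI[OF op _ _ C])
    let ?F' = "\<lambda>i x v. fderiv s i x v * w i x powr a + a * (w i x powr (a - 1) *
      (frechet_derivative (\<lambda>x. s i x * w i x) (at x) v - w i x * fderiv s i x v))"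
    show "unif_C (Suc m) U (\<lambda>i x. ?F' i x v)" for v
      by (intro unif_C_add unif_C_mult unif_C_minus p w unif_C_SucD[OF s] unif_C_SucD[OF sw] unif_C_const[where C = "\<bar>a\<bar>"])
         (use op in auto)
    fix i x assume x: "x \<in> U i"
    have pos: "w i x > 0" using c(2)[OF x] c(1) by linarith
    note ds = unif_C_has_derivative[OF s x] and dw = unif_C_has_derivative[OF w x]
    have "frechet_derivative (\<lambda>x. s i x * w i x) (at x) = (\<lambda>v. s i x * fderiv w i x v + fderiv s i x v * w i x)"
      by (rule frechet_derivative_at[symmetric]) (rule has_derivative_mult[OF ds dw])
    then show "((\<lambda>x. s i x * w i x powr a) has_derivative ?F' i x) (at x)"
      using pos ds dw by (auto intro!: derivative_eq_intros simp: powr_diff field_simps)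
  qed
qed

definition zero_on :: "'n set \<Rightarrow> real ^ 'n \<Rightarrow> real ^ 'n" where
  "zero_on J x = (\<chi> a. if a \<in> J then 0 else x $ a)"

lemma zero_on_nth [simp]: "zero_on J x $ a = (if a \<in> J then 0 else x $ a)"
  by (simp add: zero_on_def)

lemma norm_zero_on_le: "norm (zero_on J x) \<le> norm x"
  by (rule norm_le_componentwise_cart) auto

lemma linear_zero_on: "linear (zero_on J)"
  by (rule linearI) (auto simp: vec_eq_iff)

lemma zero_on_0 [simp]: "zero_on J 0 = 0"
  by (simp add: vec_eq_iff)

text \<open>The coordinates in \<open>J\<close> have been eliminated: \<open>F i\<close> no longer depends on them, and the remaining
  part of its Hessian at \<open>0\<close> is still diagonal with the original entries \<open>\<mu> i\<close>.\<close>

definition morse_state :: "nat \<Rightarrow> 'i set \<Rightarrow> real \<Rightarrow> ('i \<Rightarrow> 'n \<Rightarrow> real) \<Rightarrow> 'n set \<Rightarrow> ('i \<Rightarrow> real ^ 'n \<Rightarrow> real) \<Rightarrow> bool" where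
  "morse_state k V r \<mu> J F \<longleftrightarrow> r > 0 \<and> unif_C k (fam_ball V r) F \<and>
     (\<forall>i\<in>V. (\<forall>x. norm x < r \<longrightarrow> F i x = F i (zero_on J x)) \<and> (\<forall>v. fderiv F i 0 v = 0) \<and>
       (\<forall>v w. fderiv (\<lambda>i x. fderiv F i x v) i 0 w = (\<Sum>a\<in>-J. \<mu> i a * v $ a * w $ a)))"

lemma integral_one_minus: "integral {0..1::real} (\<lambda>t. (1 - t) * c) = c / 2"
proof -
  have "((\<lambda>t. (1 - t) * c) has_integral ((1 - 1\<^sup>2 / 2) * c - (0 - 0\<^sup>2 / 2) * c)) {0..1::real}"
    by (rule fundamental_theorem_of_calculus)
       (auto intro!: derivative_eq_intros simp flip: has_real_derivative_iff_has_vector_derivative)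
  then have "((\<lambda>t. (1 - t) * c) has_integral c / 2) {0..1::real}" by simp
  then show ?thesis by (rule integral_unique)
qed

text \<open>One elimination, with \<open>\<Phi>\<close> as the Morse coordinate that replaces
  coordinate \<open>j\<close>. Since \<open>F'\<close> has the same order as \<open>F\<close>, the
  step can be iterated; only the radius shrinks.\<close>

lemma morse_step:
  fixes F :: "'i \<Rightarrow> real ^ 'n \<Rightarrow> real"
  assumes st: "morse_state (Suc (Suc (Suc m))) V r \<mu> J F" and j: "j \<notin> J"
    and \<theta>: "\<theta> > 0" "\<And>i. i \<in> V \<Longrightarrow> \<theta> \<le> \<bar>\<mu> i j\<bar>"
  shows "\<exists>r' F' \<Phi>. r' \<le> r \<and> morse_state (Suc (Suc (Suc m))) V r' \<mu> (insert j J) F' \<and>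
    unif_C (Suc (Suc m)) (fam_ball V r') \<Phi> \<and>
    (\<forall>i\<in>V. (\<forall>x. norm x < r' \<longrightarrow> F i x = F' i x + sgn (\<mu> i j) * (\<Phi> i x)\<^sup>2) \<and> \<Phi> i 0 = 0 \<and>
      (\<forall>v. fderiv \<Phi> i 0 v = sqrt (\<bar>\<mu> i j\<bar> / 2) * v $ j))"
proof -
  let ?m = "Suc (Suc m)"
  define e :: "real ^ 'n" where "e = axis j 1"
  have e_nth: "e $ a = (if a = j then 1 else 0)" for a by (simp add: e_def axis_def)
  have norm_e: "norm e = 1" by (simp add: e_def norm_axis_1)
  have r: "r > 0" and F: "unif_C (Suc ?m) (fam_ball V r) F"
    and FJ: "\<And>i x. i \<in> V \<Longrightarrow> norm x < r \<Longrightarrow> F i x = F i (zero_on J x)"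
    and DF0: "\<And>i v. i \<in> V \<Longrightarrow> fderiv F i 0 v = 0"
    and D2F0: "\<And>i v w. i \<in> V \<Longrightarrow> fderiv (\<lambda>i x. fderiv F i x v) i 0 w = (\<Sum>a\<in>-J. \<mu> i a * v $ a * w $ a)"
    using st by (auto simp: morse_state_def)
  have dF: "(F i has_derivative fderiv F i x) (at x)" if "i \<in> V" "norm x < r" for i x
    by (rule unif_C_has_derivative[OF F]) (use that in auto)
  define p where "p i x = fderiv F i x e" for i x
  have p: "unif_C ?m (fam_ball V r) p" unfolding p_def by (rule unif_C_SucD[OF F])
  have dp: "(p i has_derivative fderiv p i x) (at x)" if "i \<in> V" "norm x < r" for i x
    by (rule unif_C_has_derivative[OF p]) (use that in auto)
  have dp0: "fderiv p i 0 v = \<mu> i j * v $ j" if "i \<in> V" for i v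
  proof -
    have "(\<Sum>a\<in>-J. \<mu> i a * e $ a * v $ a) = (\<Sum>a\<in>{j}. \<mu> i a * e $ a * v $ a)"
      by (rule sum.mono_neutral_right) (use j in \<open>auto simp: e_nth\<close>)
    then show ?thesis using D2F0[OF that, of e v] by (simp add: p_def[abs_def] e_nth)
  qed
  \<comment> \<open>Replacing coordinate j by the partial derivative \<open>p\<close> turns the
    equation p = 0 into inverting \<open>\<Psi>\<close> at points whose coordinate j is 0.\<close>
  define \<Psi> where "\<Psi> i x = x + (p i x - x $ j) *\<^sub>R e" for i x
  have \<Psi>: "unif_C ?m (fam_ball V r) \<Psi>"
    unfolding \<Psi>_def
    by (intro unif_C_add unif_C_scaleR unif_C_minus p unif_C_const[where C = 1]
        unif_C_bounded_linear[where D = r] bounded_linear_ident bounded_linear_vec_nth)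
       (auto simp: norm_e)
  have d\<Psi>0: "(\<Psi> i has_derivative (\<lambda>v. v + (\<mu> i j * v $ j - v $ j) *\<^sub>R e)) (at 0)" if "i \<in> V" for i
    using dp[OF that, of 0] r unfolding \<Psi>_def dp0[OF that]
    by (auto intro!: derivative_eq_intros bounded_linear_imp_has_derivative[OF bounded_linear_vec_nth])
  have \<Psi>_nth: "\<Psi> i x $ a = (if a = j then p i x else x $ a)" for i x a
    by (simp add: \<Psi>_def e_nth)
  have \<Psi>0: "\<Psi> i 0 = 0" if "i \<in> V" for i
    using DF0[OF that] by (simp add: \<Psi>_def p_def)
  \<comment> \<open>The Hessian of \<open>F\<close> at 0 being diagonal, so is the derivative of
    \<open>\<Psi>\<close> there: its entries are 1 except for \<open>\<mu> i j\<close> in position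
    j.\<close>
  have \<Psi>low: "min 1 \<theta> * norm v \<le> norm (fderiv \<Psi> i 0 v)" if "i \<in> V" for i v
  proof -
    have "norm (min 1 \<theta> *\<^sub>R v) \<le> norm (v + (\<mu> i j * v $ j - v $ j) *\<^sub>R e)"
      by (rule norm_le_componentwise_cart)
         (use \<theta>(1) \<theta>(2)[OF that] in \<open>auto simp: e_nth abs_mult intro!: mult_right_mono mult_left_le_one_le\<close>)
    moreover have "v + (\<mu> i j * v $ j - v $ j) *\<^sub>R e = fderiv \<Psi> i 0 v"
      using fun_cong[OF frechet_derivative_at[OF d\<Psi>0[OF that]], of v] by simp
    ultimately show ?thesis using \<theta>(1) by simp
  qed
  have c0: "0 < min 1 \<theta>" using \<theta>(1) by simp
  obtain \<rho> \<sigma> where \<rho>: "0 < \<rho>" "\<rho> \<le> r" and \<sigma>: "0 < \<sigma>" and inj: "\<And>i. i \<in> V \<Longrightarrow> inj_on (\<Psi> i) (ball 0 \<rho>)"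
    and opW: "\<And>i. i \<in> V \<Longrightarrow> open (\<Psi> i ` ball 0 \<rho>)" and sub: "\<And>i. i \<in> V \<Longrightarrow> ball 0 \<sigma> \<subseteq> \<Psi> i ` ball 0 \<rho>"
    and inv: "unif_C ?m (\<lambda>i. if i \<in> V then \<Psi> i ` ball 0 \<rho> else {}) (\<lambda>i. inv_into (ball 0 \<rho>) (\<Psi> i))"
    by (rule unif_inverse_function[OF \<Psi> r c0 \<Psi>0 \<Psi>low], assumption, assumption) (rule that; assumption)
  let ?\<pi> = "zero_on (insert j J)"
  have bl\<pi>: "bounded_linear ?\<pi>" using linear_zero_on by (simp add: linear_conv_bounded_linear)
  \<comment> \<open>The point on the line through \<open>?\<pi> x\<close> in direction
    \<open>e\<close> at which \<open>p\<close> vanishes. Clearing the coordinates in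
    \<open>J\<close> together with \<open>j\<close> makes \<open>F'\<close> independent of all of
    them.\<close>
  define Y where "Y i x = inv_into (ball 0 \<rho>) (\<Psi> i) (?\<pi> x)" for i x
  have \<pi>ball: "?\<pi> x \<in> \<Psi> i ` ball 0 \<rho>" if "i \<in> V" "norm x < \<sigma>" for i x
    using sub[OF that(1)] norm_zero_on_le[of "insert j J" x] that(2) by (meson le_less_trans mem_ball_0 subsetD)
  have Y: "unif_C ?m (fam_ball V \<sigma>) Y" unfolding Y_def
    by (rule unif_C_compose[OF inv]) (use \<pi>ball in \<open>auto intro!: unif_C_bounded_linear[where D = \<sigma>] bl\<pi>\<close>)
  have Yb: "norm (Y i x) < \<rho>" and \<Psi>Y: "\<Psi> i (Y i x) = ?\<pi> x" if "i \<in> V" "norm x < \<sigma>" for i x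
    using inv_into_into[OF \<pi>ball[OF that]] f_inv_into_f[OF \<pi>ball[OF that]] by (auto simp: Y_def)
  have Ynth: "Y i x $ a = ?\<pi> x $ a" if "i \<in> V" "norm x < \<sigma>" "a \<noteq> j" for i x a
    using \<Psi>Y[OF that(1,2)] \<Psi>_nth[of i "Y i x" a] that(3) by metis
  have pY: "p i (Y i x) = 0" if "i \<in> V" "norm x < \<sigma>" for i x
    using \<Psi>Y[OF that] \<Psi>_nth[of i "Y i x" j] by simp
  have Y0: "Y i 0 = 0" if "i \<in> V" for i
    using inv_into_f_f[OF inj[OF that], of 0] \<rho>(1) \<Psi>0[OF that] by (simp add: Y_def)
  have Ydec: "Y i x = ?\<pi> x + (Y i x $ j) *\<^sub>R e" if "i \<in> V" "norm x < \<sigma>" for i x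
    using Ynth[OF that] by (auto simp: vec_eq_iff e_nth)
  have dY: "(Y i has_derivative fderiv Y i x) (at x)" if "i \<in> V" "norm x < \<sigma>" for i x
    by (rule unif_C_has_derivative[OF Y]) (use that in auto)
  have dY': "(Y i has_derivative (\<lambda>v. ?\<pi> v + (fderiv Y i x v $ j) *\<^sub>R e)) (at x)" if i: "i \<in> V" and x: "norm x < \<sigma>" for i x
  proof (rule has_derivative_transform_within_open[where s = "ball 0 \<sigma>"])
    have "((\<lambda>y. Y i y $ j) has_derivative (\<lambda>v. fderiv Y i x v $ j)) (at x)"
      by (rule bounded_linear.has_derivative[OF bounded_linear_vec_nth dY[OF i x]])
    then show "((\<lambda>y. ?\<pi> y + (Y i y $ j) *\<^sub>R e) has_derivative (\<lambda>v. ?\<pi> v + (fderiv Y i x v $ j) *\<^sub>R e)) (at x)"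
      by (intro has_derivative_add has_derivative_scaleR_left bounded_linear_imp_has_derivative[OF bl\<pi>])
  qed (use i x Ydec in auto)
  have DY0: "fderiv Y i 0 v = ?\<pi> v" if i: "i \<in> V" for i v
  proof -
    let ?y = "fderiv Y i 0 v"
    have "((\<lambda>x. \<Psi> i (Y i x)) has_derivative (\<lambda>v. fderiv Y i 0 v + (\<mu> i j * fderiv Y i 0 v $ j - fderiv Y i 0 v $ j) *\<^sub>R e)) (at 0)"
    proof -
      have "(\<Psi> i has_derivative (\<lambda>v. v + (\<mu> i j * v $ j - v $ j) *\<^sub>R e)) (at (Y i 0))"
        unfolding Y0[OF i] by (rule d\<Psi>0[OF i])
      from diff_chain_at[OF dY[OF i] this] \<sigma> show ?thesis by (simp add: o_def)
    qed
    then have "(?\<pi> has_derivative (\<lambda>v. fderiv Y i 0 v + (\<mu> i j * fderiv Y i 0 v $ j - fderiv Y i 0 v $ j) *\<^sub>R e)) (at 0)"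
      by (rule has_derivative_transform_within_open[where s = "ball 0 \<sigma>"]) (use i \<sigma> \<Psi>Y in auto)
    from fun_cong[OF has_derivative_unique[OF this bounded_linear_imp_has_derivative[OF bl\<pi>]], of v]
    have *: "?y + (\<mu> i j * ?y $ j - ?y $ j) *\<^sub>R e = ?\<pi> v" by simp
    \<comment> \<open>In position j the equation reduces to
      \<open>\<mu> i j * ?y $ j = 0\<close>.\<close>
    have "?y $ a = ?\<pi> v $ a" for a
      using arg_cong[OF *, of "\<lambda>z. z $ a"] \<theta>(1) \<theta>(2)[OF i] by (auto simp: e_nth split: if_splits)
    then show ?thesis by (simp add: vec_eq_iff)
  qed
  define F' where "F' i x = F i (Y i x)" for i x
  \<comment> \<open>By \<open>dY'\<close> the derivative of \<open>Y\<close> is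
    \<open>?\<pi>\<close> plus a multiple of \<open>e\<close>, and \<open>fderiv F\<close>
    annihilates \<open>e\<close> at \<open>Y i x\<close> because \<open>p\<close> vanishes there; so
    no derivative of \<open>Y\<close> is left over.\<close>
  have dF': "(F' i has_derivative (\<lambda>v. fderiv F i (Y i x) (?\<pi> v))) (at x)" if i: "i \<in> V" and x: "norm x < \<sigma>" for i x
  proof -
    have Yr: "norm (Y i x) < r" using Yb[OF i x] \<rho> by simp
    have lin: "linear (fderiv F i (Y i x))" using dF[OF i Yr] has_derivative_linear by blast
    have "fderiv F i (Y i x) (?\<pi> v + t *\<^sub>R e) = fderiv F i (Y i x) (?\<pi> v)" for v t
      using pY[OF i x] by (simp add: linear_add[OF lin] linear_scale[OF lin] p_def)
    then show ?thesis using diff_chain_at[OF dY'[OF i x] dF[OF i Yr]] by (simp add: o_def F'_def[abs_def])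
  qed
  obtain CF where CF: "\<And>i x. x \<in> fam_ball V r i \<Longrightarrow> norm (F i x) \<le> CF" using unif_C_bounded[OF F] by metis
  have F': "unif_C (Suc ?m) (fam_ball V \<sigma>) F'"
  proof (rule unif_C_SucI)
    show "(F' i has_derivative (\<lambda>v. fderiv F i (Y i x) (?\<pi> v))) (at x)" if "x \<in> fam_ball V \<sigma> i" for i x
      using dF' that by auto
    show "unif_C ?m (fam_ball V \<sigma>) (\<lambda>i x. fderiv F i (Y i x) (?\<pi> v))" for v
      by (rule unif_C_compose[OF unif_C_SucD[OF F] Y]) (use Yb \<rho> in fastforce)
    show "norm (F' i x) \<le> CF" if "x \<in> fam_ball V \<sigma> i" for i x
      unfolding F'_def by (rule CF) (use that Yb \<rho> in fastforce)
  qed auto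
  define s where "s i x = x $ j - Y i x $ j" for i x
  have s: "unif_C ?m (fam_ball V \<sigma>) s" unfolding s_def
    by (intro unif_C_minus unif_C_vec_nth[OF Y] unif_C_bounded_linear[where D = \<sigma>] bounded_linear_vec_nth) auto
  obtain L where L: "L > 0" "\<And>i x y. x \<in> fam_ball V \<sigma> i \<Longrightarrow> y \<in> fam_ball V \<sigma> i \<Longrightarrow> norm (Y i x - Y i y) \<le> L * norm (x - y)"
    using unif_C_lipschitz[OF Y convex_fam_ball] by metis
  have LY: "norm (Y i x) \<le> L * norm x" if "i \<in> V" "norm x < \<sigma>" for i x
    using L(2)[of x i 0] that \<sigma> Y0[OF that(1)] by simp
  \<comment> \<open>The factor 3 L + 2 comes from |Y x| + 2 (|x| + |Y x|) with |Y x| at most L |x|.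
    It keeps the points \<open>Z i (x, t)\<close> with |t| at most 2 inside the ball of radius
    \<open>\<rho>\<close>.\<close>
  define \<tau> where "\<tau> = min \<sigma> (\<rho> / (3 * L + 2))"
  have \<tau>: "0 < \<tau>" "\<tau> \<le> \<sigma>" "(3 * L + 2) * \<tau> \<le> \<rho>"
  proof -
    show "0 < \<tau>" "\<tau> \<le> \<sigma>" using \<sigma> \<rho> L(1) by (auto simp: \<tau>_def)
    have "\<tau> \<le> \<rho> / (3 * L + 2)" by (simp add: \<tau>_def)
    then show "(3 * L + 2) * \<tau> \<le> \<rho>" using L(1) by (simp add: pos_le_divide_eq mult.commute)
  qed
  have \<tau>r: "\<tau> \<le> r"
  proof -
    have "1 * \<tau> \<le> (3 * L + 2) * \<tau>" using L(1) \<tau>(1) by (intro mult_right_mono) auto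
    then show ?thesis using \<tau>(3) \<rho>(2) by linarith
  qed
  \<comment> \<open>The segment in direction \<open>e\<close> from \<open>Y i x\<close> at t = 0 to
    \<open>zero_on J x\<close> at t = 1, where \<open>F i\<close> takes the value
    \<open>F i x\<close>.\<close>
  define Z where "Z i z = Y i (fst z) + (snd z * s i (fst z)) *\<^sub>R e" for i and z :: "(real ^ 'n) \<times> real"
  let ?U = "\<lambda>i. fam_ball V \<tau> i \<times> {-1<..<2::real}"
  have opU: "open (?U i)" for i by (intro open_Times) auto
  have zb: "norm z \<le> \<tau> + 2" if "z \<in> ?U i" for i z
    using norm_Pair_le[of "fst z" "snd z"] that by (cases z) auto
  have fst: "unif_C ?m ?U (\<lambda>i z. fst z)" and snd: "unif_C ?m ?U (\<lambda>i z. snd z)"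
    by (rule unif_C_bounded_linear[where D = "\<tau> + 2"]; use opU zb in \<open>auto intro: bounded_linear_fst bounded_linear_snd\<close>)+
  have Z: "unif_C ?m ?U Z" unfolding Z_def
    by (intro unif_C_add unif_C_scaleR unif_C_mult snd unif_C_compose[OF Y fst] unif_C_compose[OF s fst] unif_C_const[where C = 1])
       (use opU \<tau> norm_e in auto)
  have Zb: "norm (Z i (x, t)) < \<rho>" if i: "i \<in> V" and x: "norm x < \<tau>" and t: "\<bar>t\<bar> \<le> 2" for i x t
  proof -
    have x': "norm x < \<sigma>" using x \<tau> by simp
    have "\<bar>s i x\<bar> \<le> norm x + norm (Y i x)"
      unfolding s_def using component_le_norm_cart[of x j] component_le_norm_cart[of "Y i x" j] by linarith
    then have "\<bar>t\<bar> * \<bar>s i x\<bar> \<le> 2 * (norm x + norm (Y i x))" using t by (intro mult_mono) auto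
    moreover have "norm (Z i (x, t)) \<le> norm (Y i x) + \<bar>t\<bar> * \<bar>s i x\<bar>"
      unfolding Z_def using norm_triangle_ineq[of "Y i x" "(t * s i x) *\<^sub>R e"] by (simp add: norm_e abs_mult)
    ultimately have "norm (Z i (x, t)) \<le> (3 * L + 2) * norm x"
      using LY[OF i x'] by (simp add: algebra_simps)
    also have "\<dots> < (3 * L + 2) * \<tau>" using x L(1) by (intro mult_strict_left_mono) auto
    finally show ?thesis using \<tau>(3) by simp
  qed
  have Zmem: "Z i z \<in> fam_ball V r i" if "z \<in> ?U i" for i z
  proof -
    obtain x t where z: "z = (x, t)" by (cases z)
    then have "\<bar>t\<bar> \<le> 2" "i \<in> V" "norm x < \<tau>" using that by auto
    then show ?thesis using Zb[of i x t] \<rho> z by simp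
  qed
  have pZ: "unif_C ?m ?U (\<lambda>i z. p i (Z i z))"
    by (rule unif_C_compose[OF p Z Zmem])
  define p2 where "p2 i x = fderiv p i x e" for i x
  have p2: "unif_C (Suc m) (fam_ball V r) p2" unfolding p2_def by (rule unif_C_SucD[OF p])
  have p2Z: "unif_C (Suc m) ?U (\<lambda>i z. (1 - snd z) * p2 i (Z i z))"
    by (intro unif_C_mult unif_C_minus unif_C_compose[OF p2] unif_C_Suc_imp[OF Z] unif_C_Suc_imp[OF snd] unif_C_const[where C = 1])
       (use opU Zmem in auto)
  \<comment> \<open>The two Taylor quotients: F - F' = s q (\<open>Fsq\<close>) and q = s u
    (\<open>qsu\<close>). As an integral of \<open>p\<close>, \<open>q\<close> is one order smoother
    than \<open>u\<close>, and this is the regularity of s u that the square root relies on.\<close>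
  define q where "q i x = integral {0..1} (\<lambda>t. p i (Z i (x, t)))" for i x
  define u where "u i x = integral {0..1} (\<lambda>t. (1 - t) * p2 i (Z i (x, t)))" for i x
  have q: "unif_C ?m (fam_ball V \<tau>) q" unfolding q_def
    by (rule unif_C_integral[OF pZ]) auto
  have u: "unif_C (Suc m) (fam_ball V \<tau>) u" unfolding u_def
    using unif_C_integral[OF p2Z] by simp
  have int: "(\<lambda>t. p i (Z i (x, t))) integrable_on {0..1}" "(\<lambda>t. (1 - t) * p2 i (Z i (x, t))) integrable_on {0..1}"
    if "i \<in> V" "norm x < \<tau>" for i x
  proof -
    have "continuous_on {0..1} (\<lambda>t. (\<lambda>z. p i (Z i z)) (x, t))"
      by (rule continuous_on_compose2[OF unif_C_continuous[OF pZ, of i]]) (use that in \<open>auto intro!: continuous_intros\<close>)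
    then show "(\<lambda>t. p i (Z i (x, t))) integrable_on {0..1}" by (simp add: integrable_continuous_real)
    have "continuous_on {0..1} (\<lambda>t. (\<lambda>z. (1 - snd z) * p2 i (Z i z)) (x, t))"
      by (rule continuous_on_compose2[OF unif_C_continuous[OF p2Z, of i]]) (use that in \<open>auto intro!: continuous_intros\<close>)
    then show "(\<lambda>t. (1 - t) * p2 i (Z i (x, t))) integrable_on {0..1}" by (simp add: integrable_continuous_real)
  qed
  have dZ: "((\<lambda>t. Z i (x, t)) has_derivative (\<lambda>h. (h * s i x) *\<^sub>R e)) (at t)" for i x t
    unfolding Z_def by (auto intro!: derivative_eq_intros)
  have Fsq: "F i x = F' i x + s i x * q i x" if i: "i \<in> V" and x: "norm x < \<tau>" for i x
  proof -
    have "((\<lambda>t. F i (Z i (x, t))) has_vector_derivative s i x * p i (Z i (x, t))) (at t within {0..1})" if t: "t \<in> {0..1}" for t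
    proof -
      have Zr: "norm (Z i (x, t)) < r" using Zb[OF i x, of t] t \<rho> by simp
      have lin: "linear (fderiv F i (Z i (x, t)))" using dF[OF i Zr] has_derivative_linear by blast
      have "((\<lambda>t. F i (Z i (x, t))) has_derivative (\<lambda>h. fderiv F i (Z i (x, t)) ((h * s i x) *\<^sub>R e))) (at t)"
        using diff_chain_at[OF dZ dF[OF i Zr]] by (simp add: o_def)
      then show ?thesis
        by (simp add: linear_scale[OF lin] has_vector_derivative_def p_def has_derivative_at_withinI mult.assoc)
    qed
    then have "((\<lambda>t. s i x * p i (Z i (x, t))) has_integral (F i (Z i (x, 1)) - F i (Z i (x, 0)))) {0..1}"
      by (intro fundamental_theorem_of_calculus) auto
    then have "s i x * q i x = F i (Z i (x, 1)) - F i (Z i (x, 0))"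
      by (simp add: q_def integral_unique flip: integral_mult_right)
    moreover have "Z i (x, 1) = zero_on J x"
      using Ynth[OF i, of x] x \<tau> j by (auto simp: Z_def s_def vec_eq_iff e_nth)
    moreover have "Z i (x, 0) = Y i x" by (simp add: Z_def)
    ultimately show ?thesis using FJ[OF i, of x] x \<tau>r by (simp add: F'_def)
  qed
  have qsu: "q i x = s i x * u i x" if i: "i \<in> V" and x: "norm x < \<tau>" for i x
  proof -
    \<comment> \<open>Integration by parts: the boundary term at t = 1 is killed by the factor 1 -
      t, the one at t = 0 by \<open>pY\<close>.\<close>
    have "((\<lambda>t. (1 - t) * p i (Z i (x, t))) has_vector_derivative
        - p i (Z i (x, t)) + s i x * ((1 - t) * p2 i (Z i (x, t)))) (at t within {0..1})" if t: "t \<in> {0..1}" for t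
    proof -
      have Zr: "norm (Z i (x, t)) < r" using Zb[OF i x, of t] t \<rho> by simp
      have lin: "linear (fderiv p i (Z i (x, t)))" using dp[OF i Zr] has_derivative_linear by blast
      have "((\<lambda>t. p i (Z i (x, t))) has_derivative (\<lambda>h. fderiv p i (Z i (x, t)) ((h * s i x) *\<^sub>R e))) (at t)"
        using diff_chain_at[OF dZ dp[OF i Zr]] by (simp add: o_def)
      then have "((\<lambda>t. p i (Z i (x, t))) has_derivative (\<lambda>h. h * (s i x * p2 i (Z i (x, t))))) (at t within {0..1})"
        by (simp add: linear_scale[OF lin] p2_def has_derivative_at_withinI mult.assoc)
      then have "((\<lambda>t. (1 - t) * p i (Z i (x, t))) has_derivative (\<lambda>h. (1 - t) * (h * (s i x * p2 i (Z i (x, t)))) + (- h) * p i (Z i (x, t)))) (at t within {0..1})"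
        by (auto intro!: derivative_eq_intros)
      then show ?thesis unfolding has_vector_derivative_def
        by (rule has_derivative_eq_rhs) (auto simp: algebra_simps)
    qed
    then have "((\<lambda>t. - p i (Z i (x, t)) + s i x * ((1 - t) * p2 i (Z i (x, t)))) has_integral
        (1 - 1) * p i (Z i (x, 1)) - (1 - 0) * p i (Z i (x, 0))) {0..1}"
      by (rule fundamental_theorem_of_calculus[rotated]) auto
    moreover have "Z i (x, 0) = Y i x" by (simp add: Z_def)
    ultimately have "((\<lambda>t. - p i (Z i (x, t)) + s i x * ((1 - t) * p2 i (Z i (x, t)))) has_integral 0) {0..1}"
      using pY[OF i, of x] x \<tau> by simp
    moreover have "((\<lambda>t. p i (Z i (x, t))) has_integral q i x) {0..1}"
      unfolding q_def by (rule integrable_integral[OF int(1)[OF i x]])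
    moreover have "((\<lambda>t. (1 - t) * p2 i (Z i (x, t))) has_integral u i x) {0..1}"
      unfolding u_def by (rule integrable_integral[OF int(2)[OF i x]])
    ultimately have "0 = - q i x + s i x * u i x"
      using has_integral_unique has_integral_add[OF has_integral_neg has_integral_mult_right] by blast
    then show ?thesis by simp
  qed
  have s0: "s i 0 = 0" if "i \<in> V" for i using Y0[OF that] by (simp add: s_def)
  have u0: "u i 0 = \<mu> i j / 2" if "i \<in> V" for i
  proof -
    have "Z i (0, t) = 0" for t using Y0[OF that] s0[OF that] by (simp add: Z_def)
    moreover have "p2 i 0 = \<mu> i j" using dp0[OF that, of e] by (simp add: p2_def e_nth)
    ultimately show ?thesis unfolding u_def by (simp only: integral_one_minus)
  qed
  obtain Lu where Lu: "Lu > 0" "\<And>i x y. x \<in> fam_ball V \<tau> i \<Longrightarrow> y \<in> fam_ball V \<tau> i \<Longrightarrow> norm (u i x - u i y) \<le> Lu * norm (x - y)"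
    using unif_C_lipschitz[OF u convex_fam_ball] by metis
  \<comment> \<open>On this radius \<open>u\<close> stays within \<open>\<theta> / 4\<close> of its
    value \<open>\<mu> i j / 2\<close> at 0, whose modulus is at least \<open>\<theta> / 2\<close>;
    this gives \<open>wlow\<close>.\<close>
  define r' where "r' = min \<tau> (\<theta> / (4 * Lu))"
  have r': "0 < r'" "r' \<le> \<tau>" "Lu * r' \<le> \<theta> / 4"
  proof -
    show "0 < r'" "r' \<le> \<tau>" using \<tau> \<theta>(1) Lu(1) by (auto simp: r'_def)
    have "r' \<le> \<theta> / (4 * Lu)" by (simp add: r'_def)
    then show "Lu * r' \<le> \<theta> / 4" using Lu(1) by (simp add: field_simps)
  qed
  \<comment> \<open>The sign makes \<open>w\<close> positive, so that its square root exists; it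
    returns as the sign in front of the square.\<close>
  define w where "w i x = sgn (\<mu> i j) * u i x" for i x
  have wlow: "\<theta> / 4 \<le> w i x" if i: "i \<in> V" and x: "norm x < r'" for i x
  proof -
    have "\<bar>u i x - \<mu> i j / 2\<bar> \<le> Lu * norm x"
      using Lu(2)[of x i 0] x r' \<tau> i u0[OF i] by simp
    also have "\<dots> \<le> \<theta> / 4" using r'(3) x Lu(1) by (smt (verit) mult_left_mono)
    finally show ?thesis using \<theta>(1) \<theta>(2)[OF i] by (cases "\<mu> i j > 0") (auto simp: w_def sgn_if abs_if split: if_splits)
  qed
  have sub': "unif_C n (fam_ball V r') G" if "unif_C n (fam_ball V R) G" "r' \<le> R" for n R and G :: "'i \<Rightarrow> real^'n \<Rightarrow> real"
    by (rule unif_C_subset[OF that(1)]) (use that(2) in auto)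
  have w: "unif_C (Suc m) (fam_ball V r') w" unfolding w_def
    by (intro unif_C_mult sub'[OF u] unif_C_const[where C = 1]) (use r' in \<open>auto simp: sgn_if\<close>)
  have sw: "unif_C ?m (fam_ball V r') (\<lambda>i x. s i x * w i x)"
  proof (rule unif_C_cong)
    show "unif_C ?m (fam_ball V r') (\<lambda>i x. sgn (\<mu> i j) * q i x)"
      by (intro unif_C_mult sub'[OF q] unif_C_const[where C = 1]) (use r' in \<open>auto simp: sgn_if\<close>)
    show "sgn (\<mu> i j) * q i x = s i x * w i x" if "x \<in> fam_ball V r' i" for i x
      using qsu[of i x] that r' by (simp add: w_def)
  qed
  define \<Phi> where "\<Phi> i x = s i x * w i x powr (1 / 2)" for i x
  have s': "unif_C ?m (fam_ball V r') s" by (rule sub'[OF s]) (use r' \<tau> in auto)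
  have \<Phi>: "unif_C ?m (fam_ball V r') \<Phi>" unfolding \<Phi>_def
    by (rule unif_C_mult_powr[OF s' w sw, of "\<theta> / 4"]) (use \<theta>(1) wlow in auto)
  have F\<Phi>: "F i x = F' i x + sgn (\<mu> i j) * (\<Phi> i x)\<^sup>2" if i: "i \<in> V" and x: "norm x < r'" for i x
  proof -
    have "(w i x powr (1 / 2))\<^sup>2 = w i x"
      using wlow[OF i x] \<theta>(1) by (simp add: powr_half_sqrt)
    moreover have "sgn (\<mu> i j) * sgn (\<mu> i j) = 1" using \<theta>(1) \<theta>(2)[OF i] by (auto simp: sgn_if)
    ultimately have "sgn (\<mu> i j) * (\<Phi> i x)\<^sup>2 = s i x * (s i x * u i x)"
      by (simp add: \<Phi>_def w_def power_mult_distrib power2_eq_square mult.left_commute)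
    then show ?thesis using Fsq[OF i, of x] qsu[OF i, of x] x r' by simp
  qed
  have D\<Phi>0: "fderiv \<Phi> i 0 v = sqrt (\<bar>\<mu> i j\<bar> / 2) * v $ j" if i: "i \<in> V" for i v
  proof -
    have w0: "w i 0 = \<bar>\<mu> i j\<bar> / 2" using u0[OF i] by (simp add: w_def sgn_if abs_if)
    have w0': "w i 0 > 0" using wlow[OF i, of 0] r' \<theta>(1) by simp
    have ds: "(s i has_derivative (\<lambda>v. v $ j)) (at 0)"
    proof -
      have "(s i has_derivative (\<lambda>v. v $ j - fderiv Y i 0 v $ j)) (at 0)" unfolding s_def[abs_def]
        by (intro has_derivative_diff bounded_linear_imp_has_derivative[OF bounded_linear_vec_nth]
             bounded_linear.has_derivative[OF bounded_linear_vec_nth dY[OF i]]) (use \<sigma> in auto)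
      then show ?thesis using DY0[OF i] by simp
    qed
    have dw: "(w i has_derivative fderiv w i 0) (at 0)"
      by (rule unif_C_has_derivative[OF w]) (use i r' in auto)
    have dwp: "((\<lambda>x. w i x powr (1 / 2)) has_derivative (\<lambda>v. fderiv w i 0 v * w i 0 powr (1 / 2) / (2 * w i 0))) (at 0)"
      using dw w0' by (auto intro!: derivative_eq_intros simp: field_simps)
    \<comment> \<open>As \<open>s\<close> vanishes at 0, only the term with the derivative of
      \<open>s\<close> survives.\<close>
    have "(\<Phi> i has_derivative (\<lambda>v. s i 0 * (fderiv w i 0 v * w i 0 powr (1 / 2) / (2 * w i 0)) + v $ j * w i 0 powr (1 / 2))) (at 0)"
      unfolding \<Phi>_def[abs_def] by (rule has_derivative_mult[OF ds dwp])
    from fun_cong[OF frechet_derivative_at[OF this], of v] show ?thesis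
      using s0[OF i] w0 w0' by (simp add: powr_half_sqrt mult.commute)
  qed
  \<comment> \<open>At 0 the derivative of \<open>Y\<close> is just \<open>?\<pi>\<close>, so the
    Hessian of \<open>F'\<close> there is that of \<open>F\<close> with the j-th diagonal entry
    removed.\<close>
  have D2F': "fderiv (\<lambda>i x. fderiv F' i x v) i 0 w = (\<Sum>a\<in>-insert j J. \<mu> i a * v $ a * w $ a)" if i: "i \<in> V" for i v w
  proof -
    let ?G = "\<lambda>i x. fderiv F i x (?\<pi> v)"
    have dG: "(?G i has_derivative fderiv ?G i 0) (at 0)"
      by (rule unif_C_has_derivative[OF unif_C_SucD[OF F]]) (use i r in auto)
    have "((\<lambda>x. ?G i (Y i x)) has_derivative (\<lambda>w. fderiv ?G i 0 (?\<pi> w))) (at 0)"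
    proof -
      have "(?G i has_derivative fderiv ?G i 0) (at (Y i 0))" unfolding Y0[OF i] by (rule dG)
      from diff_chain_at[OF dY[OF i] this] \<sigma> DY0[OF i] show ?thesis by (simp add: o_def)
    qed
    then have "((\<lambda>x. fderiv F' i x v) has_derivative (\<lambda>w. fderiv ?G i 0 (?\<pi> w))) (at 0)"
    proof (rule has_derivative_transform_within_open[where s = "ball 0 \<sigma>"])
      show "fderiv F i (Y i x) (?\<pi> v) = fderiv F' i x v" if "x \<in> ball 0 \<sigma>" for x
        using fun_cong[OF frechet_derivative_at[OF dF'[OF i, of x]], of v] that by simp
    qed (use \<sigma> in auto)
    from fun_cong[OF frechet_derivative_at[OF this], of w]
    have "fderiv (\<lambda>i x. fderiv F' i x v) i 0 w = fderiv ?G i 0 (?\<pi> w)" by simp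
    also have "\<dots> = (\<Sum>a\<in>-J. \<mu> i a * ?\<pi> v $ a * ?\<pi> w $ a)" by (rule D2F0[OF i])
    also have "\<dots> = (\<Sum>a\<in>-insert j J. \<mu> i a * v $ a * w $ a)"
      by (rule sum.mono_neutral_cong_right) auto
    finally show ?thesis .
  qed
  have "morse_state (Suc ?m) V r' \<mu> (insert j J) F'"
    unfolding morse_state_def
  proof (intro conjI ballI allI impI)
    show "unif_C (Suc ?m) (fam_ball V r') F'" by (rule sub'[OF F']) (use r' \<tau> in auto)
    fix i assume i: "i \<in> V"
    show "F' i x = F' i (?\<pi> x)" for x
    proof -
      have "?\<pi> (?\<pi> x) = ?\<pi> x" by (simp add: vec_eq_iff)
      then show ?thesis by (simp add: F'_def Y_def)
    qed
    show "fderiv F' i 0 v = 0" for v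
      using fun_cong[OF frechet_derivative_at[OF dF'[OF i, of 0]], of v] \<sigma> Y0[OF i] DF0[OF i] by simp
  qed (use r' D2F' in auto)
  then show ?thesis using \<Phi> F\<Phi> D\<Phi>0 s0 r' \<tau>r
    by (intro exI[of _ r'] exI[of _ F'] exI[of _ \<Phi>]) (auto simp: \<Phi>_def)
qed

lemma morse_family:
  fixes g :: "'i \<Rightarrow> real ^ 'n \<Rightarrow> real"
  assumes st: "morse_state (Suc (Suc (Suc m))) V r \<mu> {} g"
    and \<theta>: "\<theta> > 0" "\<And>i a. i \<in> V \<Longrightarrow> \<theta> \<le> \<bar>\<mu> i a\<bar>"
  obtains r' \<Phi> where "0 < r'" "r' \<le> r" "\<And>a. unif_C (Suc (Suc m)) (fam_ball V r') (\<Phi> a)"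
    "\<And>i x. i \<in> V \<Longrightarrow> norm x < r' \<Longrightarrow> g i x = g i 0 + (\<Sum>a\<in>UNIV. sgn (\<mu> i a) * (\<Phi> a i x)\<^sup>2)"
    "\<And>i a. i \<in> V \<Longrightarrow> \<Phi> a i 0 = 0"
    "\<And>i a v. i \<in> V \<Longrightarrow> fderiv (\<Phi> a) i 0 v = sqrt (\<bar>\<mu> i a\<bar> / 2) * v $ a"
proof -
  \<comment> \<open>\<open>\<Phi>\<close> is constrained on \<open>J\<close> only, so the induction
    may overwrite its entry at the new index.\<close>
  have "\<exists>r' F \<Phi>. r' \<le> r \<and> morse_state (Suc (Suc (Suc m))) V r' \<mu> J F \<and>
      (\<forall>a\<in>J. unif_C (Suc (Suc m)) (fam_ball V r') (\<Phi> a) \<and>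
         (\<forall>i\<in>V. \<Phi> a i 0 = 0 \<and> (\<forall>v. fderiv (\<Phi> a) i 0 v = sqrt (\<bar>\<mu> i a\<bar> / 2) * v $ a))) \<and>
      (\<forall>i\<in>V. \<forall>x. norm x < r' \<longrightarrow> g i x = F i x + (\<Sum>a\<in>J. sgn (\<mu> i a) * (\<Phi> a i x)\<^sup>2))" for J :: "'n set"
    using finite[of J]
  proof (induction J rule: finite_induct)
    case empty
    show ?case by (rule exI[of _ r], rule exI[of _ g]) (use st in auto)
  next
    case (insert j J)
    then obtain r1 F \<Phi> where r1: "r1 \<le> r" and st1: "morse_state (Suc (Suc (Suc m))) V r1 \<mu> J F"
      and \<Phi>: "\<forall>a\<in>J. unif_C (Suc (Suc m)) (fam_ball V r1) (\<Phi> a) \<and>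
         (\<forall>i\<in>V. \<Phi> a i 0 = 0 \<and> (\<forall>v. fderiv (\<Phi> a) i 0 v = sqrt (\<bar>\<mu> i a\<bar> / 2) * v $ a))"
      and eq: "\<forall>i\<in>V. \<forall>x. norm x < r1 \<longrightarrow> g i x = F i x + (\<Sum>a\<in>J. sgn (\<mu> i a) * (\<Phi> a i x)\<^sup>2)"
      by blast
    from morse_step[OF st1 insert.hyps(2) \<theta>] obtain r2 F' \<phi> where r2: "r2 \<le> r1"
      and st2: "morse_state (Suc (Suc (Suc m))) V r2 \<mu> (insert j J) F'"
      and \<phi>: "unif_C (Suc (Suc m)) (fam_ball V r2) \<phi>" and
      \<phi>2: "\<forall>i\<in>V. (\<forall>x. norm x < r2 \<longrightarrow> F i x = F' i x + sgn (\<mu> i j) * (\<phi> i x)\<^sup>2) \<and> \<phi> i 0 = 0 \<and>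
      (\<forall>v. fderiv \<phi> i 0 v = sqrt (\<bar>\<mu> i j\<bar> / 2) * v $ j)" by blast
    define \<Phi>' where "\<Phi>' = \<Phi>(j := \<phi>)"
    have 1: "\<Phi>' a = (if a = j then \<phi> else \<Phi> a)" for a by (simp add: \<Phi>'_def)
    have 2: "(\<Sum>a\<in>J. sgn (\<mu> i a) * (\<Phi>' a i x)\<^sup>2) = (\<Sum>a\<in>J. sgn (\<mu> i a) * (\<Phi> a i x)\<^sup>2)" for i x
      by (rule sum.cong) (use insert.hyps in \<open>auto simp: 1\<close>)
    have 3: "unif_C (Suc (Suc m)) (fam_ball V r2) (\<Phi> a)" if "a \<in> J" for a
      by (rule unif_C_subset[of _ "fam_ball V r1"]) (use \<Phi> that r2 in auto)
    show ?case
    proof (intro exI conjI ballI allI impI)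
      show "r2 \<le> r" using r1 r2 by simp
      show "morse_state (Suc (Suc (Suc m))) V r2 \<mu> (insert j J) F'" by fact
      show "unif_C (Suc (Suc m)) (fam_ball V r2) (\<Phi>' a)" if "a \<in> insert j J" for a
        using that 3 \<phi> by (auto simp: 1)
      show "\<Phi>' a i 0 = 0" "fderiv (\<Phi>' a) i 0 v = sqrt (\<bar>\<mu> i a\<bar> / 2) * v $ a"
        if "a \<in> insert j J" "i \<in> V" for a i v
        using that \<Phi> \<phi>2 by (auto simp: 1)
      fix i and x :: "real ^ 'n" assume i: "i \<in> V" and x: "norm x < r2"
      have "g i x = F' i x + sgn (\<mu> i j) * (\<phi> i x)\<^sup>2 + (\<Sum>a\<in>J. sgn (\<mu> i a) * (\<Phi> a i x)\<^sup>2)"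
        using eq \<phi>2 i x r2 by simp
      then show "g i x = F' i x + (\<Sum>a\<in>insert j J. sgn (\<mu> i a) * (\<Phi>' a i x)\<^sup>2)"
        using insert.hyps 2[of i x] by (simp add: 1)
    qed
  qed
  from this[of UNIV] obtain r' F \<Phi> where r': "r' \<le> r" and st': "morse_state (Suc (Suc (Suc m))) V r' \<mu> UNIV F"
    and all: "\<forall>a\<in>UNIV. unif_C (Suc (Suc m)) (fam_ball V r') (\<Phi> a) \<and>
         (\<forall>i\<in>V. \<Phi> a i 0 = 0 \<and> (\<forall>v. fderiv (\<Phi> a) i 0 v = sqrt (\<bar>\<mu> i a\<bar> / 2) * v $ a))"
    and eq': "\<forall>i\<in>V. \<forall>x. norm x < r' \<longrightarrow> g i x = F i x + (\<Sum>a\<in>UNIV. sgn (\<mu> i a) * (\<Phi> a i x)\<^sup>2)"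
    by (elim exE conjE) (rule that; assumption)
  have \<Phi>: "unif_C (Suc (Suc m)) (fam_ball V r') (\<Phi> a)" for a using all by simp
  have \<Phi>0: "\<Phi> a i 0 = 0" "fderiv (\<Phi> a) i 0 v = sqrt (\<bar>\<mu> i a\<bar> / 2) * v $ a" if "i \<in> V" for i a v
    using all that by simp_all
  have eq: "g i x = F i x + (\<Sum>a\<in>UNIV. sgn (\<mu> i a) * (\<Phi> a i x)\<^sup>2)" if "i \<in> V" "norm x < r'" for i x
    using eq' that by simp
  have pos: "r' > 0" using st' by (simp add: morse_state_def)
  \<comment> \<open>Once every coordinate has been eliminated, the remainder depends on none of
    them.\<close>
  have const: "F i x = F i 0" if "i \<in> V" "norm x < r'" for i x
  proof -
    have "zero_on UNIV x = 0" by (simp add: vec_eq_iff)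
    moreover have "F i x = F i (zero_on UNIV x)" using st' that unfolding morse_state_def by blast
    ultimately show ?thesis by metis
  qed
  have "g i x = g i 0 + (\<Sum>a\<in>UNIV. sgn (\<mu> i a) * (\<Phi> a i x)\<^sup>2)" if "i \<in> V" "norm x < r'" for i x
    using eq[OF that] eq[OF that(1), of 0] const[OF that] \<Phi>0(1)[OF that(1)] pos by simp
  from that[OF pos r' \<Phi> this \<Phi>0] show ?thesis .
qed

section \<open>Iterated derivatives within a set\<close>

text \<open>Ensures that derivatives within \<open>U\<close> are unique. Uniqueness results for boxes do not apply to
  the boundary points of a ball, where some coordinate directions leave the ball.\<close>

definition full_tangent :: "'a::real_normed_vector set \<Rightarrow> bool" where
  "full_tangent U \<longleftrightarrow> (\<forall>x\<in>U. \<exists>z d. d > 0 \<and> (\<forall>y\<in>ball z d. \<forall>t\<in>{0..1}. x + t *\<^sub>R (y - x) \<in> U))"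

lemma full_tangent_open:
  assumes "open U" shows "full_tangent U"
  unfolding full_tangent_def
proof
  fix x assume "x \<in> U"
  then obtain d where d: "d > 0" "ball x d \<subseteq> U" using assms open_contains_ball by metis
  have "x + t *\<^sub>R (y - x) \<in> U" if "y \<in> ball x d" "t \<in> {0..1}" for y t
  proof -
    have "norm (t *\<^sub>R (y - x)) \<le> 1 * norm (y - x)"
      using that(2) unfolding norm_scaleR by (intro mult_right_mono) auto
    then show ?thesis using d(2) that(1) by (auto simp: dist_norm norm_minus_commute subset_iff)
  qed
  then show "\<exists>z d. d > 0 \<and> (\<forall>y\<in>ball z d. \<forall>t\<in>{0..1}. x + t *\<^sub>R (y - x) \<in> U)" using d(1) by blast
qed

lemma full_tangent_cball:
  fixes a :: "'a::real_normed_vector"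
  assumes "r > 0" shows "full_tangent (cball a r)"
  unfolding full_tangent_def
proof (intro ballI exI[of _ a] exI[of _ r] conjI)
  fix x y t assume "x \<in> cball a r" "y \<in> ball a r" "t \<in> {0..1::real}"
  then have "(1 - t) *\<^sub>R x + t *\<^sub>R y \<in> cball a r"
    using convexD[OF convex_cball[of a r], of x y "1 - t" t] by auto
  then show "x + t *\<^sub>R (y - x) \<in> cball a r" by (simp add: algebra_simps)
qed (use assms in auto)

text \<open>One-dimensional derivatives along segments into the set are unique, so \<open>D\<close>
  and \<open>D'\<close> agree on y - x for all y in some ball. Differences of such vectors include
  all small vectors, and linearity does the rest.\<close>

lemma full_tangent_derivative_unique:
  fixes f :: "'a::real_normed_vector \<Rightarrow> 'b::real_normed_vector"
  assumes U: "full_tangent U" "x \<in> U"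
    and D: "(f has_derivative D) (at x within U)" and D': "(f has_derivative D') (at x within U)"
  shows "D = D'"
proof -
  obtain z d where d: "d > 0" "\<And>y t. y \<in> ball z d \<Longrightarrow> t \<in> {0..1} \<Longrightarrow> x + t *\<^sub>R (y - x) \<in> U"
    using U unfolding full_tangent_def by meson
  have lin: "linear D" "linear D'" using D D' has_derivative_linear by auto
  have eq: "D (y - x) = D' (y - x)" if y: "y \<in> ball z d" for y
  proof -
    let ?p = "\<lambda>t::real. x + t *\<^sub>R (y - x)"
    have *: "((\<lambda>t. f (?p t)) has_vector_derivative E (y - x)) (at 0 within cbox 0 1)"
      if E: "(f has_derivative E) (at x within U)" for E
    proof -
      have p: "(?p has_derivative (\<lambda>h. h *\<^sub>R (y - x))) (at 0 within cbox 0 1)"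
        by (auto intro!: derivative_eq_intros)
      have sub: "?p ` cbox 0 1 \<subseteq> U" using d(2)[OF y] by auto
      have "(f has_derivative E) (at (?p 0) within ?p ` cbox 0 1)"
        using has_derivative_subset[OF E sub] by simp
      from diff_chain_within[OF p this]
      have "((\<lambda>t. f (?p t)) has_derivative (\<lambda>h. E (h *\<^sub>R (y - x)))) (at 0 within cbox 0 1)"
        by (simp add: o_def)
      then show ?thesis
        using linear_scale[OF has_derivative_linear[OF E]] by (simp add: has_vector_derivative_def)
    qed
    show ?thesis
      by (rule vector_derivative_unique_within_closed_interval[OF _ _ *[OF D] *[OF D']]) auto
  qed
  show ?thesis
  proof
    fix w :: 'a
    \<comment> \<open>Small enough to keep \<open>z + s *\<^sub>R w\<close> in the ball; the summand
      1 takes care of w = 0.\<close>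
    define s where "s = d / (2 * (norm w + 1))"
    have s: "s > 0" using d(1) by (simp add: s_def add_nonneg_pos)
    have "s * norm w < d"
    proof -
      have "s * norm w \<le> s * (norm w + 1)" using s by simp
      also have "\<dots> = d / 2" by (simp add: s_def field_simps add_nonneg_eq_0_iff)
      finally show ?thesis using d(1) by linarith
    qed
    then have "z + s *\<^sub>R w \<in> ball z d" "z \<in> ball z d" using s d(1) by (auto simp: dist_norm)
    then have eqs: "D (z + s *\<^sub>R w - x) = D' (z + s *\<^sub>R w - x)" "D (z - x) = D' (z - x)" using eq by auto
    have ex: "E (z + s *\<^sub>R w - x) = E (z - x) + s *\<^sub>R E w" if "linear E" for E :: "'a \<Rightarrow> 'b"
      using linear_add[OF that, of "z - x" "s *\<^sub>R w"] linear_scale[OF that] by (simp add: algebra_simps)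
    have "s *\<^sub>R D w = s *\<^sub>R D' w" using ex[OF lin(1)] ex[OF lin(2)] eqs by (metis add_left_cancel)
    then show "D w = D' w" using s by simp
  qed
qed

lemma full_tangent_frechet_derivative:
  assumes "full_tangent U" "x \<in> U" "(f has_derivative D) (at x within U)"
  shows "frechet_derivative f (at x within U) = D"
  using full_tangent_derivative_unique[OF assms(1,2) _ assms(3)] assms(3)
    frechet_derivative_works differentiableI by blast

section \<open>Rules for iterated derivatives and the C^k norm\<close>

lemma frechet_derivative_within_works:
  "f differentiable_on U \<Longrightarrow> x \<in> U \<Longrightarrow> (f has_derivative frechet_derivative f (at x within U)) (at x within U)"
  by (simp add: differentiable_on_def frechet_derivative_works)

text \<open>The head of the list is the outermost direction, so the tail \<open>ws\<close> is
  differentiated first.\<close>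

lemma nderiv_append: "nderiv U f (vs @ ws) = nderiv U (nderiv U f ws) vs"
  by (induction vs) auto

lemma nderiv_cong_on:
  assumes "\<And>x. x \<in> U \<Longrightarrow> f x = g x" "x \<in> U"
  shows "nderiv U f vs x = nderiv U g vs x"
  using assms(2)
proof (induction vs arbitrary: x)
  case (Cons v vs)
  have "(nderiv U f vs has_derivative D) (at x within U) \<longleftrightarrow> (nderiv U g vs has_derivative D) (at x within U)" for D
    using has_derivative_transform[OF Cons.prems, of "nderiv U f vs" "nderiv U g vs"]
      has_derivative_transform[OF Cons.prems, of "nderiv U g vs" "nderiv U f vs"] Cons.IH by metis
  then show ?case by (simp add: frechet_derivative_def)
qed (use assms(1) in auto)

lemma Ck_on_differentiable: "Ck_on k U f \<Longrightarrow> length vs < k \<Longrightarrow> nderiv U f vs differentiable_on U"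
  by (simp add: Ck_on_def)

lemma Ck_on_continuous: "Ck_on k U f \<Longrightarrow> length vs \<le> k \<Longrightarrow> continuous_on U (nderiv U f vs)"
  by (simp add: Ck_on_def)

lemma Ck_on_has_derivative:
  "Ck_on k U f \<Longrightarrow> length vs < k \<Longrightarrow> x \<in> U \<Longrightarrow>
    (nderiv U f vs has_derivative (\<lambda>v. nderiv U f (v # vs) x)) (at x within U)"
  using frechet_derivative_within_works[OF Ck_on_differentiable] by fastforce

lemma Ck_on_transfer:
  assumes "Ck_on k V f" "U \<subseteq> V"
    and "\<And>vs x. length vs \<le> k \<Longrightarrow> x \<in> U \<Longrightarrow> nderiv U f vs x = nderiv V f vs x"
  shows "Ck_on k U f"
  unfolding Ck_on_def
proof (intro conjI allI impI)
  fix vs :: "'a list"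
  assume "length vs < k"
  then have "nderiv V f vs differentiable_on U"
    using Ck_on_differentiable[OF assms(1)] assms(2) differentiable_on_subset by blast
  then show "nderiv U f vs differentiable_on U"
    using assms(3)[of vs] \<open>length vs < k\<close> differentiable_transform_within
    unfolding differentiable_on_def by (metis less_imp_le zero_less_one)
next
  fix vs :: "'a list"
  assume vs: "length vs \<le> k"
  then have "continuous_on U (nderiv V f vs)"
    using Ck_on_continuous[OF assms(1)] assms(2) continuous_on_subset by blast
  then show "continuous_on U (nderiv U f vs)"
    by (rule continuous_on_eq) (use assms(3)[OF vs] in auto)
qed

text \<open>A derivative within \<open>V\<close> is also one within \<open>U\<close>, and
  \<open>full_tangent U\<close> makes it the only one, so that \<open>frechet_derivative\<close> has
  no other choice.\<close>

lemma nderiv_restrict: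
  assumes U: "full_tangent U" "U \<subseteq> V" and f: "Ck_on k V f"
    and "length vs \<le> k" "x \<in> U"
  shows "nderiv U f vs x = nderiv V f vs x"
  using assms(4,5)
proof (induction vs arbitrary: x)
  case (Cons v vs)
  have "(nderiv V f vs has_derivative (\<lambda>v. nderiv V f (v # vs) x)) (at x within U)"
    by (rule has_derivative_subset[OF Ck_on_has_derivative[OF f] U(2)]) (use Cons.prems U(2) in auto)
  then have "(nderiv U f vs has_derivative (\<lambda>v. nderiv V f (v # vs) x)) (at x within U)"
    by (rule has_derivative_transform[rotated 2]) (use Cons in auto)
  from full_tangent_frechet_derivative[OF U(1) Cons.prems(2) this] show ?case by simp
qed auto

lemma Ck_on_restrict:
  assumes "full_tangent U" "U \<subseteq> V" "Ck_on k V f"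
  shows "Ck_on k U f"
  by (rule Ck_on_transfer[OF assms(3,2) nderiv_restrict[OF assms]])

lemma nderiv_add_scaleR:
  assumes U: "full_tangent U" and f: "Ck_on k U f" and g: "Ck_on k U g"
    and "length vs \<le> k" "x \<in> U"
  shows "nderiv U (\<lambda>x. f x + c *\<^sub>R g x) vs x = nderiv U f vs x + c *\<^sub>R nderiv U g vs x"
  using assms(4,5)
proof (induction vs arbitrary: x)
  case (Cons v vs)
  have "((\<lambda>x. nderiv U f vs x + c *\<^sub>R nderiv U g vs x) has_derivative
     (\<lambda>v. nderiv U f (v # vs) x + c *\<^sub>R nderiv U g (v # vs) x)) (at x within U)"
    using Cons.prems by (intro has_derivative_add has_derivative_scaleR_right Ck_on_has_derivative[OF f] Ck_on_has_derivative[OF g]) auto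
  then have "(nderiv U (\<lambda>x. f x + c *\<^sub>R g x) vs has_derivative
     (\<lambda>v. nderiv U f (v # vs) x + c *\<^sub>R nderiv U g (v # vs) x)) (at x within U)"
    by (rule has_derivative_transform[rotated 2]) (use Cons in auto)
  from full_tangent_frechet_derivative[OF U Cons.prems(2) this] show ?case by simp
qed auto

lemma Ck_on_add_scaleR:
  assumes U: "full_tangent U" and f: "Ck_on k U f" and g: "Ck_on k U g"
  shows "Ck_on k U (\<lambda>x. f x + c *\<^sub>R g x)"
  unfolding Ck_on_def
proof (intro conjI allI impI)
  fix vs :: "'a list"
  assume vs: "length vs < k"
  show "nderiv U (\<lambda>x. f x + c *\<^sub>R g x) vs differentiable_on U"
    unfolding differentiable_on_def
  proof
    fix x assume x: "x \<in> U"
    have "((\<lambda>x. nderiv U f vs x + c *\<^sub>R nderiv U g vs x) has_derivative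
       (\<lambda>v. nderiv U f (v # vs) x + c *\<^sub>R nderiv U g (v # vs) x)) (at x within U)"
      using vs x by (intro has_derivative_add has_derivative_scaleR_right Ck_on_has_derivative[OF f] Ck_on_has_derivative[OF g]) auto
    then have "(nderiv U (\<lambda>x. f x + c *\<^sub>R g x) vs has_derivative
       (\<lambda>v. nderiv U f (v # vs) x + c *\<^sub>R nderiv U g (v # vs) x)) (at x within U)"
      by (rule has_derivative_transform[rotated 2]) (use x vs nderiv_add_scaleR[OF assms] in auto)
    then show "nderiv U (\<lambda>x. f x + c *\<^sub>R g x) vs differentiable at x within U"
      by (rule differentiableI)
  qed
next
  fix vs :: "'a list"
  assume vs: "length vs \<le> k"
  have "continuous_on U (\<lambda>x. nderiv U f vs x + c *\<^sub>R nderiv U g vs x)"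
    by (intro continuous_intros Ck_on_continuous[OF f vs] Ck_on_continuous[OF g vs])
  then show "continuous_on U (nderiv U (\<lambda>x. f x + c *\<^sub>R g x) vs)"
    by (rule continuous_on_eq) (use nderiv_add_scaleR[OF assms vs] in auto)
qed

lemma nderiv_zero:
  fixes U :: "'a::euclidean_space set"
  assumes "full_tangent U" "x \<in> U"
  shows "nderiv U (\<lambda>x. 0 :: 'b::real_normed_vector) vs x = 0"
  using assms(2)
proof (induction vs arbitrary: x)
  case (Cons v vs)
  have "(nderiv U (\<lambda>x. 0 :: 'b) vs has_derivative (\<lambda>v. 0)) (at x within U)"
    by (rule has_derivative_transform[of _ _ _ "\<lambda>x. 0 :: 'b"]) (use Cons in auto)
  from full_tangent_frechet_derivative[OF assms(1) Cons.prems this] show ?case by simp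
qed auto

lemma Ck_on_zero:
  fixes U :: "'a::euclidean_space set"
  assumes "full_tangent U"
  shows "Ck_on k U (\<lambda>x. 0 :: 'b::real_normed_vector)"
  unfolding Ck_on_def
proof (intro conjI allI impI)
  fix vs :: "'a list"
  show "nderiv U (\<lambda>x. 0 :: 'b) vs differentiable_on U"
    unfolding differentiable_on_def
  proof
    fix x assume "x \<in> U"
    then have "(nderiv U (\<lambda>x. 0 :: 'b) vs has_derivative (\<lambda>v. 0)) (at x within U)"
      by (rule has_derivative_transform[of _ _ _ "\<lambda>x. 0 :: 'b"]) (use nderiv_zero[OF assms] in auto)
    then show "nderiv U (\<lambda>x. 0 :: 'b) vs differentiable at x within U" by (rule differentiableI)
  qed
  show "continuous_on U (nderiv U (\<lambda>x. 0 :: 'b) vs)"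
    by (rule continuous_on_eq[where f = "\<lambda>x. 0"]) (simp_all add: nderiv_zero[OF assms])
qed

text \<open>Both claims go into one induction because the formula for the next derivative rests on
  the regularity of the partial sum.\<close>

lemma Ck_on_sum:
  assumes U: "full_tangent U" and "finite S" and "\<And>s. s \<in> S \<Longrightarrow> Ck_on k U (f s)"
  shows "Ck_on k U (\<lambda>x. \<Sum>s\<in>S. c s *\<^sub>R f s x) \<and>
    (\<forall>vs x. length vs \<le> k \<longrightarrow> x \<in> U \<longrightarrow> nderiv U (\<lambda>x. \<Sum>s\<in>S. c s *\<^sub>R f s x) vs x = (\<Sum>s\<in>S. c s *\<^sub>R nderiv U (f s) vs x))"
  using assms(2,3)
proof (induction S rule: finite_induct)
  case empty
  show ?case by (simp add: Ck_on_zero[OF U] nderiv_zero[OF U])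
next
  case (insert s S)
  then have IH: "Ck_on k U (\<lambda>x. \<Sum>s\<in>S. c s *\<^sub>R f s x)"
    "\<And>vs x. length vs \<le> k \<Longrightarrow> x \<in> U \<Longrightarrow> nderiv U (\<lambda>x. \<Sum>s\<in>S. c s *\<^sub>R f s x) vs x = (\<Sum>s\<in>S. c s *\<^sub>R nderiv U (f s) vs x)"
    by auto
  have s: "Ck_on k U (f s)" using insert.prems by simp
  show ?case
    using Ck_on_add_scaleR[OF U IH(1) s, of "c s"] nderiv_add_scaleR[OF U IH(1) s, of _ _ "c s"] IH(2) insert.hyps
    by (simp add: add.commute)
qed

text \<open>All estimates use the norm in this pointwise form; \<open>k \<ge> 1\<close> makes the
  maximum range over a nonempty set.\<close>

lemma Ck_norm_le_iff:
  assumes "k \<ge> 1"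
  shows "Ck_norm k U f \<le> ereal a \<longleftrightarrow>
    (\<forall>vs. 1 \<le> length vs \<longrightarrow> length vs \<le> k \<longrightarrow> (\<forall>v\<in>set vs. norm v \<le> 1) \<longrightarrow> (\<forall>x\<in>U. norm (nderiv U f vs x) \<le> a))"
proof -
  have "Ck_norm k U f \<le> ereal a \<longleftrightarrow> (\<forall>p\<in>{1..k}. \<forall>x\<in>U. multi_onorm p (\<lambda>vs. nderiv U f vs x) \<le> ereal a)"
    unfolding Ck_norm_def using assms by (subst Max_le_iff) (auto simp: SUP_le_iff)
  also have "\<dots> \<longleftrightarrow> (\<forall>vs. 1 \<le> length vs \<longrightarrow> length vs \<le> k \<longrightarrow> (\<forall>v\<in>set vs. norm v \<le> 1) \<longrightarrow> (\<forall>x\<in>U. norm (nderiv U f vs x) \<le> a))"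
    unfolding multi_onorm_def SUP_le_iff by auto
  finally show ?thesis .
qed

section \<open>Passage between families and the C^k norm\<close>

lemma unif_C_nderiv:
  assumes F: "unif_C m U F" and "length vs \<le> m"
  shows "unif_C (m - length vs) U (\<lambda>i. nderiv (U i) (F i) vs)"
  using assms(2)
proof (induction vs)
  case (Cons v vs)
  then have "unif_C (Suc (m - length (v # vs))) U (\<lambda>i. nderiv (U i) (F i) vs)"
    by (simp add: Suc_diff_Suc)
  from unif_C_SucD[OF this, of v] show ?case
  proof (rule unif_C_cong)
    show "frechet_derivative (nderiv (U i) (F i) vs) (at x) v = nderiv (U i) (F i) (v # vs) x" if "x \<in> U i" for i x
      by (simp add: at_within_open[OF that unif_C_open[OF F]])
  qed
qed (use F in simp)

lemma unif_C_imp_Ck_on: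
  fixes F :: "'i \<Rightarrow> 'a::euclidean_space \<Rightarrow> 'b::real_normed_vector"
  assumes F: "unif_C m U F"
  shows "Ck_on m (U i) (F i)"
  unfolding Ck_on_def
proof (intro conjI allI impI)
  fix vs :: "'a list"
  assume vs: "length vs < m"
  have "unif_C (Suc (m - Suc (length vs))) U (\<lambda>i. nderiv (U i) (F i) vs)"
    using unif_C_nderiv[OF F, of vs] vs by (simp add: Suc_diff_Suc)
  then show "nderiv (U i) (F i) vs differentiable_on (U i)"
    unfolding differentiable_on_def
    by (intro ballI differentiableI) (rule has_derivative_at_withinI[OF unif_C_has_derivative])
next
  fix vs :: "'a list"
  assume "length vs \<le> m"
  then show "continuous_on (U i) (nderiv (U i) (F i) vs)"
    using unif_C_continuous[OF unif_C_nderiv[OF F]] by blast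
qed

text \<open>\<open>unif_C\<close> gives a bound for each fixed list of directions, but here one
  constant serves all lists in the unit ball. The last entry, which is differentiated first, is
  expanded in the basis, and the induction applies to the derived families.\<close>

lemma unif_C_nderiv_bounded:
  fixes F :: "'i \<Rightarrow> 'a::euclidean_space \<Rightarrow> 'b::real_normed_vector"
  assumes F: "unif_C m U F" and "p \<le> m"
  shows "\<exists>C. \<forall>vs. length vs = p \<longrightarrow> (\<forall>v\<in>set vs. norm v \<le> 1) \<longrightarrow> (\<forall>i. \<forall>x\<in>U i. norm (nderiv (U i) (F i) vs x) \<le> C)"
  using assms
proof (induction p arbitrary: F m)
  case 0
  obtain C where "\<And>i x. x \<in> U i \<Longrightarrow> norm (F i x) \<le> C" using unif_C_bounded[OF 0(1)] by metis
  then show ?case by auto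
next
  case (Suc p)
  then obtain m' where m: "m = Suc m'" by (cases m) auto
  let ?D = "\<lambda>v i x. fderiv F i x v"
  have D: "unif_C m' U (?D v)" for v using unif_C_SucD Suc.prems(1) m by blast
  have full: "full_tangent (U i)" for i using unif_C_open[OF Suc.prems(1)] by (rule full_tangent_open)
  have "\<forall>b. \<exists>C. \<forall>vs :: 'a list. length vs = p \<longrightarrow> (\<forall>v\<in>set vs. norm v \<le> 1) \<longrightarrow> (\<forall>i. \<forall>x\<in>U i. norm (nderiv (U i) (?D b i) vs x) \<le> C)"
    using Suc.IH[OF D] Suc.prems(2) m by simp
  then obtain C where C: "\<And>b (vs :: 'a list) i x. length vs = p \<Longrightarrow> \<forall>v\<in>set vs. norm v \<le> 1 \<Longrightarrow> x \<in> U i \<Longrightarrow> norm (nderiv (U i) (?D b i) vs x) \<le> C b"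
    by metis
  show ?case
  proof (intro exI allI impI ballI)
    fix vs :: "'a list" and i x
    assume vs: "length vs = Suc p" "\<forall>v\<in>set vs. norm v \<le> 1" and x: "x \<in> U i"
    obtain ws v where ws: "vs = ws @ [v]" using vs(1) by (cases vs rule: rev_cases) auto
    have len: "length ws = p" "\<forall>v\<in>set ws. norm v \<le> 1" "norm v \<le> 1" using vs ws by auto
    have "nderiv (U i) (F i) [v] y = (\<Sum>b\<in>Basis. (v \<bullet> b) *\<^sub>R ?D b i y)" if "y \<in> U i" for y
    proof -
      have "(F i has_derivative fderiv F i y) (at y)"
        by (rule unif_C_has_derivative[OF Suc.prems(1)[unfolded m] that])
      then have "linear (fderiv F i y)" by (rule has_derivative_linear)
      from linear_eq_sum_Basis[OF this, of v] show ?thesis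
        by (simp add: at_within_open[OF that unif_C_open[OF Suc.prems(1)]])
    qed
    then have "nderiv (U i) (F i) vs x = nderiv (U i) (\<lambda>y. \<Sum>b\<in>Basis. (v \<bullet> b) *\<^sub>R ?D b i y) ws x"
      unfolding ws nderiv_append by (rule nderiv_cong_on) (use x in auto)
    also have "\<dots> = (\<Sum>b\<in>Basis. (v \<bullet> b) *\<^sub>R nderiv (U i) (?D b i) ws x)"
      using Ck_on_sum[OF full, of Basis m' i "\<lambda>b. ?D b i" "\<lambda>b. v \<bullet> b"] unif_C_imp_Ck_on[OF D] len(1) Suc.prems(2) m x by simp
    also have "norm \<dots> \<le> (\<Sum>b\<in>Basis. C b)"
    proof (rule sum_norm_le)
      fix b :: 'a assume b: "b \<in> Basis"
      have "\<bar>v \<bullet> b\<bar> * norm (nderiv (U i) (?D b i) ws x) \<le> 1 * norm (nderiv (U i) (?D b i) ws x)"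
        using Basis_le_norm[OF b, of v] len(3) by (intro mult_right_mono) auto
      also have "\<dots> \<le> C b" using C[OF len(1,2) x, of b] by simp
      finally show "norm ((v \<bullet> b) *\<^sub>R nderiv (U i) (?D b i) ws x) \<le> C b" by simp
    qed
    finally show "norm (nderiv (U i) (F i) vs x) \<le> (\<Sum>b\<in>Basis. C b)" .
  qed
qed

lemma unif_C_Ck_norm:
  fixes F :: "'i \<Rightarrow> 'a::euclidean_space \<Rightarrow> 'b::real_normed_vector"
  assumes "unif_C m U F" "m \<ge> 1"
  obtains M where "M > 0" "\<And>i. Ck_norm m (U i) (F i) \<le> ereal M"
proof -
  have "\<forall>p\<in>{..m}. \<exists>C. \<forall>vs. length vs = p \<longrightarrow> (\<forall>v\<in>set vs. norm v \<le> 1) \<longrightarrow> (\<forall>i. \<forall>x\<in>U i. norm (nderiv (U i) (F i) vs x) \<le> C)"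
    using unif_C_nderiv_bounded[OF assms(1)] by simp
  from bchoice[OF this] obtain C where "\<forall>p\<in>{..m}. \<forall>vs. length vs = p \<longrightarrow> (\<forall>v\<in>set vs. norm v \<le> 1) \<longrightarrow> (\<forall>i. \<forall>x\<in>U i. norm (nderiv (U i) (F i) vs x) \<le> C p)"
    by blast
  then have C: "norm (nderiv (U i) (F i) vs x) \<le> C p"
    if "p \<le> m" "length vs = p" "\<forall>v\<in>set vs. norm v \<le> 1" "x \<in> U i" for p vs i x
    using that by simp
  define M where "M = Max (insert 1 (C ` {..m}))"
  have "C p \<le> M" if "p \<le> m" for p unfolding M_def using that by (intro Max_ge) auto
  then have "Ck_norm m (U i) (F i) \<le> ereal M" for i
    unfolding Ck_norm_le_iff[OF assms(2)]
  proof (intro allI impI ballI)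
    fix vs :: "'a list" and x
    assume "length vs \<le> m" "\<forall>v\<in>set vs. norm v \<le> 1" "x \<in> U i"
    then show "norm (nderiv (U i) (F i) vs x) \<le> M"
      using C[OF _ refl] \<open>\<And>p. p \<le> m \<Longrightarrow> C p \<le> M\<close> order_trans by blast
  qed
  moreover have "M \<ge> 1" unfolding M_def by (intro Max_ge) auto
  ultimately show ?thesis using that[of M] by simp
qed

text \<open>In this direction a separate bound for each list of directions suffices, as
  \<open>unif_C\<close> asks for no more.\<close>

lemma unif_CI_nderiv:
  assumes "\<And>i. open (U i)" "\<And>i. Ck_on m (U i) (F i)"
    and "\<And>vs. length vs \<le> m \<Longrightarrow> \<exists>C. \<forall>i. \<forall>x\<in>U i. norm (nderiv (U i) (F i) vs x) \<le> C"
  shows "unif_C m U F"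
  using assms(2,3)
proof (induction m arbitrary: F)
  case 0
  obtain C where "\<And>i x. x \<in> U i \<Longrightarrow> norm (F i x) \<le> C" using 0(2)[of "[]"] by auto
  moreover have "continuous_on (U i) (F i)" for i using Ck_on_continuous[OF 0(1), of "[]"] by simp
  ultimately show ?case by (intro unif_C_0I assms(1))
next
  case (Suc m)
  obtain C where C: "\<And>i x. x \<in> U i \<Longrightarrow> norm (F i x) \<le> C" using Suc.prems(2)[of "[]"] by auto
  show ?case
  proof (rule unif_C_SucI[OF assms(1) _ _ C])
    show "(F i has_derivative (\<lambda>v. nderiv (U i) (F i) [v] x)) (at x)" if "x \<in> U i" for i x
      using Ck_on_has_derivative[OF Suc.prems(1) _ that, of "[]"] by (simp add: at_within_open[OF that assms(1)])
    fix v
    have "Ck_on m (U i) (nderiv (U i) (F i) [v])" for i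
      unfolding Ck_on_def nderiv_append[symmetric]
      using Ck_on_differentiable[OF Suc.prems(1)] Ck_on_continuous[OF Suc.prems(1)] by simp
    moreover have "\<exists>C. \<forall>i. \<forall>x\<in>U i. norm (nderiv (U i) (nderiv (U i) (F i) [v]) vs x) \<le> C" if "length vs \<le> m" for vs
    proof -
      have "length (vs @ [v]) \<le> Suc m" using that by simp
      from Suc.prems(2)[OF this] show ?thesis unfolding nderiv_append .
    qed
    ultimately show "unif_C m U (\<lambda>i x. nderiv (U i) (F i) [v] x)" by (rule Suc.IH)
  qed auto
qed

section \<open>Symmetric second derivatives and their diagonalization\<close>

text \<open>Two applications of the mean value theorem. The left side is symmetric in
  \<open>v\<close> and \<open>w\<close>, while the right side shows the mixed derivative in one
  particular order.\<close>

lemma second_difference: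
  fixes f :: "'a::euclidean_space \<Rightarrow> real"
  assumes U: "open U" and f: "Ck_on 2 U f" and h: "h > 0"
    and sub: "\<And>s t. 0 \<le> s \<Longrightarrow> s \<le> h \<Longrightarrow> 0 \<le> t \<Longrightarrow> t \<le> h \<Longrightarrow> x + s *\<^sub>R v + t *\<^sub>R w \<in> U"
  shows "\<exists>s\<in>{0..h}. \<exists>t\<in>{0..h}. f (x + h *\<^sub>R v + h *\<^sub>R w) - f (x + h *\<^sub>R v) - f (x + h *\<^sub>R w) + f x
     = h * h * nderiv U f [w, v] (x + s *\<^sub>R v + t *\<^sub>R w)"
proof -
  have path: "((\<lambda>t. nderiv U f vs (p + t *\<^sub>R z)) has_real_derivative nderiv U f (z # vs) (p + t *\<^sub>R z)) (at t)"
    if "length vs < 2" "p + t *\<^sub>R z \<in> U" for vs p z t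
  proof -
    have *: "(nderiv U f vs has_derivative (\<lambda>v. nderiv U f (v # vs) (p + t *\<^sub>R z))) (at (p + t *\<^sub>R z))"
      using Ck_on_has_derivative[OF f that] at_within_open[OF that(2) U] by simp
    have "((\<lambda>t. p + t *\<^sub>R z) has_derivative (\<lambda>h. h *\<^sub>R z)) (at t)" by (auto intro!: derivative_eq_intros)
    from diff_chain_at[OF this *]
    have "((\<lambda>t. nderiv U f vs (p + t *\<^sub>R z)) has_derivative (\<lambda>h. nderiv U f ((h *\<^sub>R z) # vs) (p + t *\<^sub>R z))) (at t)"
      by (simp add: o_def)
    moreover have "nderiv U f ((h *\<^sub>R z) # vs) (p + t *\<^sub>R z) = nderiv U f (z # vs) (p + t *\<^sub>R z) * h" for h
      using linear_scale[OF has_derivative_linear[OF *], of h z] by simp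
    ultimately show ?thesis unfolding has_field_derivative_def by simp
  qed
  let ?g = "\<lambda>s. f (x + h *\<^sub>R w + s *\<^sub>R v) - f (x + s *\<^sub>R v)"
  have mem1: "x + h *\<^sub>R w + s *\<^sub>R v \<in> U" "x + s *\<^sub>R v \<in> U" if "0 \<le> s" "s \<le> h" for s
    using sub[of s h] sub[of s 0] that h by (auto simp: algebra_simps)
  have "\<exists>s>0. s < h \<and> ?g h - ?g 0 = (h - 0) * (nderiv U f [v] (x + h *\<^sub>R w + s *\<^sub>R v) - nderiv U f [v] (x + s *\<^sub>R v))"
  proof (rule MVT2[OF h])
    show "(?g has_real_derivative (nderiv U f [v] (x + h *\<^sub>R w + s *\<^sub>R v) - nderiv U f [v] (x + s *\<^sub>R v))) (at s)"
      if "0 \<le> s" "s \<le> h" for s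
      using path[of "[]" "x + h *\<^sub>R w" s v] path[of "[]" x s v] mem1[OF that]
      by (intro DERIV_diff) auto
  qed
  then obtain s where s: "0 < s" "s < h" and s': "?g h - ?g 0 = h * (nderiv U f [v] (x + h *\<^sub>R w + s *\<^sub>R v) - nderiv U f [v] (x + s *\<^sub>R v))"
    by auto
  have "\<exists>t>0. t < h \<and> nderiv U f [v] (x + s *\<^sub>R v + h *\<^sub>R w) - nderiv U f [v] (x + s *\<^sub>R v + 0 *\<^sub>R w) = (h - 0) * nderiv U f [w, v] (x + s *\<^sub>R v + t *\<^sub>R w)"
    by (rule MVT2[OF h]) (use path[of "[v]" "x + s *\<^sub>R v" _ w] sub s in auto)
  then obtain t where t: "0 < t" "t < h" and t': "nderiv U f [v] (x + s *\<^sub>R v + h *\<^sub>R w) - nderiv U f [v] (x + s *\<^sub>R v) = h * nderiv U f [w, v] (x + s *\<^sub>R v + t *\<^sub>R w)"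
    by auto
  have "?g h - ?g 0 = h * h * nderiv U f [w, v] (x + s *\<^sub>R v + t *\<^sub>R w)"
    using s' t' by (simp add: algebra_simps)
  then show ?thesis using s t by (intro bexI[of _ s] bexI[of _ t]) (auto simp: algebra_simps)
qed

text \<open>Schwarz's theorem: both orders of differentiation arise from the same second difference
  over a small parallelogram.\<close>

lemma nderiv_symmetric:
  fixes f :: "'a::euclidean_space \<Rightarrow> real"
  assumes U: "open U" and f: "Ck_on 2 U f" and x: "x \<in> U"
  shows "nderiv U f [v, w] x = nderiv U f [w, v] x"
proof -
  let ?A = "nderiv U f [w, v]" and ?B = "nderiv U f [v, w]"
  have "\<bar>?A x - ?B x\<bar> \<le> \<epsilon> + \<epsilon>" if \<epsilon>: "\<epsilon> > 0" for \<epsilon>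
  proof -
    have cont: "isCont ?A x" "isCont ?B x"
      using Ck_on_continuous[OF f, of "[w, v]"] Ck_on_continuous[OF f, of "[v, w]"] U x
      by (auto simp: continuous_on_eq_continuous_at simp del: nderiv.simps)
    obtain d1 where d1: "d1 > 0" "\<And>y. dist y x < d1 \<Longrightarrow> dist (?A y) (?A x) < \<epsilon>"
      using cont(1) \<epsilon> unfolding continuous_at_eps_delta by blast
    obtain d2 where d2: "d2 > 0" "\<And>y. dist y x < d2 \<Longrightarrow> dist (?B y) (?B x) < \<epsilon>"
      using cont(2) \<epsilon> unfolding continuous_at_eps_delta by blast
    obtain d3 where d3: "d3 > 0" "ball x d3 \<subseteq> U" using U x open_contains_ball by metis
    define d where "d = min d1 (min d2 d3)"
    have d: "d > 0" "d \<le> d1" "d \<le> d2" "d \<le> d3" using d1 d2 d3 by (auto simp: d_def)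
    define h where "h = d / (2 * (norm v + norm w + 1))"
    have h: "h > 0" using d(1) by (simp add: h_def add_nonneg_pos)
    have hd: "h * (norm v + norm w) < d"
    proof -
      have "h * (norm v + norm w) \<le> h * (norm v + norm w + 1)" using h by simp
      also have "\<dots> = d / 2" by (simp add: h_def field_simps add_nonneg_eq_0_iff)
      finally show ?thesis using d(1) by linarith
    qed
    have near: "dist (x + s *\<^sub>R v + t *\<^sub>R w) x < d" if "0 \<le> s" "s \<le> h" "0 \<le> t" "t \<le> h" for s t
    proof -
      have "norm (s *\<^sub>R v + t *\<^sub>R w) \<le> s * norm v + t * norm w"
        using norm_triangle_ineq[of "s *\<^sub>R v" "t *\<^sub>R w"] that by simp
      also have "\<dots> \<le> h * norm v + h * norm w" using that by (intro add_mono mult_right_mono) auto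
      finally show ?thesis using hd by (simp add: dist_norm algebra_simps)
    qed
    then have mem: "x + s *\<^sub>R v + t *\<^sub>R w \<in> U" if "0 \<le> s" "s \<le> h" "0 \<le> t" "t \<le> h" for s t
      using that d(4) d3(2) by (force simp: dist_commute)
    then have mem': "x + s *\<^sub>R w + t *\<^sub>R v \<in> U" if "0 \<le> s" "s \<le> h" "0 \<le> t" "t \<le> h" for s t
      using that mem[of t s] by (simp add: algebra_simps)
    obtain s t where A: "s \<in> {0..h}" "t \<in> {0..h}" "f (x + h *\<^sub>R v + h *\<^sub>R w) - f (x + h *\<^sub>R v) - f (x + h *\<^sub>R w) + f x
      = h * h * ?A (x + s *\<^sub>R v + t *\<^sub>R w)"
      using second_difference[OF U f h mem] by blast
    obtain s' t' where B: "s' \<in> {0..h}" "t' \<in> {0..h}" "f (x + h *\<^sub>R w + h *\<^sub>R v) - f (x + h *\<^sub>R w) - f (x + h *\<^sub>R v) + f x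
      = h * h * ?B (x + s' *\<^sub>R w + t' *\<^sub>R v)"
      using second_difference[OF U f h mem'] by blast
    have "h * h * ?A (x + s *\<^sub>R v + t *\<^sub>R w) = h * h * ?B (x + t' *\<^sub>R v + s' *\<^sub>R w)"
      using A(3) B(3) by (simp add: algebra_simps del: nderiv.simps)
    then have "?A (x + s *\<^sub>R v + t *\<^sub>R w) = ?B (x + t' *\<^sub>R v + s' *\<^sub>R w)"
      using h by (simp del: nderiv.simps)
    moreover have "dist (?A (x + s *\<^sub>R v + t *\<^sub>R w)) (?A x) < \<epsilon>"
      by (rule d1(2)) (use near[of s t] A d(2) in auto)
    moreover have "dist (?B (x + t' *\<^sub>R v + s' *\<^sub>R w)) (?B x) < \<epsilon>"
      by (rule d2(2)) (use near[of t' s'] B d(3) in auto)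
    ultimately show ?thesis unfolding dist_real_def by linarith
  qed
  then have "\<bar>?A x - ?B x\<bar> \<le> 0 + e" if "e > 0" for e using that[THEN half_gt_zero] by (metis add_0 field_sum_of_halves)
  then have "\<bar>?A x - ?B x\<bar> \<le> 0" by (rule field_le_epsilon)
  then show ?thesis by linarith
qed

text \<open>The spectral theorem on an invariant subspace, by induction on the dimension: a
  maximizer of the quadratic form on the unit sphere is an eigenvector, and its orthogonal
  complement in \<open>S\<close> is again invariant.\<close>

lemma orthonormal_eigenbasis:
  fixes T :: "'a::euclidean_space \<Rightarrow> 'a"
  assumes T: "linear T" and sym: "\<And>x y. T x \<bullet> y = x \<bullet> T y"
    and "subspace S" "\<And>x. x \<in> S \<Longrightarrow> T x \<in> S"
  shows "\<exists>B. B \<subseteq> S \<and> S \<subseteq> span B \<and> pairwise orthogonal B \<and> (\<forall>b\<in>B. norm b = 1 \<and> (\<exists>c. T b = c *\<^sub>R b))"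
  using assms(3,4)
proof (induction "dim S" arbitrary: S rule: less_induct)
  case less
  show ?case
  proof (cases "S \<subseteq> {0}")
    case True
    then show ?thesis by (intro exI[of _ "{}"]) auto
  next
    case False
    then obtain y where y: "y \<in> S" "y \<noteq> 0" by auto
    let ?K = "sphere 0 1 \<inter> S"
    have "(1 / norm y) *\<^sub>R y \<in> ?K" using y less.prems(1) by (auto simp: subspace_scale)
    then have ne: "?K \<noteq> {}" by blast
    have cpt: "compact ?K" by (intro compact_Int_closed compact_sphere closed_subspace less.prems(1))
    have "continuous_on ?K (\<lambda>x. x \<bullet> T x)"
      using T by (intro continuous_intros linear_continuous_on) (simp add: linear_conv_bounded_linear)
    from continuous_attains_sup[OF cpt ne this] obtain u where u: "u \<in> S" "norm u = 1"
      and umax: "\<And>z. z \<in> S \<Longrightarrow> norm z = 1 \<Longrightarrow> z \<bullet> T z \<le> u \<bullet> T u" by auto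
    have uu: "u \<bullet> u = 1" using u(2) by (simp add: norm_eq_1)
    define c where "c = u \<bullet> T u"
    have quad: "z \<bullet> T z \<le> c * (z \<bullet> z)" if z: "z \<in> S" for z
    proof (cases "z = 0")
      case False
      have "((1 / norm z) *\<^sub>R z) \<bullet> T ((1 / norm z) *\<^sub>R z) \<le> c"
        unfolding c_def by (rule umax) (use z False less.prems(1) in \<open>auto simp: subspace_scale\<close>)
      then have "(1 / norm z)\<^sup>2 * (z \<bullet> T z) \<le> c"
        by (simp add: linear_scale[OF T] power2_eq_square)
      then show ?thesis using False by (simp add: field_simps power2_norm_eq_inner)
    qed (simp add: linear_0[OF T])
    have orth: "T u \<bullet> w = 0" if w: "w \<in> S" "w \<bullet> u = 0" for w
    proof -
      define C where "C = c * (w \<bullet> w) - w \<bullet> T w"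
      \<comment> \<open>Maximality of \<open>u\<close> compared along u + t w; the term linear in t
        has to vanish.\<close>
      have "2 * t * (T u \<bullet> w) \<le> t\<^sup>2 * C" for t
      proof -
        have "u + t *\<^sub>R w \<in> S" using u w less.prems(1) by (simp add: subspace_add subspace_scale)
        from quad[OF this] have "(u + t *\<^sub>R w) \<bullet> T (u + t *\<^sub>R w) \<le> c * ((u + t *\<^sub>R w) \<bullet> (u + t *\<^sub>R w))" .
        moreover have "(u + t *\<^sub>R w) \<bullet> T (u + t *\<^sub>R w) = c + 2 * t * (T u \<bullet> w) + t\<^sup>2 * (w \<bullet> T w)"
          using sym[of u w]
          by (simp add: linear_add[OF T] linear_scale[OF T] inner_add_left inner_add_right c_def power2_eq_square inner_commute algebra_simps)
        moreover have "(u + t *\<^sub>R w) \<bullet> (u + t *\<^sub>R w) = 1 + t\<^sup>2 * (w \<bullet> w)"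
          using w(2) uu by (simp add: inner_add_left inner_add_right power2_eq_square inner_commute)
        ultimately have "c + 2 * t * (T u \<bullet> w) + t\<^sup>2 * (w \<bullet> T w) \<le> c * (1 + t\<^sup>2 * (w \<bullet> w))" by simp
        then show ?thesis by (simp add: C_def algebra_simps)
      qed
      note q = this
      define A where "A = T u \<bullet> w"
      have q': "2 * t * A \<le> t\<^sup>2 * C" for t using q[of t] by (simp add: A_def)
      have "A = 0"
      proof (rule ccontr)
        assume A: "A \<noteq> 0"
        \<comment> \<open>For t = A/D the linear term outweighs the quadratic one; the summand 1
          keeps \<open>D\<close> positive and above \<open>C\<close>.\<close>
        define D where "D = \<bar>C\<bar> + 1"
        have D: "D > 0" "C < D" by (auto simp: D_def)
        have "2 * (A / D) * A \<le> (A / D)\<^sup>2 * C" by (rule q')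
        also have "\<dots> \<le> (A / D)\<^sup>2 * D" using D by (intro mult_left_mono) auto
        also have "\<dots> = (A / D) * A" using D by (simp add: power2_eq_square)
        finally have "(A / D) * A \<le> 0" by simp
        moreover have "0 < A * A" using A not_real_square_gt_zero by blast
        then have "(A / D) * A > 0" using D by simp
        ultimately show False by simp
      qed
      then show ?thesis by (simp add: A_def)
    qed
    have Tu: "T u = c *\<^sub>R u"
    proof -
      let ?z = "T u - c *\<^sub>R u"
      have zS: "?z \<in> S" using less.prems u by (simp add: subspace_diff subspace_scale)
      have zu: "?z \<bullet> u = 0" using uu by (simp add: inner_diff_left inner_diff_right c_def inner_commute)
      have "?z \<bullet> ?z = T u \<bullet> ?z - c * (u \<bullet> ?z)" by (simp add: inner_diff_left)
      also have "\<dots> = 0" using orth[OF zS zu] zu by (simp add: inner_commute)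
      finally show ?thesis by simp
    qed
    define S' where "S' = {y \<in> S. y \<bullet> u = 0}"
    have sub': "subspace S'" using less.prems(1) by (auto simp: S'_def subspace_def inner_add_left)
    have T': "T y \<in> S'" if "y \<in> S'" for y
      using that less.prems(2) sym[of y u] Tu by (auto simp: S'_def)
    have "u \<notin> S'" using uu by (simp add: S'_def)
    moreover have "S' \<subseteq> S" by (auto simp: S'_def)
    ultimately have "S' \<subset> S" using u(1) by blast
    moreover have "span S = S" "span S' = S'"
      using sub' less.prems(1) span_eq_iff by blast+
    ultimately have "dim S' < dim S" by (intro dim_psubset) (simp only:)
    from less.hyps[OF this sub' T'] obtain B where B: "B \<subseteq> S'" "S' \<subseteq> span B" "pairwise orthogonal B"
      "\<forall>b\<in>B. norm b = 1 \<and> (\<exists>c. T b = c *\<^sub>R b)" by blast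
    show ?thesis
    proof (intro exI[of _ "insert u B"] conjI)
      show "insert u B \<subseteq> S" using u B(1) by (auto simp: S'_def)
      show "S \<subseteq> span (insert u B)"
      proof
        fix y assume "y \<in> S"
        then have "y - (y \<bullet> u) *\<^sub>R u \<in> S'"
          using u(1) uu less.prems(1) by (simp add: S'_def subspace_diff subspace_scale inner_diff_left)
        then have "y - (y \<bullet> u) *\<^sub>R u \<in> span (insert u B)" using B(2) span_mono[of B "insert u B"] by auto
        moreover have "(y \<bullet> u) *\<^sub>R u \<in> span (insert u B)" by (simp add: span_base span_scale)
        ultimately have "(y - (y \<bullet> u) *\<^sub>R u) + (y \<bullet> u) *\<^sub>R u \<in> span (insert u B)" by (rule span_add)
        then show "y \<in> span (insert u B)" by simp
      qed
      show "pairwise orthogonal (insert u B)"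
        using B(1,3) by (auto simp: pairwise_insert orthogonal_def S'_def inner_commute)
      show "\<forall>b\<in>insert u B. norm b = 1 \<and> (\<exists>c. T b = c *\<^sub>R b)" using B(4) u(2) Tu by auto
    qed
  qed
qed

text \<open>Eigenvectors are attached to coordinates in such a way that along the enumeration
  \<open>e\<close> those with positive eigenvalue come first, the order that
  \<open>morse_form\<close> prescribes.\<close>

lemma orthogonal_diagonalization:
  fixes T :: "real ^ 'n \<Rightarrow> real ^ 'n" and e :: "nat \<Rightarrow> 'n"
  assumes T: "linear T" and sym: "\<And>x y. T x \<bullet> y = x \<bullet> T y"
    and e: "bij_betw e {1..CARD('n)} UNIV"
    and \<theta>: "\<theta> > 0" "\<And>v. \<theta> * norm v \<le> norm (T v)"
  obtains Q \<mu> l where "orthogonal_transformation Q" "l \<le> CARD('n)"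
    "\<And>v w. Q w \<bullet> T (Q v) = (\<Sum>a\<in>UNIV. \<mu> a * v $ a * w $ a)" "\<And>a. \<theta> \<le> \<bar>\<mu> a\<bar>"
    "\<And>m. m \<in> {1..l} \<Longrightarrow> \<mu> (e m) > 0" "\<And>m. m \<in> {l+1..CARD('n)} \<Longrightarrow> \<mu> (e m) < 0"
proof -
  obtain B where "pairwise orthogonal B" "UNIV \<subseteq> span B" and B: "\<And>b. b \<in> B \<Longrightarrow> norm b = 1" "\<And>b. b \<in> B \<Longrightarrow> \<exists>c. T b = c *\<^sub>R b"
    using orthonormal_eigenbasis[OF T sym subspace_UNIV] by blast
  moreover have "0 \<notin> B" using B(1) by force
  ultimately have B': "independent B" "span B = UNIV" and Borth: "pairwise orthogonal B"
    using pairwise_orthogonal_independent by auto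
  have fin: "finite B" and cardB: "card B = CARD('n)"
    using B' independent_imp_finite basis_card_eq_dim[of B UNIV] by (auto simp: dim_UNIV)
  define ev where "ev b = b \<bullet> T b" for b
  have ev: "T b = ev b *\<^sub>R b" if "b \<in> B" for b
  proof -
    have b: "b \<in> B" by fact
    obtain c where c: "T b = c *\<^sub>R b" using B(2)[OF b] by auto
    then show ?thesis using B(1)[OF b] by (simp add: ev_def norm_eq_1)
  qed
  have ev\<theta>: "\<theta> \<le> \<bar>ev b\<bar>" if "b \<in> B" for b using \<theta>(2)[of b] ev[OF that] B(1)[OF that] by simp
  define P where "P = {b \<in> B. ev b > 0}"
  define l where "l = card P"
  have P: "P \<subseteq> B" "finite P" "finite (B - P)" using fin by (auto simp: P_def)
  have l: "l \<le> CARD('n)" using card_mono[OF fin P(1)] cardB by (simp add: l_def)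
  have "card (B - P) = CARD('n) - l" using P cardB by (simp add: card_Diff_subset l_def)
  then have "\<exists>g. bij_betw g {l+1..CARD('n)} (B - P)"
    by (intro finite_same_card_bij) (use P l in auto)
  then obtain g where g: "bij_betw g {l+1..CARD('n)} (B - P)" by blast
  have "\<exists>f. bij_betw f {1..l} P" by (intro finite_same_card_bij) (use P in \<open>auto simp: l_def\<close>)
  then obtain f where f: "bij_betw f {1..l} P" by blast
  define \<beta> where "\<beta> m = (if m \<le> l then f m else g m)" for m
  have b1: "bij_betw \<beta> {1..l} P" using f by (subst bij_betw_cong[of _ _ f]) (auto simp: \<beta>_def)
  have b2: "bij_betw \<beta> {l+1..CARD('n)} (B - P)" using g by (subst bij_betw_cong[of _ _ g]) (auto simp: \<beta>_def)
  have "{1..l} \<union> {l+1..CARD('n)} = {1..CARD('n)}" "P \<union> (B - P) = B" using l P(1) by auto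
  then have \<beta>: "bij_betw \<beta> {1..CARD('n)} B" using bij_betw_combine[OF b1 b2] by auto
  define q where "q a = \<beta> (inv_into {1..CARD('n)} e a)" for a
  have q: "bij_betw q UNIV B"
    using bij_betw_trans[OF bij_betw_inv_into[OF e] \<beta>] by (simp add: q_def[abs_def] o_def)
  have qe: "q (e m) = \<beta> m" if "m \<in> {1..CARD('n)}" for m
    unfolding q_def using bij_betw_inv_into_left[OF e that] by simp
  have qB: "q a \<in> B" for a using q by (auto simp: bij_betw_def)
  have qq: "q a \<bullet> q b = (if a = b then 1 else 0)" for a b
  proof (cases "a = b")
    case False
    then have "q a \<noteq> q b" using q by (auto simp: bij_betw_def inj_on_def)
    then show ?thesis using Borth qB[of a] qB[of b] False by (auto simp: pairwise_def orthogonal_def)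
  qed (use B(1)[OF qB] in \<open>simp add: norm_eq_1\<close>)
  define Q where "Q x = (\<Sum>a\<in>UNIV. x $ a *\<^sub>R q a)" for x :: "real ^ 'n"
  define \<mu> where "\<mu> a = ev (q a)" for a
  have linQ: "linear Q"
    by (rule linearI) (auto simp: Q_def scaleR_add_left sum.distrib scaleR_sum_right)
  have QQ: "Q x \<bullet> Q y = x \<bullet> y" for x y
  proof -
    have "Q x \<bullet> Q y = (\<Sum>a\<in>UNIV. \<Sum>b\<in>UNIV. if a = b then x $ a * y $ b else 0)"
      unfolding Q_def inner_sum_left inner_sum_right by (intro sum.cong refl) (auto simp: qq)
    then show ?thesis by (simp add: inner_vec_def)
  qed
  have "orthogonal_transformation Q" using linQ QQ by (simp add: orthogonal_transformation_def)
  moreover have "Q w \<bullet> T (Q v) = (\<Sum>a\<in>UNIV. \<mu> a * v $ a * w $ a)" for v w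
  proof -
    have "T (Q v) = Q (\<chi> a. \<mu> a * v $ a)"
      unfolding Q_def by (simp add: linear_sum[OF T] linear_scale[OF T] ev[OF qB] \<mu>_def mult.commute)
    then have "Q w \<bullet> T (Q v) = w \<bullet> (\<chi> a. \<mu> a * v $ a)" by (simp only: QQ)
    then show ?thesis by (simp add: inner_vec_def mult.commute mult.left_commute)
  qed
  moreover have "\<theta> \<le> \<bar>\<mu> a\<bar>" for a unfolding \<mu>_def by (rule ev\<theta>[OF qB])
  moreover have "\<mu> (e m) > 0" if "m \<in> {1..l}" for m
    using bij_betwE[OF b1] that qe[of m] l by (auto simp: \<mu>_def P_def)
  moreover have "\<mu> (e m) < 0" if m: "m \<in> {l+1..CARD('n)}" for m
  proof -
    have "\<beta> m \<in> B - P" using bij_betwE[OF b2] m by blast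
    then have "\<beta> m \<in> B" "ev (\<beta> m) \<le> 0" by (auto simp: P_def)
    then show ?thesis using ev\<theta>[of "\<beta> m"] \<theta>(1) qe[of m] m by (auto simp: \<mu>_def)
  qed
  ultimately show ?thesis using that[of Q l \<mu>] l by blast
qed

section \<open>The uniform Morse lemma\<close>

lemma Ck_on_le: "Ck_on k U f \<Longrightarrow> k' \<le> k \<Longrightarrow> Ck_on k' U f"
  by (simp add: Ck_on_def)

text \<open>Homogeneity in all directions at once brings arbitrary directions into the unit ball,
  where the C^k norm is evaluated.\<close>

lemma nderiv_scale_map:
  assumes U: "full_tangent U" and f: "Ck_on k U f" and "length vs \<le> k" "x \<in> U"
  shows "nderiv U f (map ((*\<^sub>R) c) vs) x = c ^ length vs *\<^sub>R nderiv U f vs x"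
  using assms(3,4)
proof (induction vs arbitrary: x)
  case (Cons v vs)
  have d: "(nderiv U f vs has_derivative (\<lambda>v. nderiv U f (v # vs) x)) (at x within U)"
    by (rule Ck_on_has_derivative[OF f]) (use Cons.prems in auto)
  then have "((\<lambda>x. c ^ length vs *\<^sub>R nderiv U f vs x) has_derivative
      (\<lambda>v. c ^ length vs *\<^sub>R nderiv U f (v # vs) x)) (at x within U)"
    by (rule has_derivative_scaleR_right)
  then have "(nderiv U f (map ((*\<^sub>R) c) vs) has_derivative
      (\<lambda>v. c ^ length vs *\<^sub>R nderiv U f (v # vs) x)) (at x within U)"
    by (rule has_derivative_transform[rotated 2]) (use Cons in auto)
  from full_tangent_frechet_derivative[OF U Cons.prems(2) this]
  have "nderiv U f (map ((*\<^sub>R) c) (v # vs)) x = c ^ length vs *\<^sub>R nderiv U f ((c *\<^sub>R v) # vs) x" by simp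
  also have "nderiv U f ((c *\<^sub>R v) # vs) x = c *\<^sub>R nderiv U f (v # vs) x"
    by (rule linear_scale[OF has_derivative_linear[OF d]])
  finally show ?case by (simp del: nderiv.simps add: mult.commute)
qed auto

lemma Ck_norm_nderiv_bound:
  assumes U: "full_tangent U" and vs: "1 \<le> length vs" "length vs \<le> k"
  shows "\<exists>C. \<forall>f. Ck_on k U f \<longrightarrow> Ck_norm k U f \<le> ereal K \<longrightarrow> (\<forall>x\<in>U. norm (nderiv U f vs x) \<le> C)"
proof -
  \<comment> \<open>The summand 1 keeps the scaling factor positive even if all directions are
    0.\<close>
  define S where "S = 1 + (\<Sum>v\<leftarrow>vs. norm v)"
  have nn: "0 \<le> (\<Sum>v\<leftarrow>vs. norm v)" by (rule sum_list_nonneg) auto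
  then have S: "S > 0" by (simp add: S_def)
  have le: "norm v \<le> S" if "v \<in> set vs" for v
  proof -
    have "norm v \<le> (\<Sum>v\<leftarrow>vs. norm v)" by (rule member_le_sum_list) (use that in auto)
    then show ?thesis by (simp add: S_def)
  qed
  have k: "1 \<le> k" using vs by simp
  have "norm (nderiv U f vs x) \<le> S ^ length vs * K"
    if f: "Ck_on k U f" "Ck_norm k U f \<le> ereal K" and x: "x \<in> U" for f :: "'a \<Rightarrow> 'b" and x
  proof -
    let ?ws = "map ((*\<^sub>R) (1 / S)) vs"
    have "norm (nderiv U f ?ws x) \<le> K"
      using f(2) vs x le S unfolding Ck_norm_le_iff[OF k] by (auto simp: field_simps)
    moreover have "nderiv U f vs x = S ^ length vs *\<^sub>R nderiv U f ?ws x"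
      using nderiv_scale_map[OF U f(1) vs(2) x, of "1 / S"] S by (simp add: power_divide)
    ultimately show ?thesis using S by simp
  qed
  then show ?thesis by blast
qed

lemma nderiv_single:
  fixes f :: "real ^ 'n \<Rightarrow> 'b::real_normed_vector"
  assumes "Ck_on k U f" "length vs < k" "x \<in> U"
  shows "nderiv U f (v # vs) x = (\<Sum>j\<in>UNIV. v $ j *\<^sub>R nderiv U f (axis j 1 # vs) x)"
proof -
  have lin: "linear (\<lambda>v. nderiv U f (v # vs) x)"
    by (rule has_derivative_linear[OF Ck_on_has_derivative[OF assms]])
  have "nderiv U f (v # vs) x = nderiv U f ((\<Sum>j\<in>UNIV. v $ j *\<^sub>R axis j 1) # vs) x"
    by (simp add: basis_expansion flip: scalar_mult_eq_scaleR)
  also have "\<dots> = (\<Sum>j\<in>UNIV. v $ j *\<^sub>R nderiv U f (axis j 1 # vs) x)"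
    by (simp only: linear_sum[OF lin] linear_scale[OF lin])
  finally show ?thesis .
qed

text \<open>Linearity in the outer direction is that of a derivative; linearity in the inner one
  comes from differentiating the identity \<open>nderiv_single\<close>.\<close>

lemma nderiv_pair_right:
  fixes f :: "real ^ 'n \<Rightarrow> real"
  assumes U: "full_tangent U" and f: "Ck_on k U f" "2 \<le> k" and x: "x \<in> U"
  shows "nderiv U f [w, v] x = (\<Sum>j\<in>UNIV. v $ j * nderiv U f [w, axis j 1] x)"
proof -
  have "((\<lambda>y. \<Sum>j\<in>UNIV. v $ j *\<^sub>R nderiv U f [axis j 1] y) has_derivative
      (\<lambda>w. \<Sum>j\<in>UNIV. v $ j *\<^sub>R nderiv U f [w, axis j 1] x)) (at x within U)"
    by (intro has_derivative_sum has_derivative_scaleR_right Ck_on_has_derivative[OF f(1)]) (use f x in auto)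
  then have "(nderiv U f [v] has_derivative
      (\<lambda>w. \<Sum>j\<in>UNIV. v $ j *\<^sub>R nderiv U f [w, axis j 1] x)) (at x within U)"
    by (rule has_derivative_transform[rotated 2]) (use x nderiv_single[OF f(1), of "[]"] f(2) in auto)
  from full_tangent_frechet_derivative[OF U x this] show ?thesis by simp
qed

text \<open>The outer direction pairs with the row index. Symmetry does not enter, so this covers
  boundary points too.\<close>

lemma nderiv_Hessian:
  fixes f :: "real ^ 'n \<Rightarrow> real"
  assumes U: "full_tangent U" and f: "Ck_on k U f" "2 \<le> k" and x: "x \<in> U"
  shows "nderiv U f [w, v] x = w \<bullet> (Hessian U f x *v v)"
proof -
  have "nderiv U f [w, v] x = (\<Sum>j\<in>UNIV. v $ j * nderiv U f [w, axis j 1] x)"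
    by (rule nderiv_pair_right[OF assms])
  also have "\<dots> = (\<Sum>j\<in>UNIV. v $ j * (\<Sum>i\<in>UNIV. w $ i * nderiv U f [axis i 1, axis j 1] x))"
    using nderiv_single[OF f(1), of "[axis _ 1]" x w] f(2) x by simp
  also have "\<dots> = (\<Sum>j\<in>UNIV. \<Sum>i\<in>UNIV. w $ i * (Hessian U f x $ i $ j * v $ j))"
    by (simp only: Hessian_def vec_lambda_beta sum_distrib_left mult_ac)
  also have "\<dots> = (\<Sum>i\<in>UNIV. \<Sum>j\<in>UNIV. w $ i * (Hessian U f x $ i $ j * v $ j))" by (rule sum.swap)
  also have "\<dots> = w \<bullet> (Hessian U f x *v v)"
    by (simp only: inner_vec_def matrix_vector_mult_def vec_lambda_beta sum_distrib_left inner_real_def)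
  finally show ?thesis .
qed

lemma nderiv_commute_interior:
  fixes f :: "'a::euclidean_space \<Rightarrow> real"
  assumes f: "Ck_on k U f" "2 \<le> k" and W: "open W" "W \<subseteq> U" "x \<in> W"
  shows "nderiv U f [v, w] x = nderiv U f [w, v] x"
proof -
  note full = full_tangent_open[OF W(1)]
  have f2: "Ck_on 2 U f" by (rule Ck_on_le[OF f])
  have "nderiv W f [v, w] x = nderiv W f [w, v] x"
    by (rule nderiv_symmetric[OF W(1) Ck_on_restrict[OF full W(2) f2] W(3)])
  then show ?thesis
    using nderiv_restrict[OF full W(2) f2 _ W(3), of "[v, w]"] nderiv_restrict[OF full W(2) f2 _ W(3), of "[w, v]"]
    by (simp del: nderiv.simps)
qed

section \<open>The normal form near a critical point\<close>

lemma morse_form_sum: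
  fixes y :: "real ^ 'n"
  assumes e: "bij_betw e {1..CARD('n)} (UNIV :: 'n set)" and l: "l \<le> CARD('n)"
    and pos: "\<And>m. m \<in> {1..l} \<Longrightarrow> \<mu> (e m) > 0" and neg: "\<And>m. m \<in> {l+1..CARD('n)} \<Longrightarrow> \<mu> (e m) < (0::real)"
  shows "(\<Sum>a\<in>UNIV. sgn (\<mu> a) * (y $ a)\<^sup>2) = morse_form e l y"
proof -
  have "(\<Sum>a\<in>UNIV. sgn (\<mu> a) * (y $ a)\<^sup>2) = (\<Sum>m\<in>{1..CARD('n)}. sgn (\<mu> (e m)) * (y $ e m)\<^sup>2)"
    using sum.reindex_bij_betw[OF e, of "\<lambda>a. sgn (\<mu> a) * (y $ a)\<^sup>2"] by simp
  also have "{1..CARD('n)} = {1..l} \<union> {l+1..CARD('n)}" using l by auto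
  also have "(\<Sum>m\<in>{1..l} \<union> {l+1..CARD('n)}. sgn (\<mu> (e m)) * (y $ e m)\<^sup>2)
     = (\<Sum>m\<in>{1..l}. sgn (\<mu> (e m)) * (y $ e m)\<^sup>2) + (\<Sum>m\<in>{l+1..CARD('n)}. sgn (\<mu> (e m)) * (y $ e m)\<^sup>2)"
    by (rule sum.union_disjoint) auto
  also have "(\<Sum>m\<in>{1..l}. sgn (\<mu> (e m)) * (y $ e m)\<^sup>2) = (\<Sum>m\<in>{1..l}. (y $ e m)\<^sup>2)"
    by (rule sum.cong) (use pos in auto)
  also have "(\<Sum>m\<in>{l+1..CARD('n)}. sgn (\<mu> (e m)) * (y $ e m)\<^sup>2) = (\<Sum>m\<in>{l+1..CARD('n)}. - (y $ e m)\<^sup>2)"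
    by (rule sum.cong) (use neg in auto)
  finally show ?thesis by (simp add: morse_form_def sum_negf)
qed

text \<open>The index of the family is the tuple of function, critical point, diagonalizing
  orthogonal map and eigenvalues. The number \<open>\<theta>\<close> is at once the radius of a ball
  inside \<open>B\<close>, a lower bound for the eigenvalues and an upper bound for
  \<open>\<delta>\<close>.\<close>

lemma uniform_morse_coordinates:
  fixes B :: "(real ^ 'n) set"
  assumes B: "full_tangent B" "bounded B" and \<theta>: "\<theta> > 0"
  shows "\<exists>\<delta> M. 0 < \<delta> \<and> \<delta> \<le> \<theta> \<and> 0 < M \<and>
    (\<forall>f x0 (Q :: real ^ 'n \<Rightarrow> real ^ 'n) \<mu>. Ck_on (Suc (Suc (Suc m))) B f \<and> Ck_norm (Suc (Suc (Suc m))) B f \<le> ereal K \<and>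
      ball x0 \<theta> \<subseteq> B \<and> (\<forall>v. nderiv B f [v] x0 = 0) \<and> orthogonal_transformation Q \<and>
      (\<forall>v w. nderiv B f [Q w, Q v] x0 = (\<Sum>a\<in>UNIV. \<mu> a * v $ a * w $ a)) \<and> (\<forall>a. \<theta> \<le> \<bar>\<mu> a\<bar>) \<longrightarrow>
      (\<exists>\<phi>. Ck_diffeo_onto_image (Suc (Suc m)) (ball x0 \<delta>) \<phi> \<and> Ck_norm (Suc (Suc m)) (ball x0 \<delta>) \<phi> \<le> ereal M \<and>
        (\<forall>x\<in>ball x0 \<delta>. f x = f x0 + (\<Sum>a\<in>UNIV. sgn (\<mu> a) * (\<phi> x $ a)\<^sup>2))))"
proof -
  let ?k = "Suc (Suc (Suc m))"
  define V :: "((real ^ 'n \<Rightarrow> real) \<times> (real ^ 'n) \<times> (real ^ 'n \<Rightarrow> real ^ 'n) \<times> ('n \<Rightarrow> real)) set" where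
    "V = {(f, x0, Q, \<mu>). Ck_on ?k B f \<and> Ck_norm ?k B f \<le> ereal K \<and> ball x0 \<theta> \<subseteq> B \<and>
       (\<forall>v. nderiv B f [v] x0 = 0) \<and> orthogonal_transformation Q \<and>
       (\<forall>v w. nderiv B f [Q w, Q v] x0 = (\<Sum>a\<in>UNIV. \<mu> a * v $ a * w $ a)) \<and> (\<forall>a. \<theta> \<le> \<bar>\<mu> a\<bar>)}"
  define F where "F i = fst i" for i :: "(real ^ 'n \<Rightarrow> real) \<times> (real ^ 'n) \<times> (real ^ 'n \<Rightarrow> real ^ 'n) \<times> ('n \<Rightarrow> real)"
  define X where "X i = fst (snd i)" for i :: "(real ^ 'n \<Rightarrow> real) \<times> (real ^ 'n) \<times> (real ^ 'n \<Rightarrow> real ^ 'n) \<times> ('n \<Rightarrow> real)"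
  define Q where "Q i = fst (snd (snd i))" for i :: "(real ^ 'n \<Rightarrow> real) \<times> (real ^ 'n) \<times> (real ^ 'n \<Rightarrow> real ^ 'n) \<times> ('n \<Rightarrow> real)"
  define \<mu> where "\<mu> i = snd (snd (snd i))" for i :: "(real ^ 'n \<Rightarrow> real) \<times> (real ^ 'n) \<times> (real ^ 'n \<Rightarrow> real ^ 'n) \<times> ('n \<Rightarrow> real)"
  have V: "Ck_on ?k B (F i)" "Ck_norm ?k B (F i) \<le> ereal K" "ball (X i) \<theta> \<subseteq> B"
    "\<And>v. nderiv B (F i) [v] (X i) = 0" "orthogonal_transformation (Q i)"
    "\<And>v w. nderiv B (F i) [Q i w, Q i v] (X i) = (\<Sum>a\<in>UNIV. \<mu> i a * v $ a * w $ a)" "\<And>a. \<theta> \<le> \<bar>\<mu> i a\<bar>"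
    if "i \<in> V" for i
    using that by (auto simp: V_def F_def X_def Q_def \<mu>_def)
  obtain b where b: "\<And>x. x \<in> B \<Longrightarrow> norm x \<le> b" using B(2) bounded_iff by metis
  define U where "U r i = (if i \<in> V then ball (X i) r else {})" for r i
  have opU: "open (U r i)" for r i by (simp add: U_def)
  have UB: "U r i \<subseteq> B" if "r \<le> \<theta>" for r i using V(3)[of i] that by (auto simp: U_def subset_iff)
  have XB: "X i \<in> U r i" if "i \<in> V" "r > 0" for r i using that by (simp add: U_def)
  have nU: "nderiv (U \<theta> i) (F i) vs x = nderiv B (F i) vs x" if "length vs \<le> ?k" "x \<in> U \<theta> i" for vs i x
  proof -
    have i: "i \<in> V" using that(2) by (auto simp: U_def split: if_splits)
    show ?thesis by (rule nderiv_restrict[OF full_tangent_open[OF opU] UB[OF order_refl] V(1)[OF i] that])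
  qed
  have CkU: "Ck_on ?k (U \<theta> i) (F i)" for i
  proof (cases "i \<in> V")
    case True
    show ?thesis by (rule Ck_on_restrict[OF full_tangent_open[OF opU] UB[OF order_refl] V(1)[OF True]])
  next
    case False
    then show ?thesis by (simp add: Ck_on_def U_def differentiable_on_def)
  qed
  have bdU: "\<exists>C. \<forall>i. \<forall>x\<in>U \<theta> i. norm (nderiv (U \<theta> i) (F i) vs x) \<le> C" if vs: "1 \<le> length vs" "length vs \<le> ?k" for vs
  proof -
    obtain C where C: "\<And>f x. Ck_on ?k B f \<Longrightarrow> Ck_norm ?k B f \<le> ereal K \<Longrightarrow> x \<in> B \<Longrightarrow> norm (nderiv B f vs x :: real) \<le> C"
      using Ck_norm_nderiv_bound[OF B(1) vs, of K, where 'b = real] by blast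
    have "norm (nderiv (U \<theta> i) (F i) vs x) \<le> C" if x: "x \<in> U \<theta> i" for i x
    proof -
      have i: "i \<in> V" using x by (auto simp: U_def split: if_splits)
      show ?thesis unfolding nU[OF vs(2) x] using C[OF V(1,2)[OF i]] x UB[of \<theta> i] by auto
    qed
    then show ?thesis by blast
  qed
  have dU: "(F i has_derivative (\<lambda>v. nderiv (U \<theta> i) (F i) [v] x)) (at x)" if "x \<in> U \<theta> i" for i x
    using Ck_on_has_derivative[OF CkU _ that, of "[]"] by (simp add: at_within_open[OF that opU])
  have D: "unif_C (Suc (Suc m)) (U \<theta>) (\<lambda>i x. nderiv (U \<theta> i) (F i) [v] x)" for v
  proof (rule unif_CI_nderiv[OF opU])
    show "Ck_on (Suc (Suc m)) (U \<theta> i) (nderiv (U \<theta> i) (F i) [v])" for i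
      unfolding Ck_on_def nderiv_append[symmetric]
      using Ck_on_differentiable[OF CkU] Ck_on_continuous[OF CkU] by simp
    show "\<exists>C. \<forall>i. \<forall>x\<in>U \<theta> i. norm (nderiv (U \<theta> i) (nderiv (U \<theta> i) (F i) [v]) vs x) \<le> C" if "length vs \<le> Suc (Suc m)" for vs
      unfolding nderiv_append[symmetric] by (rule bdU) (use that in auto)
  qed
  \<comment> \<open>The C^k norm says nothing about values, so a uniform bound exists only after
    subtracting the value at the centre.\<close>
  define G where "G i x = F i x - F i (X i)" for i x
  have dG: "(G i has_derivative (\<lambda>v. nderiv (U \<theta> i) (F i) [v] x)) (at x)" if "x \<in> U \<theta> i" for i x
    using has_derivative_diff[OF dU[OF that] has_derivative_const[of "F i (X i)"]] by (simp add: G_def[abs_def])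
  have G: "unif_C ?k (U \<theta>) G"
  proof (rule unif_C_SucI[OF opU dG D])
    fix i x assume x: "x \<in> U \<theta> i"
    then have i: "i \<in> V" by (auto simp: U_def split: if_splits)
    have Kb: "norm (nderiv (U \<theta> i) (F i) [v] y) \<le> \<bar>K\<bar> * norm v" if y: "y \<in> U \<theta> i" for v y
    proof (cases "v = 0")
      case True
      then show ?thesis using linear_0[OF has_derivative_linear[OF dU[OF y]]] by simp
    next
      case False
      have "norm (nderiv (U \<theta> i) (F i) [(1 / norm v) *\<^sub>R v] y) \<le> K"
      proof -
        have "norm (nderiv B (F i) [(1 / norm v) *\<^sub>R v] y) \<le> K"
        proof -
          have k: "1 \<le> ?k" by simp
          have "y \<in> B" using y UB[of \<theta> i] by auto
          moreover have "\<forall>w\<in>set [(1 / norm v) *\<^sub>R v]. norm w \<le> 1" by simp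
          moreover have "1 \<le> length [(1 / norm v) *\<^sub>R v]" "length [(1 / norm v) *\<^sub>R v] \<le> ?k" by auto
          ultimately show ?thesis using V(2)[OF i] unfolding Ck_norm_le_iff[OF k] by blast
        qed
        then show ?thesis using nU[of "[(1 / norm v) *\<^sub>R v]" y i] y by (simp del: nderiv.simps)
      qed
      then have "\<bar>1 / norm v\<bar> * norm (nderiv (U \<theta> i) (F i) [v] y) \<le> K"
        using linear_scale[OF has_derivative_linear[OF dU[OF y]], of "1 / norm v" v] by (simp del: nderiv.simps)
      then have "norm (nderiv (U \<theta> i) (F i) [v] y) \<le> K * norm v" using False by (simp add: field_simps del: nderiv.simps)
      then show ?thesis by (smt (verit) mult_right_mono norm_ge_zero)
    qed
    have "norm (F i x - F i (X i)) \<le> \<bar>K\<bar> * norm (x - X i)"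
    proof (rule differentiable_bound[where S = "U \<theta> i" and f' = "\<lambda>x v. nderiv (U \<theta> i) (F i) [v] x"])
      show "onorm (\<lambda>v. nderiv (U \<theta> i) (F i) [v] y) \<le> \<bar>K\<bar>" if "y \<in> U \<theta> i" for y
        by (rule onorm_le) (rule Kb[OF that])
      show "(F i has_derivative (\<lambda>v. nderiv (U \<theta> i) (F i) [v] y)) (at y within U \<theta> i)" if "y \<in> U \<theta> i" for y
        by (rule has_derivative_at_withinI[OF dU[OF that]])
      show "convex (U \<theta> i)" by (simp add: U_def)
    qed (use x XB[OF i \<theta>] in auto)
    also have "\<dots> \<le> \<bar>K\<bar> * \<theta>"
      using x i by (intro mult_left_mono) (auto simp: U_def dist_norm norm_minus_commute)
    finally show "norm (G i x) \<le> \<bar>K\<bar> * \<theta>" by (simp add: G_def)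
  qed auto
  have linQ: "linear (Q i)" if "i \<in> V" for i using V(5)[OF that] by (simp add: orthogonal_transformation)
  have normQ: "norm (Q i v) = norm v" if "i \<in> V" for i v using V(5)[OF that] by (simp add: orthogonal_transformation_norm)
  \<comment> \<open>Orthonormal coordinates in which the Hessian at \<open>X i\<close> is diagonal.
    For inadmissible indices the linear part is set to 0, so that it is bounded linear for every
    index.\<close>
  define A where "A i y = X i + (if i \<in> V then Q i y else 0)" for i y
  have Xb: "norm (X i) \<le> b" if "i \<in> V" for i
    using XB[OF that \<theta>] UB[of \<theta> i] b by auto
  have A: "unif_C n (fam_ball V r) A" for n r
  proof -
    have "unif_C n (fam_ball V r) (\<lambda>i y. X i + (if i \<in> V then Q i y else 0))"
    proof (rule unif_C_affine[where T = "\<lambda>i y. if i \<in> V then Q i y else 0" and C = 1 and D = "b + r"])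
      show "bounded_linear (\<lambda>y. if i \<in> V then Q i y else 0)" for i
        using linQ[of i] by (cases "i \<in> V") (auto simp: linear_conv_bounded_linear)
      show "norm (X i + (if i \<in> V then Q i x else 0)) \<le> b + r" if "x \<in> fam_ball V r i" for i x
        using that Xb[of i] normQ[of i x] norm_triangle_ineq[of "X i" "Q i x"] by auto
    qed (use normQ in auto)
    then show ?thesis by (simp add: A_def[abs_def])
  qed
  have Amem: "A i y \<in> U r i" if "y \<in> fam_ball V r i" for i y r
    using that normQ by (auto simp: A_def U_def dist_norm)
  have dA: "(A i has_derivative Q i) (at y)" if "i \<in> V" for i y
    using linear_imp_has_derivative[OF linQ[OF that]] that unfolding A_def
    by (auto intro!: derivative_eq_intros)
  define g where "g i y = G i (A i y)" for i y
  have g: "unif_C ?k (fam_ball V \<theta>) g" unfolding g_def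
    by (rule unif_C_compose[OF G A Amem])
  have A0: "A i 0 = X i" if "i \<in> V" for i using linear_0[OF linQ[OF that]] that by (simp add: A_def)
  have dg: "(g i has_derivative (\<lambda>v. nderiv (U \<theta> i) (F i) [Q i v] (A i y))) (at y)" if "i \<in> V" "norm y < \<theta>" for i y
    using diff_chain_at[OF dA[OF that(1)] dG[OF Amem[of y \<theta> i]]] that by (simp add: o_def g_def[abs_def])
  have ms: "morse_state ?k V \<theta> \<mu> {} g"
    unfolding morse_state_def
  proof (intro conjI ballI allI impI \<theta> g)
    fix i assume i: "i \<in> V"
    show "g i x = g i (zero_on {} x)" for x by (simp add: zero_on_def)
    have nX: "nderiv (U \<theta> i) (F i) vs (X i) = nderiv B (F i) vs (X i)" if "length vs \<le> 2" for vs
      by (rule nU) (use that XB[OF i \<theta>] in auto)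
    show "fderiv g i 0 v = 0" for v
      using fun_cong[OF frechet_derivative_at[OF dg[OF i, of 0]], of v] \<theta> nX[of "[Q i v]"] V(4)[OF i] A0[OF i]
      by (simp del: nderiv.simps)
    fix v w
    have "(nderiv (U \<theta> i) (F i) [Q i v] has_derivative (\<lambda>w. nderiv (U \<theta> i) (F i) [w, Q i v] (A i 0))) (at (A i 0))"
      using Ck_on_has_derivative[OF CkU _ XB[OF i \<theta>], of "[Q i v]"]
      by (simp add: A0[OF i] at_within_open[OF XB[OF i \<theta>] opU] del: nderiv.simps)
    from diff_chain_at[OF dA[OF i] this]
    have "((\<lambda>y. nderiv (U \<theta> i) (F i) [Q i v] (A i y)) has_derivative (\<lambda>w. nderiv (U \<theta> i) (F i) [Q i w, Q i v] (A i 0))) (at 0)"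
      by (simp only: o_def)
    then have "((\<lambda>y. fderiv g i y v) has_derivative (\<lambda>w. nderiv (U \<theta> i) (F i) [Q i w, Q i v] (A i 0))) (at 0)"
    proof (rule has_derivative_transform_within_open[where s = "ball 0 \<theta>"])
      show "nderiv (U \<theta> i) (F i) [Q i v] (A i x) = fderiv g i x v" if "x \<in> ball 0 \<theta>" for x
        using fun_cong[OF frechet_derivative_at[OF dg[OF i, of x]], of v] that by (simp del: nderiv.simps)
    qed (use \<theta> in auto)
    from fun_cong[OF frechet_derivative_at[OF this], of w]
    show "fderiv (\<lambda>i x. fderiv g i x v) i 0 w = (\<Sum>a\<in>- {}. \<mu> i a * v $ a * w $ a)"
      using nX[of "[Q i w, Q i v]"] V(6)[OF i, of w v] A0[OF i] by (simp del: nderiv.simps)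
  qed
  obtain r \<Phi> where r: "0 < r" "r \<le> \<theta>" and
    \<Phi>: "\<And>a. unif_C (Suc (Suc m)) (fam_ball V r) (\<Phi> a)" and
    eq: "\<And>i x. i \<in> V \<Longrightarrow> norm x < r \<Longrightarrow> g i x = g i 0 + (\<Sum>a\<in>UNIV. sgn (\<mu> i a) * (\<Phi> a i x)\<^sup>2)"
    and \<Phi>0: "\<And>i a. i \<in> V \<Longrightarrow> \<Phi> a i 0 = 0"
    and d\<Phi>0: "\<And>i a v. i \<in> V \<Longrightarrow> fderiv (\<Phi> a) i 0 v = sqrt (\<bar>\<mu> i a\<bar> / 2) * v $ a"
    by (rule morse_family[OF ms \<theta> V(7)], assumption) (rule that; assumption)
  define P where "P i x = (\<chi> a. \<Phi> a i x)" for i x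
  have P: "unif_C (Suc (Suc m)) (fam_ball V r) P"
    by (rule unif_C_vec) (simp add: P_def \<Phi>)
  have P0: "P i 0 = 0" if "i \<in> V" for i using \<Phi>0[OF that] by (simp add: P_def vec_eq_iff)
  \<comment> \<open>The derivative of \<open>P\<close> at 0 is diagonal with entries
    \<open>sqrt (\<bar>\<mu> i a\<bar> / 2)\<close>; this lower bound feeds the inverse function
    theorem.\<close>
  have dP0: "sqrt (\<theta> / 2) * norm v \<le> norm (fderiv P i 0 v)" if i: "i \<in> V" for i v
  proof -
    have "(P i has_derivative fderiv P i 0) (at 0)" by (rule unif_C_has_derivative[OF P]) (use i r in auto)
    then have "((\<lambda>x. P i x $ a) has_derivative (\<lambda>v. fderiv P i 0 v $ a)) (at 0)" for a
      by (rule bounded_linear.has_derivative[OF bounded_linear_vec_nth])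
    then have "(\<Phi> a i has_derivative (\<lambda>v. fderiv P i 0 v $ a)) (at 0)" for a by (simp add: P_def)
    from fun_cong[OF frechet_derivative_at[OF this]]
    have c: "fderiv P i 0 v $ a = sqrt (\<bar>\<mu> i a\<bar> / 2) * v $ a" for a using d\<Phi>0[OF i] by simp
    have "norm (sqrt (\<theta> / 2) *\<^sub>R v) \<le> norm (fderiv P i 0 v)"
    proof (rule norm_le_componentwise_cart)
      show "norm ((sqrt (\<theta> / 2) *\<^sub>R v) $ a) \<le> norm (fderiv P i 0 v $ a)" for a
        using V(7)[OF i, of a] \<theta> by (auto simp: c abs_mult intro!: mult_right_mono)
    qed
    then show ?thesis using \<theta> by simp
  qed
  have c0: "0 < sqrt (\<theta> / 2)" using \<theta> by simp
  obtain \<delta> \<sigma> where \<delta>: "0 < \<delta>" "\<delta> \<le> r" and inj: "\<And>i. i \<in> V \<Longrightarrow> inj_on (P i) (ball 0 \<delta>)"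
    and op: "\<And>i. i \<in> V \<Longrightarrow> open (P i ` ball 0 \<delta>)"
    and inv: "unif_C (Suc (Suc m)) (\<lambda>i. if i \<in> V then P i ` ball 0 \<delta> else {}) (\<lambda>i. inv_into (ball 0 \<delta>) (P i))"
    by (rule unif_inverse_function[OF P r(1) c0 P0 dP0], assumption, assumption) (rule that; assumption)
  define R where "R i = inv (Q i)" for i
  have QR: "Q i (R i v) = v" "R i (Q i v) = v" if "i \<in> V" for i v
  proof -
    have "bij (Q i)" using V(5)[OF that] by (rule orthogonal_transformation_bij)
    then show "Q i (R i v) = v" "R i (Q i v) = v"
      unfolding R_def using bij_is_inj bij_is_surj surj_f_inv_f inv_f_f by metis+
  qed
  have linR: "linear (R i)" if "i \<in> V" for i
    unfolding R_def using orthogonal_transformation_inv[OF V(5)[OF that]] by (simp add: orthogonal_transformation)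
  have normR: "norm (R i v) = norm v" if "i \<in> V" for i v using normQ[OF that, of "R i v"] QR[OF that] by simp
  define A' where "A' i x = (if i \<in> V then R i (x - X i) else 0)" for i x
  have A': "unif_C n (U \<delta>) A'" for n
  proof -
    have "unif_C n (U \<delta>) (\<lambda>i x. (if i \<in> V then - R i (X i) else 0) + (if i \<in> V then R i x else 0))"
    proof (rule unif_C_affine[where T = "\<lambda>i x. if i \<in> V then R i x else 0" and C = 1 and D = \<delta>])
      show "bounded_linear (\<lambda>y. if i \<in> V then R i y else 0)" for i
        using linR[of i] by (cases "i \<in> V") (auto simp: linear_conv_bounded_linear)
      show "norm ((if i \<in> V then - R i (X i) else 0) + (if i \<in> V then R i x else 0)) \<le> \<delta>" if "x \<in> U \<delta> i" for i x
        using that normR[of i "x - X i"] linear_diff[OF linR, of i x "X i"]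
        by (auto simp: U_def dist_norm norm_minus_commute split: if_splits)
    qed (use normR opU in \<open>auto simp: U_def\<close>)
    then show ?thesis
      by (rule unif_C_cong) (auto simp: A'_def U_def linear_diff[OF linR] split: if_splits)
  qed
  have A'mem: "A' i x \<in> fam_ball V \<delta> i" if "x \<in> U \<delta> i" for i x
    using that normR by (auto simp: A'_def U_def dist_norm norm_minus_commute split: if_splits)
  define \<phi> where "\<phi> i x = P i (A' i x)" for i x
  have \<phi>: "unif_C (Suc (Suc m)) (U \<delta>) \<phi>"
    unfolding \<phi>_def
    by (rule unif_C_compose[OF unif_C_subset[OF P open_fam_ball fam_ball_mono[OF \<delta>(2)]] A' A'mem])
  obtain M where M: "M > 0" "\<And>i. Ck_norm (Suc (Suc m)) (U \<delta> i) (\<phi> i) \<le> ereal M"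
    using unif_C_Ck_norm[OF \<phi>] by auto
  have bij: "A i (A' i x) = x" "A' i (A i y) = y" if "i \<in> V" for i x y
    using QR[OF that] that by (auto simp: A_def A'_def)
  have im: "\<phi> i ` U \<delta> i = (if i \<in> V then P i ` ball 0 \<delta> else {})" for i
  proof (cases "i \<in> V")
    case True
    have "A' i ` U \<delta> i = ball 0 \<delta>"
    proof (intro equalityI subsetI)
      fix y :: "real ^ 'n" assume "y \<in> ball 0 \<delta>"
      then have "A i y \<in> U \<delta> i" using True by (intro Amem) simp
      then show "y \<in> A' i ` U \<delta> i" using bij(2)[OF True] by (metis image_eqI)
    next
      fix y assume "y \<in> A' i ` U \<delta> i"
      then obtain x where x: "x \<in> U \<delta> i" "y = A' i x" by blast
      then show "y \<in> ball 0 \<delta>" using A'mem[OF x(1)] by simp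
    qed
    then show ?thesis using True by (simp add: \<phi>_def image_image[symmetric])
  qed (simp add: U_def)
  have inj\<phi>: "inj_on (\<phi> i) (U \<delta> i)" if i: "i \<in> V" for i
  proof (rule inj_onI)
    fix x y assume xy: "x \<in> U \<delta> i" "y \<in> U \<delta> i" "\<phi> i x = \<phi> i y"
    then have "A' i x = A' i y"
      using inj_onD[OF inj[OF i], of "A' i x" "A' i y"] A'mem[OF xy(1)] A'mem[OF xy(2)] by (simp add: \<phi>_def)
    then show "x = y" using bij(1)[OF i] by metis
  qed
  let ?W = "\<lambda>i. if i \<in> V then P i ` ball 0 \<delta> else {}"
  have opW: "open (?W i)" for i using op by simp
  have Wmem: "inv_into (ball 0 \<delta>) (P i) y \<in> fam_ball V \<delta> i" if "y \<in> ?W i" for i y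
    using that inv_into_into[of y "P i" "ball 0 \<delta>"] by (auto split: if_splits)
  have "unif_C (Suc (Suc m)) ?W (\<lambda>i y. A i (inv_into (ball 0 \<delta>) (P i) y))"
    by (rule unif_C_compose[OF A inv Wmem])
  then have inv\<phi>: "unif_C (Suc (Suc m)) ?W (\<lambda>i. inv_into (U \<delta> i) (\<phi> i))"
  proof (rule unif_C_cong)
    fix i y assume y: "y \<in> ?W i"
    then have i: "i \<in> V" by (auto split: if_splits)
    let ?z = "inv_into (ball 0 \<delta>) (P i) y"
    have "\<phi> i (A i ?z) = y" using bij(2)[OF i] f_inv_into_f[of y "P i" "ball 0 \<delta>"] y i by (simp add: \<phi>_def)
    moreover have "A i ?z \<in> U \<delta> i" by (rule Amem[OF Wmem[OF y]])
    ultimately show "A i ?z = inv_into (U \<delta> i) (\<phi> i) y" using inv_into_f_f[OF inj\<phi>[OF i]] by metis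
  qed
  show ?thesis
  proof (rule exI[of _ \<delta>], rule exI[of _ M], intro conjI allI impI)
    fix f x0 and Q0 :: "real ^ 'n \<Rightarrow> real ^ 'n" and \<mu>0
    assume *: "Ck_on ?k B f \<and> Ck_norm ?k B f \<le> ereal K \<and> ball x0 \<theta> \<subseteq> B \<and> (\<forall>v. nderiv B f [v] x0 = 0) \<and>
      orthogonal_transformation Q0 \<and> (\<forall>v w. nderiv B f [Q0 w, Q0 v] x0 = (\<Sum>a\<in>UNIV. \<mu>0 a * v $ a * w $ a)) \<and> (\<forall>a. \<theta> \<le> \<bar>\<mu>0 a\<bar>)"
    \<comment> \<open>Every admissible tuple is an index, so the constants of the family apply to
      it.\<close>
    define i where "i = (f, x0, Q0, \<mu>0)"
    have i: "i \<in> V" unfolding V_def i_def using * by blast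
    have sel: "F i = f" "X i = x0" "\<mu> i = \<mu>0" by (auto simp: i_def F_def X_def \<mu>_def)
    have Ui: "U \<delta> i = ball x0 \<delta>" using i sel by (simp add: U_def)
    show "\<exists>\<phi>. Ck_diffeo_onto_image (Suc (Suc m)) (ball x0 \<delta>) \<phi> \<and> Ck_norm (Suc (Suc m)) (ball x0 \<delta>) \<phi> \<le> ereal M \<and>
        (\<forall>x\<in>ball x0 \<delta>. f x = f x0 + (\<Sum>a\<in>UNIV. sgn (\<mu>0 a) * (\<phi> x $ a)\<^sup>2))"
    proof (intro exI[of _ "\<phi> i"] conjI ballI)
      show "Ck_norm (Suc (Suc m)) (ball x0 \<delta>) (\<phi> i) \<le> ereal M" using M(2)[of i] Ui by simp
      show "Ck_diffeo_onto_image (Suc (Suc m)) (ball x0 \<delta>) (\<phi> i)"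
        unfolding Ck_diffeo_onto_image_def Ui[symmetric]
        using unif_C_imp_Ck_on[OF \<phi>, of i] inj\<phi>[OF i] opW[of i] unif_C_imp_Ck_on[OF inv\<phi>, of i] im[of i] i by simp
      fix x assume x: "x \<in> ball x0 \<delta>"
      then have n: "norm (A' i x) < r" using A'mem[of x i] Ui \<delta>(2) by auto
      have "f x - f x0 = g i (A' i x)" using bij(1)[OF i] sel by (simp add: g_def G_def)
      moreover have "g i 0 = 0" using A0[OF i] by (simp add: g_def G_def)
      ultimately have "f x - f x0 = (\<Sum>a\<in>UNIV. sgn (\<mu> i a) * (\<Phi> a i (A' i x))\<^sup>2)" using eq[OF i n] by simp
      then show "f x = f x0 + (\<Sum>a\<in>UNIV. sgn (\<mu>0 a) * (\<phi> i x $ a)\<^sup>2)" by (simp add: \<phi>_def P_def sel)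
    qed
  qed (use \<delta> r M in auto)
qed

text \<open>Frees the statement from a chosen eigenbasis: the spectral theorem supplies
  \<open>Q\<close> and \<open>\<mu>\<close>, the Hessian being symmetric because \<open>x0\<close>
  is an interior point.\<close>

lemma uniform_morse:
  fixes B :: "(real ^ 'n) set" and e :: "nat \<Rightarrow> 'n"
  assumes B: "full_tangent B" "bounded B" and \<theta>: "\<theta> > 0" and e: "bij_betw e {1..CARD('n)} UNIV"
  shows "\<exists>\<delta> M. 0 < \<delta> \<and> \<delta> \<le> \<theta> \<and> 0 < M \<and>
    (\<forall>f x0. Ck_on (Suc (Suc (Suc m))) B f \<and> Ck_norm (Suc (Suc (Suc m))) B f \<le> ereal K \<and>
      ball x0 \<theta> \<subseteq> B \<and> (\<forall>v. nderiv B f [v] x0 = 0) \<and>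
      (\<forall>v. \<theta> * norm v \<le> norm (Hessian B f x0 *v v)) \<longrightarrow>
      (\<exists>\<phi> l c. l \<le> CARD('n) \<and> Ck_diffeo_onto_image (Suc (Suc m)) (ball x0 \<delta>) \<phi> \<and>
        Ck_norm (Suc (Suc m)) (ball x0 \<delta>) \<phi> \<le> ereal M \<and>
        (\<forall>y\<in>\<phi> ` ball x0 \<delta>. (f \<circ> inv_into (ball x0 \<delta>) \<phi>) y = morse_form e l y + c)))"
proof -
  let ?k = "Suc (Suc (Suc m))"
  from uniform_morse_coordinates[OF B \<theta>, of m K] obtain \<delta> M where \<delta>: "\<delta> > 0" "\<delta> \<le> \<theta>" and M: "M > 0" and main:
    "(\<forall>f x0 (Q :: real ^ 'n \<Rightarrow> real ^ 'n) \<mu>. Ck_on (?k) B f \<and> Ck_norm (?k) B f \<le> ereal K \<and>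
      ball x0 \<theta> \<subseteq> B \<and> (\<forall>v. nderiv B f [v] x0 = 0) \<and> orthogonal_transformation Q \<and>
      (\<forall>v w. nderiv B f [Q w, Q v] x0 = (\<Sum>a\<in>UNIV. \<mu> a * v $ a * w $ a)) \<and> (\<forall>a. \<theta> \<le> \<bar>\<mu> a\<bar>) \<longrightarrow>
      (\<exists>\<phi>. Ck_diffeo_onto_image (Suc (Suc m)) (ball x0 \<delta>) \<phi> \<and> Ck_norm (Suc (Suc m)) (ball x0 \<delta>) \<phi> \<le> ereal M \<and>
        (\<forall>x\<in>ball x0 \<delta>. f x = f x0 + (\<Sum>a\<in>UNIV. sgn (\<mu> a) * (\<phi> x $ a)\<^sup>2))))"
    by (elim exE conjE)
  show ?thesis
  proof (rule exI[of _ \<delta>], rule exI[of _ M], intro conjI allI impI \<delta> M; elim conjE)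
    fix f x0
    assume f: "Ck_on ?k B f" "Ck_norm ?k B f \<le> ereal K" and x0: "ball x0 \<theta> \<subseteq> B"
      and crit: "\<forall>v. nderiv B f [v] x0 = 0" and nd': "\<forall>v. \<theta> * norm v \<le> norm (Hessian B f x0 *v v)"
    then have nd: "\<theta> * norm v \<le> norm (Hessian B f x0 *v v)" for v by blast
    have x0B: "x0 \<in> B" using x0 \<theta> by auto
    let ?T = "\<lambda>v. Hessian B f x0 *v v"
    have H: "nderiv B f [w, v] x0 = w \<bullet> ?T v" for v w
      by (rule nderiv_Hessian[OF B(1) f(1) _ x0B]) simp
    have sym: "?T x \<bullet> y = x \<bullet> ?T y" for x y
      using nderiv_commute_interior[OF f(1) _ open_ball x0, of x0 x y] \<theta> H by (simp add: inner_commute del: nderiv.simps)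
    obtain Q \<mu> l where Q: "orthogonal_transformation Q" and l: "l \<le> CARD('n)"
      and QT: "\<And>v w. Q w \<bullet> ?T (Q v) = (\<Sum>a\<in>UNIV. \<mu> a * v $ a * w $ a)" and \<mu>: "\<And>a. \<theta> \<le> \<bar>\<mu> a\<bar>"
      and pos: "\<And>m. m \<in> {1..l} \<Longrightarrow> \<mu> (e m) > 0" and neg: "\<And>m. m \<in> {l+1..CARD('n)} \<Longrightarrow> \<mu> (e m) < 0"
      by (rule orthogonal_diagonalization[OF matrix_vector_mul_linear sym e \<theta> nd]) (rule that; assumption)
    have "nderiv B f [Q w, Q v] x0 = (\<Sum>a\<in>UNIV. \<mu> a * v $ a * w $ a)" for v w
      unfolding H by (rule QT)
    with main[rule_format, of f x0 Q \<mu>] f x0 crit Q \<mu> obtain \<phi> where \<phi>: "Ck_diffeo_onto_image (Suc (Suc m)) (ball x0 \<delta>) \<phi>"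
      "Ck_norm (Suc (Suc m)) (ball x0 \<delta>) \<phi> \<le> ereal M"
      "\<And>x. x \<in> ball x0 \<delta> \<Longrightarrow> f x = f x0 + (\<Sum>a\<in>UNIV. sgn (\<mu> a) * (\<phi> x $ a)\<^sup>2)" by blast
    have "(f \<circ> inv_into (ball x0 \<delta>) \<phi>) y = morse_form e l y + f x0" if y: "y \<in> \<phi> ` ball x0 \<delta>" for y
      using \<phi>(3)[OF inv_into_into[OF y]] f_inv_into_f[OF y] morse_form_sum[where \<mu> = \<mu>, OF e l pos neg]
      by simp
    then show "\<exists>\<phi> l c. l \<le> CARD('n) \<and> Ck_diffeo_onto_image (Suc (Suc m)) (ball x0 \<delta>) \<phi> \<and>
        Ck_norm (Suc (Suc m)) (ball x0 \<delta>) \<phi> \<le> ereal M \<and>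
        (\<forall>y\<in>\<phi> ` ball x0 \<delta>. (f \<circ> inv_into (ball x0 \<delta>) \<phi>) y = morse_form e l y + c)"
      using l \<phi>(1,2) by blast
  qed
qed

section \<open>Quantitative Sard theorem by counting\<close>

text \<open>A set of grid points in a box which is thin in the direction \<open>i\<close>.\<close>

lemma card_le_by_fibers:
  fixes S :: "('n::finite \<Rightarrow> int) set"
  assumes box: "\<And>q j. q \<in> S \<Longrightarrow> \<bar>q j - q0 j\<bar> \<le> int R"
    and fib: "\<And>q q'. q \<in> S \<Longrightarrow> q' \<in> S \<Longrightarrow> (\<And>j. j \<noteq> i \<Longrightarrow> q j = q' j) \<Longrightarrow> \<bar>q i - q' i\<bar> \<le> int T"
  shows "card S \<le> (2 * R + 1) ^ (CARD('n) - 1) * (T + 1)"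
proof -
  define I where "I j = {q0 j - int R..q0 j + int R}" for j
  have inI: "q j \<in> I j" if "q \<in> S" for q j using box[OF that, of j] by (auto simp: I_def)
  define \<phi> where "\<phi> q = restrict q (-{i})" for q :: "'n \<Rightarrow> int"
  define F where "F q = (\<lambda>q'. q' i) ` {q' \<in> S. \<phi> q' = \<phi> q}" for q
  have finF: "finite (F q)" for q
    by (rule finite_subset[of _ "I i"]) (use inI in \<open>auto simp: F_def I_def\<close>)
  have mem: "q i \<in> F q" if "q \<in> S" for q using that by (auto simp: F_def)
  \<comment> \<open>A point is determined by its coordinates off \<open>i\<close> and its height
    above the lowest point of its fibre, and this height lies between 0 and
    \<open>T\<close>.\<close>
  define g where "g q = (\<phi> q, q i - Min (F q))" for q
  have off: "q j = q' j" if "\<phi> q = \<phi> q'" "j \<noteq> i" for q q' j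
    using fun_cong[OF that(1), of j] that(2) by (simp add: \<phi>_def)
  have "inj_on g S"
  proof (rule inj_onI)
    fix q q' assume q: "q \<in> S" "q' \<in> S" "g q = g q'"
    then have \<phi>: "\<phi> q = \<phi> q'" by (simp add: g_def)
    then have "F q = F q'" by (simp add: F_def)
    then have "q i = q' i" using q(3) by (simp add: g_def)
    then show "q = q'" using off[OF \<phi>] by (metis ext)
  qed
  moreover have "g ` S \<subseteq> PiE (-{i}) I \<times> {0..int T}"
  proof
    fix z assume "z \<in> g ` S"
    then obtain q where q: "q \<in> S" "z = g q" by auto
    have "Min (F q) \<in> F q" using finF mem[OF q(1)] by (intro Min_in) auto
    then obtain q' where q': "q' \<in> S" "\<phi> q' = \<phi> q" "Min (F q) = q' i" by (auto simp: F_def)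
    have "\<bar>q i - q' i\<bar> \<le> int T" by (rule fib[OF q(1) q'(1)]) (use off[OF q'(2)] in auto)
    moreover have "Min (F q) \<le> q i" by (rule Min_le[OF finF mem[OF q(1)]])
    moreover have "\<phi> q \<in> PiE (-{i}) I" using inI[OF q(1)] by (auto simp: \<phi>_def)
    ultimately show "z \<in> PiE (-{i}) I \<times> {0..int T}" using q' q(2) by (simp add: g_def)
  qed
  moreover have fin: "finite (PiE (-{i}) I \<times> {0..int T})"
    by (intro finite_cartesian_product finite_PiE) (auto simp: I_def)
  ultimately have "card S \<le> card (PiE (-{i}) I \<times> {0..int T})" by (rule card_inj_on_le)
  also have "\<dots> = (2 * R + 1) ^ (CARD('n) - 1) * (T + 1)"
  proof -
    have "card (I j) = 2 * R + 1" for j by (simp add: I_def)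
    then have "card (PiE (-{i}) I) = (2 * R + 1) ^ card (-{i})" by (simp add: card_PiE)
    moreover have "card (-{i}) = CARD('n) - 1" by (simp add: Compl_eq_Diff_UNIV card_Diff_singleton)
    ultimately show ?thesis by (simp add: card_cartesian_product nat_add_distrib)
  qed
  finally show ?thesis .
qed

lemma card_box_le:
  fixes S :: "('n::finite \<Rightarrow> int) set"
  assumes box: "\<And>q j. q \<in> S \<Longrightarrow> \<bar>q j - q0 j\<bar> \<le> int R"
  shows "finite S" "card S \<le> (2 * R + 1) ^ CARD('n)"
proof -
  have sub: "S \<subseteq> PiE UNIV (\<lambda>j. {q0 j - int R..q0 j + int R})"
  proof
    fix q assume "q \<in> S"
    then have "q j \<in> {q0 j - int R..q0 j + int R}" for j using box[of q j] by auto
    then show "q \<in> PiE UNIV (\<lambda>j. {q0 j - int R..q0 j + int R})" by auto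
  qed
  have fin: "finite (PiE UNIV (\<lambda>j. {q0 j - int R..q0 j + int R}))" by (intro finite_PiE) auto
  show "finite S" by (rule finite_subset[OF sub fin])
  have "card {q0 j - int R..q0 j + int R} = 2 * R + 1" for j by simp
  then have "card (PiE UNIV (\<lambda>j. {q0 j - int R..q0 j + int R})) = (2 * R + 1) ^ CARD('n)"
    by (simp only: card_PiE finite prod_constant)
  then show "card S \<le> (2 * R + 1) ^ CARD('n)" using card_mono[OF fin sub] by simp
qed

lemma norm_le_card_mult:
  fixes x :: "real ^ 'n"
  assumes "\<And>i. \<bar>x $ i\<bar> \<le> c"
  shows "norm x \<le> real CARD('n) * c"
proof -
  have "norm x \<le> (\<Sum>i\<in>UNIV. \<bar>x $ i\<bar>)" by (rule norm_le_l1_cart)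
  also have "\<dots> \<le> (\<Sum>i\<in>(UNIV :: 'n set). c)" by (intro sum_mono assms)
  finally show ?thesis by simp
qed

lemma exists_large_component:
  fixes x :: "real ^ 'n"
  obtains i where "norm x \<le> real CARD('n) * \<bar>x $ i\<bar>"
proof -
  let ?A = "range (\<lambda>i. \<bar>x $ i\<bar>)"
  have "Max ?A \<in> ?A" by (intro Max_in) auto
  then obtain i where i: "Max ?A = \<bar>x $ i\<bar>" by (rule imageE)
  have "\<bar>x $ j\<bar> \<le> \<bar>x $ i\<bar>" for j unfolding i[symmetric] by (rule Max_ge) auto
  from norm_le_card_mult[OF this] show ?thesis by (rule that)
qed

lemma abs_floor_le:
  assumes "\<bar>r\<bar> \<le> real m"
  shows "\<bar>\<lfloor>r\<rfloor>\<bar> \<le> int m"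
proof -
  have "\<lfloor>r\<rfloor> \<le> int m" "- int m \<le> \<lfloor>r\<rfloor>" using assms by linarith+
  then show ?thesis by simp
qed

text \<open>For fixed other coordinates, \<open>p\<^sub>i\<^sup>2\<close> is confined to an interval of length \<open>O(m)\<close>; this leaves boundedly
  many values if \<open>i\<close> is a coordinate of size at least a multiple of \<open>m\<close>.\<close>

lemma card_boundary_cells:
  fixes m :: nat
  assumes m: "m \<ge> 4 * CARD('n)"
  shows "card {p :: 'n::finite \<Rightarrow> int. \<exists>x :: real ^ 'n. norm x \<le> 1 \<and> norm x > 1 - 1 / (real m)\<^sup>2 \<and> p = (\<lambda>i. \<lfloor>real m * x $ i\<rfloor>)}
    \<le> 2 * CARD('n) * ((2 * m + 1) ^ (CARD('n) - 1) * (12 * CARD('n)\<^sup>2 + 1))" (is "card ?Sh \<le> _")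
proof -
  let ?n = "CARD('n)"
  let ?N = "real ?n" and ?M = "real m"
  have N: "?N \<ge> 1" by (simp add: Suc_le_eq)
  have M: "?M \<ge> 4 * ?N" using m by (metis of_nat_le_iff of_nat_mult of_nat_numeral)
  then have M4: "?M \<ge> 4" using N by linarith
  define u where "u p = (\<Sum>j\<in>UNIV. (real_of_int (p j))\<^sup>2)" for p :: "'n \<Rightarrow> int"
  \<comment> \<open>\<open>s\<close> is the sign of a large coordinate. The bounds on
    \<open>u\<close> are what rounding the coordinates of z = m x leaves of the inequality that puts
    |z|^2 between m^2 - 2 and m^2.\<close>
  define A where "A i s = {p. (\<forall>j. \<bar>p j\<bar> \<le> int m) \<and> ?M / (4 * ?N) \<le> s * real_of_int (p i) \<and>
     ?M\<^sup>2 - 2 - 2 * ?M * ?N \<le> u p \<and> u p \<le> ?M\<^sup>2 + 2 * ?M * ?N}" for i and s :: real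
  have cardA: "card (A i s) \<le> (2 * m + 1) ^ (?n - 1) * (12 * ?n\<^sup>2 + 1)" if s: "s = 1 \<or> s = -1" for i s
  proof (rule card_le_by_fibers[where i = i and ?q0.0 = "\<lambda>_. 0"])
    fix p p' assume p: "p \<in> A i s" "p' \<in> A i s" and eq: "\<And>j. j \<noteq> i \<Longrightarrow> p j = p' j"
    let ?a = "real_of_int (p i)" and ?b = "real_of_int (p' i)"
    have "u p - u p' = (\<Sum>j\<in>UNIV. (real_of_int (p j))\<^sup>2 - (real_of_int (p' j))\<^sup>2)"
      by (simp add: u_def sum_subtractf)
    also have "\<dots> = (\<Sum>j\<in>{i}. (real_of_int (p j))\<^sup>2 - (real_of_int (p' j))\<^sup>2)"
      by (rule sum.mono_neutral_right) (use eq in auto)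
    finally have up: "u p - u p' = ?a\<^sup>2 - ?b\<^sup>2" by simp
    have MN: "1 \<le> ?M * ?N" using mult_mono[of 1 ?M 1 ?N] M4 N by simp
    have ub: "\<bar>?a\<^sup>2 - ?b\<^sup>2\<bar> \<le> 6 * (?M * ?N)"
    proof -
      have "?M\<^sup>2 - 2 - 2 * (?M * ?N) \<le> u p" "u p \<le> ?M\<^sup>2 + 2 * (?M * ?N)"
        "?M\<^sup>2 - 2 - 2 * (?M * ?N) \<le> u p'" "u p' \<le> ?M\<^sup>2 + 2 * (?M * ?N)"
        using p by (simp_all add: A_def mult.assoc)
      then show ?thesis using MN unfolding up[symmetric] by linarith
    qed
    \<comment> \<open>Since both values have the sign \<open>s\<close>, their sum is large, and so a
      bound on a^2 - b^2 is one on a - b.\<close>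
    have "s * ?a \<ge> ?M / (4 * ?N)" "s * ?b \<ge> ?M / (4 * ?N)" using p by (auto simp: A_def)
    then have sab: "s * (?a + ?b) \<ge> ?M / (2 * ?N)" by (simp add: distrib_left field_simps)
    moreover have "s * (?a + ?b) \<le> \<bar>?a + ?b\<bar>" using s by auto
    ultimately have lb: "\<bar>?a + ?b\<bar> \<ge> ?M / (2 * ?N)" by linarith
    have "?M / (2 * ?N) * \<bar>?a - ?b\<bar> \<le> \<bar>?a + ?b\<bar> * \<bar>?a - ?b\<bar>" by (rule mult_right_mono[OF lb]) simp
    also have "\<dots> = \<bar>?a\<^sup>2 - ?b\<^sup>2\<bar>" by (simp add: abs_mult[symmetric] power2_eq_square algebra_simps)
    finally have "?M * \<bar>?a - ?b\<bar> \<le> 2 * ?N * \<bar>?a\<^sup>2 - ?b\<^sup>2\<bar>" using N by (simp add: field_simps)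
    also have "\<dots> \<le> 2 * ?N * (6 * (?M * ?N))" using ub by (intro mult_left_mono) auto
    finally have "?M * \<bar>?a - ?b\<bar> \<le> 12 * (?M * ?N) * ?N" by (simp add: algebra_simps)
    then have "?M * \<bar>?a - ?b\<bar> \<le> ?M * (12 * ?N\<^sup>2)" by (simp add: power2_eq_square algebra_simps)
    then have "\<bar>?a - ?b\<bar> \<le> 12 * ?N\<^sup>2" using M4 by simp
    then have "real_of_int \<bar>p i - p' i\<bar> \<le> real_of_int (int (12 * ?n\<^sup>2))" by simp
    then show "\<bar>p i - p' i\<bar> \<le> int (12 * ?n\<^sup>2)" by (simp only: of_int_le_iff)
  qed (auto simp: A_def)
  have finA: "finite (A i s)" for i s
    by (rule card_box_le(1)[where ?q0.0 = "\<lambda>_. 0" and R = m]) (auto simp: A_def)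
  have sub: "?Sh \<subseteq> (\<Union>z\<in>UNIV \<times> {1, -1}. A (fst z) (snd z))"
  proof
    fix p assume "p \<in> ?Sh"
    then obtain x :: "real ^ 'n" where x: "norm x \<le> 1" "norm x > 1 - 1 / ?M\<^sup>2" and p: "p = (\<lambda>i. \<lfloor>?M * x $ i\<rfloor>)" by auto
    define z where "z = ?M *\<^sub>R x"
    have z_nth: "z $ j = ?M * x $ j" for j by (simp add: z_def)
    have fl: "real_of_int (p j) \<le> z $ j" "z $ j < real_of_int (p j) + 1" for j
      by (auto simp: p z_nth)
    have xj: "\<bar>x $ j\<bar> \<le> 1" for j using component_le_norm_cart[of x j] x(1) by linarith
    have zj: "\<bar>z $ j\<bar> \<le> ?M" for j
      unfolding z_nth abs_mult using mult_left_mono[OF xj[of j], of ?M] by simp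
    have pj: "\<bar>p j\<bar> \<le> int m" for j
      using abs_floor_le[OF zj[of j]] by (simp add: p z_nth)
    then have pj': "\<bar>real_of_int (p j)\<bar> \<le> ?M" for j
      by (metis of_int_abs of_int_le_iff of_int_of_nat_eq)
    have nz: "norm z = ?M * norm x" by (simp add: z_def)
    have nz2: "(norm z)\<^sup>2 = (\<Sum>j\<in>UNIV. (z $ j)\<^sup>2)"
      unfolding power2_norm_eq_inner inner_vec_def by (simp add: power2_eq_square)
    have "\<bar>(z $ j)\<^sup>2 - (real_of_int (p j))\<^sup>2\<bar> \<le> 2 * ?M" for j
    proof -
      have "\<bar>(z $ j)\<^sup>2 - (real_of_int (p j))\<^sup>2\<bar> = \<bar>z $ j - real_of_int (p j)\<bar> * \<bar>z $ j + real_of_int (p j)\<bar>"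
        by (simp add: abs_mult[symmetric] power2_eq_square algebra_simps)
      also have "\<dots> \<le> 1 * (2 * ?M)" using fl[of j] zj[of j] pj'[of j] by (intro mult_mono) auto
      finally show ?thesis by simp
    qed
    then have "\<bar>\<Sum>j\<in>UNIV. (z $ j)\<^sup>2 - (real_of_int (p j))\<^sup>2\<bar> \<le> (\<Sum>j\<in>(UNIV::'n set). 2 * ?M)"
      by (intro order_trans[OF sum_abs] sum_mono)
    then have uz: "\<bar>(norm z)\<^sup>2 - u p\<bar> \<le> 2 * ?M * ?N"
      by (simp add: sum_subtractf nz2 u_def algebra_simps)
    have "norm z \<le> ?M" unfolding nz using mult_left_mono[OF x(1), of ?M] by simp
    then have up: "(norm z)\<^sup>2 \<le> ?M\<^sup>2" by (intro power_mono) auto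
    have lo: "(norm z)\<^sup>2 \<ge> ?M\<^sup>2 - 2"
    proof -
      have "?M - 1 / ?M \<le> norm z"
        unfolding nz using mult_left_mono[OF less_imp_le[OF x(2)], of ?M] M4 by (simp add: algebra_simps power2_eq_square)
      moreover have "1 / ?M \<le> 1" using M4 by simp
      then have "0 \<le> ?M - 1 / ?M" using M4 by linarith
      ultimately have "(?M - 1 / ?M)\<^sup>2 \<le> (norm z)\<^sup>2" by (intro power_mono)
      moreover have "(?M - 1 / ?M)\<^sup>2 = ?M\<^sup>2 - 2 + (1 / ?M)\<^sup>2" using M4 by (simp add: power2_diff)
      ultimately show ?thesis by (smt (verit) zero_le_power2)
    qed
    obtain i where i: "norm z \<le> ?N * \<bar>z $ i\<bar>" by (rule exists_large_component)
    have "?M / 2 \<le> norm z"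
    proof (rule power2_le_imp_le)
      have "?M * ?M \<ge> 4 * ?M" using M4 by (intro mult_right_mono) auto
      then have "?M * ?M / 4 \<le> ?M * ?M - 2" using M4 by linarith
      then have "(?M / 2)\<^sup>2 \<le> ?M\<^sup>2 - 2" by (simp add: power2_eq_square)
      then show "(?M / 2)\<^sup>2 \<le> (norm z)\<^sup>2" using lo by linarith
    qed simp
    then have "?M / (2 * ?N) \<le> \<bar>z $ i\<bar>" using i N by (simp add: field_simps)
    \<comment> \<open>Rounding costs at most 1, and by the assumption on \<open>m\<close> this is no
      more than half of the available \<open>?M / (2 * ?N)\<close>.\<close>
    moreover have "1 \<le> ?M / (4 * ?N)" using M N by (simp add: field_simps)
    moreover have "?M / (2 * ?N) = ?M / (4 * ?N) + ?M / (4 * ?N)" by simp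
    ultimately have zi: "?M / (4 * ?N) + 1 \<le> \<bar>z $ i\<bar>" by linarith
    have "\<exists>s\<in>{1, -1}. ?M / (4 * ?N) \<le> s * real_of_int (p i)"
      using zi fl[of i] by (cases "z $ i \<ge> 0") auto
    then obtain s where s: "s \<in> {1, -1}" "?M / (4 * ?N) \<le> s * real_of_int (p i)" by blast
    have "u p \<le> ?M\<^sup>2 + 2 * ?M * ?N" "?M\<^sup>2 - 2 - 2 * ?M * ?N \<le> u p" using uz up lo by linarith+
    then have "p \<in> A i s" using pj s(2) by (simp add: A_def)
    then show "p \<in> (\<Union>z\<in>UNIV \<times> {1, -1}. A (fst z) (snd z))" using s(1) by force
  qed
  have "card ?Sh \<le> card (\<Union>z\<in>UNIV \<times> {1, -1}. A (fst z) (snd z))"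
    by (rule card_mono[OF _ sub]) (use finA in auto)
  also have "\<dots> \<le> (\<Sum>z\<in>(UNIV :: 'n set) \<times> {1, -1 :: real}. card (A (fst z) (snd z)))"
    by (rule card_UN_le) auto
  also have "\<dots> \<le> (\<Sum>z\<in>(UNIV :: 'n set) \<times> {1, -1 :: real}. (2 * m + 1) ^ (?n - 1) * (12 * ?n\<^sup>2 + 1))"
    by (rule sum_mono) (use cardA in auto)
  also have "\<dots> = 2 * ?n * ((2 * m + 1) ^ (?n - 1) * (12 * ?n\<^sup>2 + 1))" by (simp add: card_cartesian_product)
  finally show ?thesis .
qed

text \<open>\<open>G\<close> stands for a gradient, \<open>D\<close> for its derivative and
  \<open>H\<close> for the Hessian. \<open>H x\<close> enters only as the adjoint of
  \<open>D x\<close>, because the symmetry of second derivatives is available in the interior only.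
  If |H w| is small, the adjoint relation makes the inner product of \<open>w\<close> with every
  value of \<open>D\<close> small, which is all that the slab estimate asks for.\<close>

lemma quantitative_sard:
  fixes L \<epsilon> :: real
  assumes L: "L \<ge> 0" and \<epsilon>: "\<epsilon> > 0"
  shows "\<exists>\<theta>>0. \<theta> \<le> 1 \<and> (\<forall>(G :: real ^ 'n \<Rightarrow> real ^ 'n) H D.
    (\<forall>x\<in>cball 0 1. \<forall>y\<in>cball 0 1. norm (G y - G x) \<le> L * norm (y - x)) \<and>
    (\<forall>x\<in>cball 0 1. \<forall>y\<in>cball 0 1. norm (G y - G x - D x (y - x)) \<le> L * (norm (y - x))\<^sup>2) \<and>
    (\<forall>x\<in>cball 0 1. \<forall>v w. w \<bullet> D x v = v \<bullet> (H x *v w)) \<longrightarrow>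
    (\<exists>a. norm a \<le> \<epsilon> \<and> (\<forall>x\<in>cball 0 1. norm (G x - a) \<le> \<theta> \<longrightarrow>
       (\<forall>v. \<theta> * norm v \<le> norm (H x *v v)) \<and> norm x \<le> 1 - \<theta>)))"
proof -
  let ?n = "CARD('n)"
  let ?N = "real ?n"
  have N: "?N \<ge> 1" by (simp add: Suc_le_eq)
  \<comment> \<open>Tilts whose witnesses share a cell differ by at most \<open>R0 * m\<close> grid
    steps in each coordinate: \<open>L * ?N * m\<close> from the variation of \<open>G\<close> on
    the cell, 2 from the tolerances.\<close>
  define R0 where "R0 = nat \<lceil>2 + L * ?N\<rceil>"
  \<comment> \<open>Half-thickness of the slab in units of \<open>\<theta>\<close>: 2 from the
    tolerances, \<open>?N\<close> from the linear part, \<open>L * ?N\<^sup>2\<close> from the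
    Taylor remainder.\<close>
  define C where "C = 2 + ?N + L * ?N\<^sup>2"
  define T1 where "T1 = nat \<lceil>2 * ?N * C\<rceil>"
  \<comment> \<open>\<open>C1\<close> and \<open>C2\<close> bound the bad tilts of the two kinds,
    nearly singular Hessian and closeness to the sphere, in units of m^(2n-1).\<close>
  define C1 where "C1 = 3 ^ ?n * ((2 * R0 + 1) ^ (?n - 1) * (T1 + 1))"
  define C2 where "C2 = 2 * ?n * (3 ^ (?n - 1) * (12 * ?n\<^sup>2 + 1)) * (2 * R0 + 1) ^ ?n"
  \<comment> \<open>A tilt whose coordinates are at most \<open>\<epsilon>'\<close> has norm at most
    \<open>\<epsilon>\<close>.\<close>
  define \<epsilon>' where "\<epsilon>' = \<epsilon> / ?N"
  have \<epsilon>': "\<epsilon>' > 0" using \<epsilon> N by (simp add: \<epsilon>'_def)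
  have R0: "2 + L * ?N \<le> real R0" unfolding R0_def by linarith
  have T1: "2 * ?N * C \<le> real T1" unfolding T1_def by linarith
  \<comment> \<open>Large enough for the grid, which has at least (eps' m^2)^n points, to outnumber
    the (C1 + C2) m^(2n-1) bad ones.\<close>
  obtain m where m: "m \<ge> 4 * ?n" and mC: "real (C1 + C2) < \<epsilon>' ^ ?n * real m"
  proof -
    define m where "m = max (4 * ?n) (nat \<lceil>real (C1 + C2) / \<epsilon>' ^ ?n\<rceil> + 1)"
    have "real (C1 + C2) / \<epsilon>' ^ ?n < real (nat \<lceil>real (C1 + C2) / \<epsilon>' ^ ?n\<rceil> + 1)" by linarith
    also have "\<dots> \<le> real m" unfolding m_def by (simp only: of_nat_le_iff max.cobounded2)
    finally have "real (C1 + C2) < \<epsilon>' ^ ?n * real m" using \<epsilon>' by (simp add: field_simps)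
    moreover have "m \<ge> 4 * ?n" unfolding m_def by (rule max.cobounded1)
    ultimately show ?thesis using that by blast
  qed
  let ?M = "real m"
  have M: "?M \<ge> 4 * ?N" using m by (metis of_nat_le_iff of_nat_mult of_nat_numeral)
  then have M4: "?M \<ge> 4" using N by linarith
  have m1: "m \<ge> 1" using M4 by linarith
  \<comment> \<open>One grid step: tolerance, shell thickness and squared cell size are then all
    fixed multiples of the mesh.\<close>
  define \<theta> where "\<theta> = 1 / ?M\<^sup>2"
  have \<theta>: "\<theta> > 0" "\<theta> \<le> 1" using M4 by (auto simp: \<theta>_def)
  have M\<theta>: "?M\<^sup>2 * \<theta> = 1" using M4 by (simp add: \<theta>_def)
  have main: "\<exists>a. norm a \<le> \<epsilon> \<and> (\<forall>x\<in>cball 0 1. norm (G x - a) \<le> \<theta> \<longrightarrow>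
       (\<forall>v. \<theta> * norm v \<le> norm (H x *v v)) \<and> norm x \<le> 1 - \<theta>)"
    if G1: "\<And>x y. x \<in> cball 0 1 \<Longrightarrow> y \<in> cball 0 1 \<Longrightarrow> norm (G y - G x) \<le> L * norm (y - x)"
      and G2: "\<And>x y. x \<in> cball 0 1 \<Longrightarrow> y \<in> cball 0 1 \<Longrightarrow> norm (G y - G x - D x (y - x)) \<le> L * (norm (y - x))\<^sup>2"
      and GH: "\<And>x v w. x \<in> cball 0 1 \<Longrightarrow> w \<bullet> D x v = v \<bullet> (H x *v w)"
    for G :: "real ^ 'n \<Rightarrow> real ^ 'n" and H D
  proof (rule ccontr)
    assume contra: "\<not> ?thesis"
    define T where "T = nat \<lfloor>\<epsilon>' * ?M\<^sup>2\<rfloor>"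
    define Q where "Q = PiE (UNIV :: 'n set) (\<lambda>_. {0..int T})"
    define a where "a q = (\<chi> i. real_of_int (q i) / ?M\<^sup>2)" for q :: "'n \<Rightarrow> int"
    have Tle: "real T \<le> \<epsilon>' * ?M\<^sup>2" unfolding T_def using \<epsilon>' by (simp add: of_nat_nat)
    have finQ: "finite Q" unfolding Q_def by (intro finite_PiE) auto
    have "card Q = (T + 1) ^ ?n" unfolding Q_def by (simp add: card_PiE nat_add_distrib)
    moreover have "\<epsilon>' * ?M\<^sup>2 \<le> real (T + 1)" unfolding T_def by linarith
    ultimately have cardQ: "(\<epsilon>' * ?M\<^sup>2) ^ ?n \<le> real (card Q)"
      using \<epsilon>' power_mono[of "\<epsilon>' * ?M\<^sup>2" "real (T + 1)" ?n] by simp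
    have na: "norm (a q) \<le> \<epsilon>" if "q \<in> Q" for q
    proof -
      have "\<bar>a q $ i\<bar> \<le> \<epsilon>'" for i
      proof -
        have "q i \<in> {0..int T}" using that by (auto simp: Q_def)
        then have "0 \<le> real_of_int (q i)" "real_of_int (q i) \<le> real T" by auto
        then show ?thesis using Tle M4 by (simp add: a_def field_simps)
      qed
      from norm_le_card_mult[OF this] show ?thesis using N by (simp add: \<epsilon>'_def)
    qed
    \<comment> \<open>If all grid tilts are bad, each has a witness point; the tilts are counted by
      the cells of their witnesses.\<close>
    have "\<forall>q\<in>Q. \<exists>x. norm x \<le> 1 \<and> norm (G x - a q) \<le> \<theta> \<and> ((\<exists>w. norm (H x *v w) < \<theta> * norm w) \<or> norm x > 1 - \<theta>)"
    proof
      fix q assume "q \<in> Q"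
      then have "\<not> (\<forall>x\<in>cball 0 1. norm (G x - a q) \<le> \<theta> \<longrightarrow> (\<forall>v. \<theta> * norm v \<le> norm (H x *v v)) \<and> norm x \<le> 1 - \<theta>)"
        using contra na by blast
      then show "\<exists>x. norm x \<le> 1 \<and> norm (G x - a q) \<le> \<theta> \<and> ((\<exists>w. norm (H x *v w) < \<theta> * norm w) \<or> norm x > 1 - \<theta>)"
        by (auto simp: not_le)
    qed
    then obtain X where X: "\<And>q. q \<in> Q \<Longrightarrow> norm (X q) \<le> 1" "\<And>q. q \<in> Q \<Longrightarrow> norm (G (X q) - a q) \<le> \<theta>"
      "\<And>q. q \<in> Q \<Longrightarrow> (\<exists>w. norm (H (X q) *v w) < \<theta> * norm w) \<or> norm (X q) > 1 - \<theta>"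
      by metis
    define cell where "cell q = (\<lambda>i. \<lfloor>?M * X q $ i\<rfloor>)" for q
    have Xd: "norm (X q - X q') \<le> ?N / ?M" if "q \<in> Q" "q' \<in> Q" "cell q = cell q'" for q q'
    proof -
      have "\<bar>(X q - X q') $ i\<bar> \<le> 1 / ?M" for i
      proof -
        have "\<lfloor>?M * X q $ i\<rfloor> = \<lfloor>?M * X q' $ i\<rfloor>" using fun_cong[OF that(3), of i] by (simp add: cell_def)
        then have "\<bar>?M * X q $ i - ?M * X q' $ i\<bar> \<le> 1" by linarith
        moreover have "?M * X q $ i - ?M * X q' $ i = ?M * (X q - X q') $ i" by (simp add: algebra_simps)
        ultimately have "?M * \<bar>(X q - X q') $ i\<bar> \<le> 1" using M4 by (simp add: abs_mult)
        then show ?thesis using M4 by (simp add: field_simps)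
      qed
      from norm_le_card_mult[OF this] show ?thesis by simp
    qed
    have qdiff: "real_of_int (q i) - real_of_int (q' i) = ?M\<^sup>2 * (a q - a q') $ i" for q q' i
      using M4 by (simp add: a_def field_simps)
    have box: "\<bar>q j - q' j\<bar> \<le> int (R0 * m)" if q: "q \<in> Q" "q' \<in> Q" "cell q = cell q'" for q q' j
    proof -
      have "norm (G (X q) - G (X q')) \<le> L * (?N / ?M)"
        using G1[of "X q'" "X q"] X(1)[OF q(1)] X(1)[OF q(2)] mult_left_mono[OF Xd[OF q] L] by simp
      then have "norm (a q - a q') \<le> 2 * \<theta> + L * (?N / ?M)"
      proof -
        have e: "a q - a q' = (G (X q) - G (X q')) - (G (X q) - a q) + (G (X q') - a q')" by simp
        have "norm (a q - a q') \<le> norm (G (X q) - G (X q')) + norm (G (X q) - a q) + norm (G (X q') - a q')"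
          unfolding e by (intro order_trans[OF norm_triangle_ineq] add_right_mono norm_triangle_ineq4)
        then show ?thesis
          using X(2)[OF q(1)] X(2)[OF q(2)] \<open>norm (G (X q) - G (X q')) \<le> L * (?N / ?M)\<close> by linarith
      qed
      then have "\<bar>(a q - a q') $ j\<bar> \<le> 2 * \<theta> + L * (?N / ?M)"
        using component_le_norm_cart[of "a q - a q'" j] by linarith
      then have "?M\<^sup>2 * \<bar>(a q - a q') $ j\<bar> \<le> ?M\<^sup>2 * (2 * \<theta> + L * (?N / ?M))" by (intro mult_left_mono) auto
      also have "\<dots> = 2 * (?M\<^sup>2 * \<theta>) + L * ?N * ?M" using M4 by (simp add: power2_eq_square field_simps)
      also have "\<dots> \<le> (2 + L * ?N) * ?M" using M\<theta> M4 by (simp add: algebra_simps)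
      also have "\<dots> \<le> real R0 * ?M" using R0 by (intro mult_right_mono) auto
      finally have "\<bar>real_of_int (q j) - real_of_int (q' j)\<bar> \<le> real R0 * ?M" unfolding qdiff by (simp add: abs_mult)
      then have "real_of_int \<bar>q j - q' j\<bar> \<le> real_of_int (int (R0 * m))" by simp
      then show ?thesis by (simp only: of_int_le_iff)
    qed
    define Q1 where "Q1 = {q \<in> Q. \<exists>w. norm (H (X q) *v w) < \<theta> * norm w}"
    define Q2 where "Q2 = {q \<in> Q. norm (X q) > 1 - \<theta>}"
    have Q12: "Q = Q1 \<union> Q2" using X(3) by (auto simp: Q1_def Q2_def)
    have fin12: "finite Q1" "finite Q2" using finQ by (auto simp: Q1_def Q2_def)
    have pow3: "2 * m + 1 \<le> 3 * m" "2 * (R0 * m) + 1 \<le> (2 * R0 + 1) * m" using m1 by auto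
    have fib1: "card {q \<in> Q1. cell q = p} \<le> (2 * (R0 * m) + 1) ^ (?n - 1) * (T1 + 1)" for p
    proof (cases "{q \<in> Q1. cell q = p} = {}")
      case True
      show ?thesis unfolding True by simp
    next
      case False
      then obtain q0 where q0: "q0 \<in> Q" "cell q0 = p" and "\<exists>w. norm (H (X q0) *v w) < \<theta> * norm w"
        by (auto simp: Q1_def)
      then obtain w where w: "norm (H (X q0) *v w) < \<theta> * norm w" by blast
      then have w0: "w \<noteq> 0" by auto
      obtain i where i: "norm w \<le> ?N * \<bar>w $ i\<bar>" by (rule exists_large_component)
      have wi: "\<bar>w $ i\<bar> > 0"
      proof (rule ccontr)
        assume "\<not> \<bar>w $ i\<bar> > 0"
        then show False using i w0 by simp
      qed
      \<comment> \<open>The direction \<open>w\<close>, taken from one bad witness in the cell,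
        confines all tilts of the cell to a slab, whatever the null directions at their own
        witnesses are.\<close>
      have slab: "\<bar>w \<bullet> (a q - a q0)\<bar> \<le> norm w * (C * \<theta>)" if q: "q \<in> Q" "cell q = p" for q
      proof -
        let ?x = "X q0" and ?y = "X q"
        have xy: "?x \<in> cball 0 1" "?y \<in> cball 0 1" using X(1) q0 q by auto
        have d: "norm (?y - ?x) \<le> ?N / ?M" using Xd q q0 by simp
        have d2: "(norm (?y - ?x))\<^sup>2 \<le> ?N\<^sup>2 * \<theta>"
          using power_mono[OF d norm_ge_zero, of 2] by (simp add: \<theta>_def power_divide)
        have "\<bar>w \<bullet> D ?x (?y - ?x)\<bar> \<le> norm (?y - ?x) * norm (H ?x *v w)"
          unfolding GH[OF xy(1)] by (rule Cauchy_Schwarz_ineq2)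
        also have "\<dots> \<le> ?N * (\<theta> * norm w)"
        proof (rule mult_mono)
          have "?N / ?M \<le> ?N" using M4 N by (simp add: field_simps)
          then show "norm (?y - ?x) \<le> ?N" using d by linarith
        qed (use w N in auto)
        finally have e1: "\<bar>w \<bullet> D ?x (?y - ?x)\<bar> \<le> norm w * (?N * \<theta>)" by (simp add: mult_ac)
        have "\<bar>w \<bullet> (G ?y - G ?x - D ?x (?y - ?x))\<bar> \<le> norm w * norm (G ?y - G ?x - D ?x (?y - ?x))"
          by (rule Cauchy_Schwarz_ineq2)
        also have "\<dots> \<le> norm w * (L * (?N\<^sup>2 * \<theta>))"
          using G2[OF xy] mult_left_mono[OF d2 L] by (intro mult_left_mono) auto
        finally have e2: "\<bar>w \<bullet> (G ?y - G ?x - D ?x (?y - ?x))\<bar> \<le> norm w * (L * (?N\<^sup>2 * \<theta>))" .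
        have e3: "\<bar>w \<bullet> (G ?y - a q)\<bar> \<le> norm w * \<theta>" "\<bar>w \<bullet> (G ?x - a q0)\<bar> \<le> norm w * \<theta>"
          using Cauchy_Schwarz_ineq2[of w] X(2)[OF q(1)] X(2)[OF q0(1)] mult_left_mono norm_ge_zero order_trans by metis+
        have "w \<bullet> (a q - a q0) = w \<bullet> D ?x (?y - ?x) + w \<bullet> (G ?y - G ?x - D ?x (?y - ?x)) - w \<bullet> (G ?y - a q) + w \<bullet> (G ?x - a q0)"
          by (simp add: inner_diff_right)
        then have "\<bar>w \<bullet> (a q - a q0)\<bar> \<le> norm w * (?N * \<theta>) + norm w * (L * (?N\<^sup>2 * \<theta>)) + norm w * \<theta> + norm w * \<theta>"
          using e1 e2 e3 by linarith
        then show ?thesis by (simp add: C_def algebra_simps)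
      qed
      show ?thesis
      proof (rule card_le_by_fibers[where i = i and ?q0.0 = q0])
        show "\<bar>q j - q0 j\<bar> \<le> int (R0 * m)" if "q \<in> {q \<in> Q1. cell q = p}" for q j
          by (rule box) (use that q0 in \<open>auto simp: Q1_def\<close>)
        fix q q' assume q: "q \<in> {q \<in> Q1. cell q = p}" "q' \<in> {q \<in> Q1. cell q = p}" and eq: "\<And>j. j \<noteq> i \<Longrightarrow> q j = q' j"
        have "\<bar>w \<bullet> (a q - a q0)\<bar> \<le> norm w * (C * \<theta>)" "\<bar>w \<bullet> (a q' - a q0)\<bar> \<le> norm w * (C * \<theta>)"
          using q slab by (auto simp: Q1_def)
        then have "\<bar>w \<bullet> (a q - a q')\<bar> \<le> 2 * (norm w * (C * \<theta>))"
          by (simp add: inner_diff_right)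
        \<comment> \<open>Along a fibre only coordinate \<open>i\<close> varies, and
          \<open>i\<close> was chosen so that \<open>w $ i\<close> is comparable with |w|.\<close>
        moreover have "w \<bullet> (a q - a q') = w $ i * (a q - a q') $ i"
        proof -
          have "w \<bullet> (a q - a q') = (\<Sum>j\<in>UNIV. w $ j * (a q - a q') $ j)" by (simp add: inner_vec_def)
          also have "\<dots> = (\<Sum>j\<in>{i}. w $ j * (a q - a q') $ j)"
            by (rule sum.mono_neutral_right) (use eq in \<open>auto simp: a_def\<close>)
          finally show ?thesis by simp
        qed
        ultimately have "\<bar>w $ i\<bar> * \<bar>(a q - a q') $ i\<bar> \<le> 2 * (norm w * (C * \<theta>))" by (simp add: abs_mult)
        also have "\<dots> \<le> 2 * ((?N * \<bar>w $ i\<bar>) * (C * \<theta>))"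
          using i L \<theta>(1) by (intro mult_left_mono mult_right_mono) (auto simp: C_def)
        also have "\<dots> = \<bar>w $ i\<bar> * (2 * ?N * C * \<theta>)" by simp
        finally have "\<bar>(a q - a q') $ i\<bar> \<le> 2 * ?N * C * \<theta>" using wi by simp
        then have "?M\<^sup>2 * \<bar>(a q - a q') $ i\<bar> \<le> ?M\<^sup>2 * (2 * ?N * C * \<theta>)" by (rule mult_left_mono) simp
        also have "\<dots> = 2 * ?N * C * (?M\<^sup>2 * \<theta>)" by simp
        also have "\<dots> \<le> real T1" using M\<theta> T1 by simp
        finally have "\<bar>real_of_int (q i) - real_of_int (q' i)\<bar> \<le> real T1" unfolding qdiff by (simp add: abs_mult)
        then have "real_of_int \<bar>q i - q' i\<bar> \<le> real_of_int (int T1)" by simp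
        then show "\<bar>q i - q' i\<bar> \<le> int T1" by (simp only: of_int_le_iff)
      qed
    qed
    have pcell: "\<bar>cell q j - 0\<bar> \<le> int m" if "q \<in> Q" for q j
    proof -
      have "\<bar>X q $ j\<bar> \<le> 1" using component_le_norm_cart[of "X q" j] X(1)[OF that] by linarith
      then have b: "\<bar>?M * X q $ j\<bar> \<le> ?M" unfolding abs_mult using mult_left_mono[of "\<bar>X q $ j\<bar>" 1 ?M] by simp
      show ?thesis using abs_floor_le[OF b] by (simp add: cell_def)
    qed
    have "Q1 = (\<Union>p\<in>cell ` Q1. {q \<in> Q1. cell q = p})" by auto
    then have "card Q1 \<le> (\<Sum>p\<in>cell ` Q1. card {q \<in> Q1. cell q = p})"
      using card_UN_le[of "cell ` Q1" "\<lambda>p. {q \<in> Q1. cell q = p}"] fin12 by simp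
    also have "\<dots> \<le> (\<Sum>p\<in>cell ` Q1. (2 * (R0 * m) + 1) ^ (?n - 1) * (T1 + 1))" by (rule sum_mono) (rule fib1)
    also have "\<dots> = card (cell ` Q1) * ((2 * (R0 * m) + 1) ^ (?n - 1) * (T1 + 1))" by simp
    also have "\<dots> \<le> (2 * m + 1) ^ ?n * ((2 * (R0 * m) + 1) ^ (?n - 1) * (T1 + 1))"
      by (intro mult_right_mono card_box_le(2)[where ?q0.0 = "\<lambda>_. 0"]) (use pcell in \<open>auto simp: Q1_def\<close>)
    also have "\<dots> \<le> (3 * m) ^ ?n * (((2 * R0 + 1) * m) ^ (?n - 1) * (T1 + 1))"
      by (intro mult_mono power_mono pow3) auto
    also have "\<dots> = C1 * (m ^ ?n * m ^ (?n - 1))" unfolding C1_def power_mult_distrib by (simp only: mult_ac)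
    finally have card1: "card Q1 \<le> C1 * (m ^ ?n * m ^ (?n - 1))" .
    let ?Sh = "{p :: 'n \<Rightarrow> int. \<exists>x :: real ^ 'n. norm x \<le> 1 \<and> norm x > 1 - 1 / ?M\<^sup>2 \<and> p = (\<lambda>i. \<lfloor>?M * x $ i\<rfloor>)}"
    have finSh: "finite ?Sh"
    proof (rule card_box_le(1)[where ?q0.0 = "\<lambda>_. 0" and R = m])
      fix p j assume "p \<in> ?Sh"
      then obtain x :: "real ^ 'n" where x: "norm x \<le> 1" "p = (\<lambda>i. \<lfloor>?M * x $ i\<rfloor>)" by blast
      have "\<bar>x $ j\<bar> \<le> 1" using component_le_norm_cart[of x j] x(1) by linarith
      then have b: "\<bar>?M * x $ j\<bar> \<le> ?M" unfolding abs_mult using mult_left_mono[of "\<bar>x $ j\<bar>" 1 ?M] by simp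
      show "\<bar>p j - 0\<bar> \<le> int m" using abs_floor_le[OF b] by (simp add: x(2))
    qed
    have subSh: "cell ` Q2 \<subseteq> ?Sh"
      using X(1) unfolding Q2_def cell_def \<theta>_def by blast
    \<comment> \<open>Cells near the sphere are rarer by a factor m, so here the box count without
      any slab is good enough.\<close>
    have "Q2 = (\<Union>p\<in>cell ` Q2. {q \<in> Q2. cell q = p})" by auto
    then have "card Q2 \<le> (\<Sum>p\<in>cell ` Q2. card {q \<in> Q2. cell q = p})"
      using card_UN_le[of "cell ` Q2" "\<lambda>p. {q \<in> Q2. cell q = p}"] fin12 by simp
    also have "\<dots> \<le> (\<Sum>p\<in>cell ` Q2. (2 * (R0 * m) + 1) ^ ?n)"
    proof (rule sum_mono)
      fix p assume "p \<in> cell ` Q2"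
      then obtain q0 where q0: "q0 \<in> Q" "cell q0 = p" by (auto simp: Q2_def)
      show "card {q \<in> Q2. cell q = p} \<le> (2 * (R0 * m) + 1) ^ ?n"
        by (rule card_box_le(2)[where ?q0.0 = q0]) (use box q0 in \<open>auto simp: Q2_def\<close>)
    qed
    also have "\<dots> = card (cell ` Q2) * (2 * (R0 * m) + 1) ^ ?n" by simp
    also have "\<dots> \<le> (2 * ?n * ((2 * m + 1) ^ (?n - 1) * (12 * ?n\<^sup>2 + 1))) * (2 * (R0 * m) + 1) ^ ?n"
      by (intro mult_right_mono order_trans[OF card_mono[OF finSh subSh] card_boundary_cells[OF m]]) simp
    also have "\<dots> \<le> (2 * ?n * ((3 * m) ^ (?n - 1) * (12 * ?n\<^sup>2 + 1))) * ((2 * R0 + 1) * m) ^ ?n"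
      by (intro mult_mono power_mono pow3) auto
    also have "\<dots> = C2 * (m ^ ?n * m ^ (?n - 1))" unfolding C2_def power_mult_distrib by (simp only: mult_ac)
    finally have card2: "card Q2 \<le> C2 * (m ^ ?n * m ^ (?n - 1))" .
    have "card Q \<le> (C1 + C2) * (m ^ ?n * m ^ (?n - 1))"
      using card_Un_le[of Q1 Q2] card1 card2 unfolding Q12[symmetric] by (simp add: distrib_right)
    then have "real (card Q) \<le> real ((C1 + C2) * (m ^ ?n * m ^ (?n - 1)))" by (simp only: of_nat_le_iff)
    then have "(\<epsilon>' * ?M\<^sup>2) ^ ?n \<le> real (C1 + C2) * (?M ^ ?n * ?M ^ (?n - 1))" using cardQ by simp
    \<comment> \<open>Splits off the one factor m by which the grid exceeds m^(2n-1), to be played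
      against \<open>mC\<close>.\<close>
    moreover have "(\<epsilon>' * ?M\<^sup>2) ^ ?n = \<epsilon>' ^ ?n * ?M * (?M ^ ?n * ?M ^ (?n - 1))"
    proof -
      have "?M * ?M ^ (?n - 1) = ?M ^ ?n" by (metis power_minus_mult zero_less_card_finite mult.commute)
      then show ?thesis by (simp add: power_mult_distrib power2_eq_square mult_ac)
    qed
    ultimately have "\<epsilon>' ^ ?n * ?M * (?M ^ ?n * ?M ^ (?n - 1)) \<le> real (C1 + C2) * (?M ^ ?n * ?M ^ (?n - 1))" by simp
    moreover have "0 < ?M ^ ?n * ?M ^ (?n - 1)" using M4 by simp
    ultimately have "\<epsilon>' ^ ?n * ?M \<le> real (C1 + C2)" by (simp only: mult_le_cancel_right_pos)
    then show False using mC by linarith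
  qed
  show ?thesis
  proof (intro exI[of _ \<theta>] conjI allI impI \<theta>; elim conjE)
    fix G :: "real ^ 'n \<Rightarrow> real ^ 'n" and H :: "real ^ 'n \<Rightarrow> real ^ 'n ^ 'n" and D
    assume "\<forall>x\<in>cball 0 1. \<forall>y\<in>cball 0 1. norm (G y - G x) \<le> L * norm (y - x)"
      "\<forall>x\<in>cball 0 1. \<forall>y\<in>cball 0 1. norm (G y - G x - D x (y - x)) \<le> L * (norm (y - x))\<^sup>2"
      "\<forall>x\<in>cball 0 1. \<forall>v w. w \<bullet> D x v = v \<bullet> (H x *v w)"
    then show "\<exists>a. norm a \<le> \<epsilon> \<and> (\<forall>x\<in>cball 0 1. norm (G x - a) \<le> \<theta> \<longrightarrow>
       (\<forall>v. \<theta> * norm v \<le> norm (H x *v v)) \<and> norm x \<le> 1 - \<theta>)"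
      by (intro main[where D = D]) blast+
  qed
qed

section \<open>Nondegenerate functions\<close>

definition gradient :: "(real ^ 'n) set \<Rightarrow> (real ^ 'n \<Rightarrow> real) \<Rightarrow> real ^ 'n \<Rightarrow> real ^ 'n" where
  "gradient U f x = (\<chi> j. nderiv U f [axis j 1] x)"

text \<open>As a matrix this is the transpose of the Hessian, hence equal to it at interior
  points.\<close>

definition gradient_deriv :: "(real ^ 'n) set \<Rightarrow> (real ^ 'n \<Rightarrow> real) \<Rightarrow> real ^ 'n \<Rightarrow> real ^ 'n \<Rightarrow> real ^ 'n" where
  "gradient_deriv U f x v = (\<chi> j. nderiv U f [v, axis j 1] x)"

lemma nderiv_gradient:
  assumes "Ck_on k U f" "1 \<le> k" "x \<in> U"
  shows "nderiv U f [v] x = v \<bullet> gradient U f x"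
  using nderiv_single[of k U f "[]" x v] assms by (simp add: gradient_def inner_vec_def)

lemma critical_points_iff_gradient:
  assumes "Ck_on k U f" "1 \<le> k"
  shows "x \<in> critical_points U f \<longleftrightarrow> x \<in> U \<and> gradient U f x = 0"
proof -
  have "frechet_derivative f (at x within U) v = v \<bullet> gradient U f x" if "x \<in> U" for v
    using nderiv_gradient[OF assms that, of v] by simp
  then have "(frechet_derivative f (at x within U) = (\<lambda>v. 0)) \<longleftrightarrow> gradient U f x = 0" if "x \<in> U"
    using that by (metis inner_eq_zero_iff inner_zero_right)
  then show ?thesis by (auto simp: critical_points_def)
qed

text \<open>The functional is evaluated at the gradient itself. This turns the operator norm in (v)
  into a bound on the gradient.\<close>

lemma norm_gradient_le_onorm:
  assumes "Ck_on k U f" "1 \<le> k" "x \<in> U"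
  shows "norm (gradient U f x) \<le> onorm (frechet_derivative f (at x within U))"
proof -
  let ?g = "gradient U f x"
  have eq: "frechet_derivative f (at x within U) = (\<lambda>v. v \<bullet> ?g)"
    using nderiv_gradient[OF assms] by (simp add: fun_eq_iff)
  have "norm (?g \<bullet> ?g) \<le> onorm (\<lambda>v. v \<bullet> ?g) * norm ?g"
    by (rule onorm[OF bounded_linear_inner_left])
  then have "norm ?g * norm ?g \<le> onorm (\<lambda>v. v \<bullet> ?g) * norm ?g"
    by (simp add: power2_norm_eq_inner[symmetric] power2_eq_square)
  then show ?thesis unfolding eq
    using onorm_pos_le[OF bounded_linear_inner_left[of ?g]] by (cases "?g = 0") auto
qed

lemma inner_gradient_deriv:
  assumes "full_tangent U" "Ck_on k U f" "2 \<le> k" "x \<in> U"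
  shows "w \<bullet> gradient_deriv U f x v = v \<bullet> (Hessian U f x *v w)"
proof -
  have "w \<bullet> gradient_deriv U f x v = (\<Sum>j\<in>UNIV. w $ j * nderiv U f [v, axis j 1] x)"
    by (simp only: gradient_deriv_def inner_vec_def vec_lambda_beta inner_real_def)
  also have "\<dots> = nderiv U f [v, w] x" by (rule nderiv_pair_right[OF assms, symmetric])
  also have "\<dots> = v \<bullet> (Hessian U f x *v w)" by (rule nderiv_Hessian[OF assms])
  finally show ?thesis .
qed

lemma gradient_deriv_interior:
  assumes U: "full_tangent U" and f: "Ck_on k U f" "2 \<le> k" and W: "open W" "W \<subseteq> U" "x \<in> W"
  shows "gradient_deriv U f x v = Hessian U f x *v v"
proof -
  have x: "x \<in> U" using W by auto
  have "w \<bullet> gradient_deriv U f x v = w \<bullet> (Hessian U f x *v v)" for w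
    using inner_gradient_deriv[OF U f x, of w v] nderiv_Hessian[OF U f x, of v w]
      nderiv_Hessian[OF U f x, of w v] nderiv_commute_interior[OF f W, of v w] by simp
  then show ?thesis using vector_eq_ldot by blast
qed

lemma gradient_has_derivative:
  assumes f: "Ck_on k U f" "2 \<le> k" and x: "x \<in> U"
  shows "(gradient U f has_derivative gradient_deriv U f x) (at x within U)"
proof -
  have "(nderiv U f [axis j 1] has_derivative (\<lambda>v. nderiv U f [v, axis j 1] x)) (at x within U)" for j
    by (rule Ck_on_has_derivative[OF f(1)]) (use f x in auto)
  then show ?thesis
    unfolding has_derivative_componentwise_within[of "gradient U f"]
    by (auto simp: Basis_vec_def gradient_def gradient_deriv_def inner_axis simp del: nderiv.simps)
qed

lemma linear_bound_unit_ball: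
  fixes \<phi> :: "'a::real_normed_vector \<Rightarrow> 'b::real_normed_vector"
  assumes lin: "linear \<phi>" and b: "\<And>v. norm v \<le> 1 \<Longrightarrow> norm (\<phi> v) \<le> K"
  shows "norm (\<phi> v) \<le> K * norm v"
proof (cases "v = 0")
  case True
  then show ?thesis using linear_0[OF lin] by simp
next
  case False
  have "norm (\<phi> ((1 / norm v) *\<^sub>R v)) \<le> K" by (rule b) (use False in simp)
  then have "(1 / norm v) * norm (\<phi> v) \<le> K" by (simp add: linear_scale[OF lin])
  then show ?thesis using False by (simp add: field_simps)
qed

text \<open>The C^k norm bounds single components, whence the factor \<open>CARD('n)\<close> in
  \<open>L\<close>. The Taylor estimate compares two points \<open>y\<close> and \<open>z\<close>
  with the linearization at a third, the form in which the contraction argument uses it.\<close>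

lemma C3_estimates:
  fixes f :: "real ^ 'n \<Rightarrow> real"
  assumes U: "full_tangent U" "convex U" and f: "Ck_on k U f" "3 \<le> k" "Ck_norm k U f \<le> ereal K" and K: "K \<ge> 0"
    and L: "L = real CARD('n) * K"
  shows gradient_lipschitz: "\<And>x y. x \<in> U \<Longrightarrow> y \<in> U \<Longrightarrow> norm (gradient U f y - gradient U f x) \<le> L * norm (y - x)"
    and gradient_taylor: "\<And>x y z r. x \<in> U \<Longrightarrow> y \<in> U \<Longrightarrow> z \<in> U \<Longrightarrow> norm (y - x) \<le> r \<Longrightarrow> norm (z - x) \<le> r \<Longrightarrow>
      norm (gradient U f y - gradient U f z - gradient_deriv U f x (y - z)) \<le> L * r * norm (y - z)"
    and Hessian_lipschitz: "\<And>x y v. x \<in> U \<Longrightarrow> y \<in> U \<Longrightarrow>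
      norm (Hessian U f y *v v - Hessian U f x *v v) \<le> L * norm (y - x) * norm v"
proof -
  have f2: "2 \<le> k" "1 \<le> k" using f(2) by auto
  have L0: "L \<ge> 0" using K L by simp
  have bd: "norm (nderiv U f vs x) \<le> K" if "1 \<le> length vs" "length vs \<le> 3" "\<forall>v\<in>set vs. norm v \<le> 1" "x \<in> U" for vs x
    using f(3) that f(2) unfolding Ck_norm_le_iff[OF f2(2)] by auto
  have lin: "linear (\<lambda>v. nderiv U f (v # vs) x)" if "length vs < 3" "x \<in> U" for vs x
    by (rule has_derivative_linear[OF Ck_on_has_derivative[OF f(1)]]) (use that f(2) in auto)
  have ax: "norm (axis j 1 :: real ^ 'n) \<le> 1" for j by (simp add: norm_axis_1)
  have c1: "norm (nderiv U f [v, axis j 1] x) \<le> K * norm v" if "x \<in> U" for j v x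
    by (rule linear_bound_unit_ball[OF lin]) (use that ax bd[of "[_, axis j 1]" x] in auto)
  have c2: "norm (nderiv U f [v, axis j 1] y - nderiv U f [v, axis j 1] x) \<le> K * norm (y - x) * norm v"
    if xy: "x \<in> U" "y \<in> U" for j v x y
  proof (rule linear_bound_unit_ball)
    show "linear (\<lambda>v. nderiv U f [v, axis j 1] y - nderiv U f [v, axis j 1] x)"
      by (rule linear_compose_sub[OF lin lin]) (use xy in auto)
    fix v :: "real ^ 'n" assume v: "norm v \<le> 1"
    show "norm (nderiv U f [v, axis j 1] y - nderiv U f [v, axis j 1] x) \<le> K * norm (y - x)"
    proof (rule differentiable_bound[OF U(2), where f' = "\<lambda>x w. nderiv U f [w, v, axis j 1] x"])
      show "(nderiv U f [v, axis j 1] has_derivative (\<lambda>w. nderiv U f [w, v, axis j 1] x)) (at x within U)" if "x \<in> U" for x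
        by (rule Ck_on_has_derivative[OF f(1)]) (use that f(2) in auto)
      show "onorm (\<lambda>w. nderiv U f [w, v, axis j 1] x) \<le> K" if "x \<in> U" for x
      proof (rule onorm_le)
        show "norm (nderiv U f [w, v, axis j 1] x) \<le> K * norm w" for w
          by (rule linear_bound_unit_ball[OF lin]) (use that ax v bd[of "[_, v, axis j 1]" x] in auto)
      qed
    qed (use xy in auto)
  qed
  have D: "norm (gradient_deriv U f x v) \<le> L * norm v" if "x \<in> U" for x v
    using norm_le_card_mult[of "gradient_deriv U f x v" "K * norm v"] c1[OF that, of v] L
    by (simp add: gradient_deriv_def mult.assoc del: nderiv.simps)
  have DL: "norm (gradient_deriv U f y v - gradient_deriv U f x v) \<le> L * norm (y - x) * norm v"
    if "x \<in> U" "y \<in> U" for x y v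
    using norm_le_card_mult[of "gradient_deriv U f y v - gradient_deriv U f x v" "K * norm (y - x) * norm v"] c2[OF that, of v] L
    by (simp add: gradient_deriv_def mult.assoc del: nderiv.simps)
  note dg = gradient_has_derivative[OF f(1) f2(1)]
  show "norm (gradient U f y - gradient U f x) \<le> L * norm (y - x)" if "x \<in> U" "y \<in> U" for x y
    by (rule differentiable_bound[OF U(2) dg]) (use that D in \<open>auto intro!: onorm_le\<close>)
  show "norm (gradient U f y - gradient U f z - gradient_deriv U f x (y - z)) \<le> L * r * norm (y - z)"
    if x: "x \<in> U" and yz: "y \<in> U" "z \<in> U" "norm (y - x) \<le> r" "norm (z - x) \<le> r" for x y z r
  proof -
    let ?S = "U \<inter> cball x r"
    have linD: "linear (gradient_deriv U f x)" using dg[OF x] by (rule has_derivative_linear)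
    have "norm ((gradient U f y - gradient_deriv U f x y) - (gradient U f z - gradient_deriv U f x z)) \<le> L * r * norm (y - z)"
    proof (rule differentiable_bound[where S = ?S and f' = "\<lambda>u v. gradient_deriv U f u v - gradient_deriv U f x v"])
      show "convex ?S" by (intro convex_Int U(2) convex_cball)
      show "((\<lambda>y. gradient U f y - gradient_deriv U f x y) has_derivative (\<lambda>v. gradient_deriv U f u v - gradient_deriv U f x v)) (at u within ?S)"
        if "u \<in> ?S" for u
        by (intro has_derivative_diff has_derivative_subset[OF dg] linear_imp_has_derivative linD) (use that in auto)
      show "onorm (\<lambda>v. gradient_deriv U f u v - gradient_deriv U f x v) \<le> L * r" if u: "u \<in> ?S" for u
      proof (rule onorm_le)
        fix v
        have "norm (gradient_deriv U f u v - gradient_deriv U f x v) \<le> L * norm (u - x) * norm v"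
          by (rule DL) (use u x in auto)
        also have "\<dots> \<le> L * r * norm v"
          using u L0 by (intro mult_right_mono mult_left_mono) (auto simp: dist_norm norm_minus_commute)
        finally show "norm (gradient_deriv U f u v - gradient_deriv U f x v) \<le> L * r * norm v" .
      qed
    qed (use yz in \<open>auto simp: dist_norm norm_minus_commute\<close>)
    then show ?thesis by (simp add: linear_diff[OF linD] algebra_simps)
  qed
  show "norm (Hessian U f y *v v - Hessian U f x *v v) \<le> L * norm (y - x) * norm v" if xy: "x \<in> U" "y \<in> U" for x y v
  proof -
    let ?d = "Hessian U f y *v v - Hessian U f x *v v"
    \<comment> \<open>Pairing the difference with itself leads, through the adjoint relation, to
      \<open>gradient_deriv\<close> and its Lipschitz bound \<open>DL\<close>.\<close>
    have "norm ?d * norm ?d = ?d \<bullet> ?d" by (simp add: power2_norm_eq_inner[symmetric] power2_eq_square)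
    also have "\<dots> = v \<bullet> (gradient_deriv U f y ?d - gradient_deriv U f x ?d)"
      using inner_gradient_deriv[OF U(1) f(1) f2(1) xy(1), of v ?d] inner_gradient_deriv[OF U(1) f(1) f2(1) xy(2), of v ?d]
      by (simp add: inner_diff_right)
    also have "\<dots> \<le> norm v * norm (gradient_deriv U f y ?d - gradient_deriv U f x ?d)" by (rule norm_cauchy_schwarz)
    also have "\<dots> \<le> norm v * (L * norm (y - x) * norm ?d)" by (intro mult_left_mono DL xy) auto
    finally have "norm ?d * norm ?d \<le> (L * norm (y - x) * norm v) * norm ?d" by (simp add: mult_ac)
    then show ?thesis using L0 by (cases "?d = 0") auto
  qed
qed

text \<open>The condition is imposed wherever the gradient is small, not only where it vanishes. So
  it serves (v) as well as (i), and the last clause also gives room inside the ball for the Morse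
  charts.\<close>

definition nondegenerate :: "real \<Rightarrow> (real ^ 'n \<Rightarrow> real) \<Rightarrow> bool" where
  "nondegenerate \<theta> f \<longleftrightarrow> (\<forall>x\<in>cball 0 1. norm (gradient (cball 0 1) f x) \<le> \<theta> \<longrightarrow>
     (\<forall>v. \<theta> * norm v \<le> norm (Hessian (cball 0 1) f x *v v)) \<and> norm x \<le> 1 - \<theta>)"

lemma nondegenerateD:
  fixes f :: "real ^ 'n \<Rightarrow> real"
  assumes nd: "nondegenerate \<theta> f" and \<theta>: "\<theta> > 0" and f: "Ck_on k (cball 0 1) f" "2 \<le> k"
    and x: "x \<in> cball 0 1" "norm (gradient (cball 0 1) f x) \<le> \<theta>"
  shows "norm x \<le> 1 - \<theta>" "\<theta> * norm v \<le> norm (Hessian (cball 0 1) f x *v v)"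
    "gradient_deriv (cball 0 1) f x v = Hessian (cball 0 1) f x *v v"
proof -
  show n: "norm x \<le> 1 - \<theta>" "\<theta> * norm v \<le> norm (Hessian (cball 0 1) f x *v v)"
    using nd x unfolding nondegenerate_def by auto
  show "gradient_deriv (cball 0 1) f x v = Hessian (cball 0 1) f x *v v"
    by (rule gradient_deriv_interior[OF full_tangent_cball f, of "ball 0 1"]) (use n \<theta> in auto)
qed

text \<open>Newton iteration with the derivative frozen at \<open>x\<close>. The bound on
  \<open>CARD('n) * K * r\<close> makes it contract by 1/2, and the small gradient moves the centre
  by at most r/2, so \<open>cball x r\<close> is mapped into itself.\<close>

lemma near_critical_point:
  fixes f :: "real ^ 'n \<Rightarrow> real"
  assumes nd: "nondegenerate \<theta> f" and \<theta>: "\<theta> > 0" and f: "Ck_on k (cball 0 1) f" "3 \<le> k" "Ck_norm k (cball 0 1) f \<le> ereal K" and K: "K \<ge> 0"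
    and r: "0 < r" "r \<le> \<theta>" "real CARD('n) * K * r \<le> \<theta> / 2"
    and x: "x \<in> cball 0 1" "norm (gradient (cball 0 1) f x) \<le> \<theta>" "norm (gradient (cball 0 1) f x) \<le> \<theta> * r / 2"
  obtains x' where "x' \<in> critical_points (cball 0 1) f" "dist x x' \<le> r"
proof -
  let ?B = "cball (0 :: real ^ 'n) 1"
  let ?G = "gradient ?B f" and ?H = "\<lambda>v. Hessian ?B f x *v v"
  have f2: "2 \<le> k" "1 \<le> k" using f(2) by auto
  note nx = nondegenerateD[OF nd \<theta> f(1) f2(1) x(1,2)]
  have sub: "cball x r \<subseteq> ?B"
  proof
    fix y assume "y \<in> cball x r"
    then have "norm y \<le> norm x + r" using norm_triangle_ineq2[of y x] by (simp add: dist_norm norm_minus_commute)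
    then show "y \<in> ?B" using nx(1) r by simp
  qed
  have lin: "linear ?H" by (rule matrix_vector_mul_linear)
  have inj: "inj ?H"
  proof (rule injI)
    fix v w assume "?H v = ?H w"
    then show "v = w" using nx(2)[of "v - w"] \<theta> by (simp add: matrix_vector_mult_diff_distrib mult_le_0_iff)
  qed
  have surj: "surj ?H" by (rule linear_injective_imp_surjective[OF lin inj refl])
  define J where "J = inv ?H"
  have HJ: "?H (J w) = w" for w unfolding J_def using surj_f_inv_f[OF surj] .
  have JH: "J (?H w) = w" for w unfolding J_def using inv_f_f[OF inj] .
  have linJ: "linear J" unfolding J_def using inj_linear_imp_inv_linear[OF lin inj] .
  have J: "norm (J w) \<le> norm w / \<theta>" for w using nx(2)[of "J w"] \<theta> unfolding HJ by (simp add: field_simps)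
  define T where "T y = y - J (?G y)" for y
  have contr: "dist (T y) (T z) \<le> (1 / 2) * dist y z" if yz: "y \<in> cball x r" "z \<in> cball x r" for y z
  proof -
    have "T y - T z = J (?H (y - z) - (?G y - ?G z))"
      by (simp add: T_def linear_diff[OF linJ] JH)
    then have "norm (T y - T z) \<le> norm (?G y - ?G z - gradient_deriv ?B f x (y - z)) / \<theta>"
      using J[of "?H (y - z) - (?G y - ?G z)"] by (simp add: nx(3) norm_minus_commute)
    also have "\<dots> \<le> (real CARD('n) * K * r * norm (y - z)) / \<theta>"
      by (intro divide_right_mono gradient_taylor[OF full_tangent_cball convex_cball f K refl])
         (use yz sub x \<theta> in \<open>auto simp: dist_norm norm_minus_commute\<close>)
    also have "\<dots> \<le> (\<theta> / 2 * norm (y - z)) / \<theta>"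
      using r(3) \<theta> by (intro divide_right_mono mult_right_mono) auto
    also have "\<dots> = 1 / 2 * norm (y - z)" using \<theta> by simp
    finally show ?thesis by (simp add: dist_norm)
  qed
  have "\<exists>!y\<in>cball x r. T y = y"
  proof (rule Banach_fix[where c = "1 / 2"])
    show "T ` cball x r \<subseteq> cball x r"
    proof
      fix u assume "u \<in> T ` cball x r"
      then obtain y where y: "y \<in> cball x r" "u = T y" by auto
      have "dist x (T y) \<le> dist x (T x) + dist (T x) (T y)" by (rule dist_triangle)
      also have "dist x (T x) \<le> r / 2"
      proof -
        have "dist x (T x) = norm (J (?G x))" by (simp add: T_def dist_norm)
        also have "\<dots> \<le> (\<theta> * r / 2) / \<theta>" using J[of "?G x"] x(3) \<theta> by (smt (verit) divide_right_mono)
        finally show ?thesis using \<theta> by simp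
      qed
      also have "dist (T x) (T y) \<le> r / 2"
        using contr[of x y] y r by simp
      finally show "u \<in> cball x r" using y by simp
    qed
  qed (use contr r in \<open>auto simp: complete_eq_closed\<close>)
  then obtain y where y: "y \<in> cball x r" "T y = y" by auto
  then have "J (?G y) = 0" by (simp add: T_def)
  then have "?G y = 0" using HJ[of "?G y"] linear_0[OF lin] by simp
  then have "y \<in> critical_points ?B f"
    using critical_points_iff_gradient[OF f(1) f2(2)] y(1) sub by auto
  then show ?thesis using that y(1) by auto
qed

text \<open>Up to a quadratic error the gradient is linear and invertible near \<open>x\<close>, so
  it grows at least linearly there; a second critical point can lie only where the error takes
  over.\<close>

lemma critical_points_separated:
  fixes f :: "real ^ 'n \<Rightarrow> real"
  assumes nd: "nondegenerate \<theta> f" and \<theta>: "\<theta> > 0" and f: "Ck_on k (cball 0 1) f" "3 \<le> k" "Ck_norm k (cball 0 1) f \<le> ereal K" and K: "K \<ge> 0"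
    and x: "x \<in> critical_points (cball 0 1) f"
  shows "y \<in> cball 0 1 \<Longrightarrow> (\<theta> - real CARD('n) * K * norm (y - x)) * norm (y - x) \<le> norm (gradient (cball 0 1) f y)"
    and "y \<in> critical_points (cball 0 1) f \<Longrightarrow> x \<noteq> y \<Longrightarrow> \<theta> \<le> real CARD('n) * K * norm (x - y)"
proof -
  let ?B = "cball (0 :: real ^ 'n) 1"
  have f2: "2 \<le> k" "1 \<le> k" using f(2) by auto
  note crit = critical_points_iff_gradient[OF f(1) f2(2)]
  have x': "x \<in> ?B" "gradient ?B f x = 0" using x crit by auto
  have gx: "norm (gradient ?B f x) \<le> \<theta>" using x'(2) \<theta> by simp
  note nx = nondegenerateD[OF nd \<theta> f(1) f2(1) x'(1) gx]
  show main: "(\<theta> - real CARD('n) * K * norm (y - x)) * norm (y - x) \<le> norm (gradient ?B f y)" if "y \<in> ?B" for y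
  proof -
    have "norm (gradient ?B f y - gradient ?B f x - gradient_deriv ?B f x (y - x)) \<le> real CARD('n) * K * norm (y - x) * norm (y - x)"
      by (rule gradient_taylor[OF full_tangent_cball convex_cball f K refl]) (use that x' in auto)
    moreover have "\<theta> * norm (y - x) \<le> norm (gradient_deriv ?B f x (y - x))" unfolding nx(3) by (rule nx(2))
    moreover have "norm (gradient_deriv ?B f x (y - x)) - norm (gradient ?B f y) \<le> norm (gradient ?B f y - gradient_deriv ?B f x (y - x))"
      by (metis norm_minus_commute norm_triangle_ineq2)
    ultimately show ?thesis using x'(2) by (simp add: left_diff_distrib)
  qed
  show "\<theta> \<le> real CARD('n) * K * norm (x - y)" if "y \<in> critical_points ?B f" "x \<noteq> y"
  proof -
    have "y \<in> ?B" "gradient ?B f y = 0" using that(1) crit by auto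
    then have "(\<theta> - real CARD('n) * K * norm (y - x)) * norm (y - x) \<le> 0" using main by fastforce
    then show ?thesis using that(2) by (simp add: mult_le_0_iff norm_minus_commute)
  qed
qed

text \<open>Pigeonhole: the points of \<open>C\<close> fall into distinct cells of a grid of mesh
  below \<open>d / CARD('n)\<close>.\<close>

lemma separated_finite:
  assumes d: "d > 0"
  obtains N :: nat where "\<And>C :: (real ^ 'n) set. C \<subseteq> cball 0 1 \<Longrightarrow> (\<And>x y. x \<in> C \<Longrightarrow> y \<in> C \<Longrightarrow> x \<noteq> y \<Longrightarrow> d \<le> norm (x - y)) \<Longrightarrow>
    finite C \<and> card C \<le> N"
proof -
  define m where "m = nat \<lceil>real CARD('n) / d\<rceil> + 1"
  have m: "real CARD('n) / d < real m" unfolding m_def by linarith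
  then have m0: "0 < real m" using d by (smt (verit) divide_nonneg_pos of_nat_0_le_iff)
  show ?thesis
  proof (rule that[of "(2 * m + 1) ^ CARD('n)"])
    fix C :: "(real ^ 'n) set"
    assume C: "C \<subseteq> cball 0 1" and sep: "\<And>x y. x \<in> C \<Longrightarrow> y \<in> C \<Longrightarrow> x \<noteq> y \<Longrightarrow> d \<le> norm (x - y)"
    define c where "c x = (\<lambda>i. \<lfloor>real m * x $ i\<rfloor>)" for x :: "real ^ 'n"
    have inj: "inj_on c C"
    proof (rule inj_onI, rule ccontr)
      fix x y assume xy: "x \<in> C" "y \<in> C" "c x = c y" "x \<noteq> y"
      have "\<bar>(x - y) $ i\<bar> \<le> 1 / real m" for i
      proof -
        have "\<lfloor>real m * x $ i\<rfloor> = \<lfloor>real m * y $ i\<rfloor>" using fun_cong[OF xy(3), of i] by (simp add: c_def)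
        then have "\<bar>real m * x $ i - real m * y $ i\<bar> \<le> 1" by linarith
        moreover have "real m * x $ i - real m * y $ i = real m * (x - y) $ i" by (simp add: algebra_simps)
        ultimately have "real m * \<bar>(x - y) $ i\<bar> \<le> 1" by (simp add: abs_mult)
        then show ?thesis using m0 by (simp add: field_simps)
      qed
      from norm_le_card_mult[OF this] have "norm (x - y) \<le> real CARD('n) / real m" by simp
      also have "\<dots> < d" using m m0 d by (simp add: field_simps)
      finally show False using sep[OF xy(1,2,4)] by simp
    qed
    have b: "\<bar>q j - 0\<bar> \<le> int m" if q: "q \<in> c ` C" for q j
    proof -
      obtain x where x: "x \<in> C" "q = c x" using q by blast
      have "\<bar>x $ j\<bar> \<le> 1" using component_le_norm_cart[of x j] C x(1) by auto
      then have "\<bar>real m * x $ j\<bar> \<le> real m" unfolding abs_mult using mult_left_mono[of "\<bar>x $ j\<bar>" 1 "real m"] by simp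
      from abs_floor_le[OF this] show ?thesis by (simp add: x c_def)
    qed
    have "finite (c ` C)" "card (c ` C) \<le> (2 * m + 1) ^ CARD('n)"
      using card_box_le[where ?q0.0 = "\<lambda>_. 0" and S = "c ` C" and R = m] b by blast+
    then show "finite C \<and> card C \<le> (2 * m + 1) ^ CARD('n)"
      using inj by (simp add: card_image finite_image_iff)
  qed
qed

section \<open>Truncated powers\<close>

lemma pos_part_power_derivative:
  assumes "j \<ge> 1"
  shows "((\<lambda>t::real. (max 0 t) ^ Suc j) has_real_derivative real (Suc j) * (max 0 t) ^ j) (at t)"
proof -
  consider "t > 0" | "t < 0" | "t = 0" by linarith
  then show ?thesis
  proof cases
    case 1
    have "((\<lambda>t. t ^ Suc j) has_real_derivative real (Suc j) * t ^ j) (at t)"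
      using DERIV_pow[of "Suc j" t] by simp
    then have "((\<lambda>t. (max 0 t) ^ Suc j) has_real_derivative real (Suc j) * t ^ j) (at t)"
      by (rule has_field_derivative_transform_within_open[where S = "{0<..}"]) (use 1 in auto)
    then show ?thesis using 1 by (simp add: max_def)
  next
    case 2
    have "((\<lambda>t. 0) has_real_derivative 0) (at t)" by simp
    then have "((\<lambda>t. (max 0 t) ^ Suc j) has_real_derivative 0) (at t)"
      by (rule has_field_derivative_transform_within_open[where S = "{..<0}"]) (use 2 in \<open>auto simp: max_def\<close>)
    moreover have "real (Suc j) * (max 0 t) ^ j = 0" using 2 assms by (simp add: max_def)
    ultimately show ?thesis by (simp only:)
  next
    case 3
    \<comment> \<open>At the kink the difference quotient is at most |h|^j, which tends to 0 because
      j is positive.\<close>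
    have "((\<lambda>h::real. (max 0 h) ^ Suc j / h) \<longlongrightarrow> 0) (at 0)"
    proof (rule Lim_null_comparison)
      show "\<forall>\<^sub>F h in at 0. norm ((max 0 h) ^ Suc j / h) \<le> \<bar>h\<bar> ^ j"
        by (rule eventuallyI) (auto simp: max_def field_simps)
      show "((\<lambda>h. \<bar>h\<bar> ^ j) \<longlongrightarrow> 0) (at (0::real))"
        using assms by (auto intro!: tendsto_eq_intros)
    qed
    then show ?thesis using 3 assms by (simp add: DERIV_def zero_power)
  qed
qed

text \<open>Each differentiation lowers the exponent by 1; starting above the order, it remains
  positive throughout.\<close>

lemma unif_C_pos_part_power:
  fixes u :: "'i \<Rightarrow> 'a::euclidean_space \<Rightarrow> real"
  assumes "unif_C m U u" "m < j"
  shows "unif_C m U (\<lambda>i x. (max 0 (u i x)) ^ j)"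
proof -
  obtain C where C: "C > 0" "\<And>i x. x \<in> U i \<Longrightarrow> norm (u i x) \<le> C" using unif_C_bounded[OF assms(1)] by blast
  have bd: "norm ((max 0 (u i x)) ^ j) \<le> C ^ j" if "x \<in> U i" for i x j
  proof -
    have "max 0 (u i x) \<le> C" using C(1) C(2)[OF that] by auto
    then have "(max 0 (u i x)) ^ j \<le> C ^ j" by (intro power_mono) auto
    then show ?thesis by simp
  qed
  from assms show ?thesis
  proof (induction m arbitrary: j)
    case 0
    then show ?case
      by (intro unif_C_0I[OF _ _ bd] continuous_intros) (auto intro: unif_C_open unif_C_continuous)
  next
    case (Suc m)
    then obtain j' where j: "j = Suc j'" "m < j'" by (cases j) auto
    show ?case unfolding j
    proof (rule unif_C_SucI[OF _ _ _ bd])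
      show "unif_C m U (\<lambda>i x. real (Suc j') * ((max 0 (u i x)) ^ j' * fderiv u i x v))" for v
        by (intro unif_C_mult unif_C_const[where C = "real (Suc j')"] Suc.IH unif_C_Suc_imp[OF Suc.prems(1)] unif_C_SucD[OF Suc.prems(1)] j(2))
           (use unif_C_open[OF Suc.prems(1)] in auto)
      fix i x assume x: "x \<in> U i"
      have 1: "((\<lambda>t. (max 0 t) ^ Suc j') has_derivative (\<lambda>h. h * (real (Suc j') * (max 0 (u i x)) ^ j'))) (at (u i x))"
        using pos_part_power_derivative[of j' "u i x"] j(2) by (simp add: has_field_derivative_def mult.commute[of _ "real (Suc j') * _"] del: of_nat_Suc power_Suc)
      from diff_chain_at[OF unif_C_has_derivative[OF Suc.prems(1) x] 1]
      show "((\<lambda>x. (max 0 (u i x)) ^ Suc j') has_derivative (\<lambda>v. real (Suc j') * ((max 0 (u i x)) ^ j' * fderiv u i x v))) (at x)"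
        by (simp add: o_def mult_ac del: of_nat_Suc power_Suc)
    qed (use unif_C_open[OF Suc.prems(1)] in auto)
  qed
qed

section \<open>Small perturbations\<close>

text \<open>The power \<open>k + 1\<close> makes the truncated paraboloid \<open>C\<^sup>k\<close>. Unlike a plateau function it changes the
  Hessian at \<open>c\<close>, but its gradient is bounded by a multiple of \<open>\<bar>x - c\<bar>\<close>, which is what keeps a
  nondegenerate critical point \<open>c\<close> isolated.\<close>

definition bump :: "nat \<Rightarrow> real \<Rightarrow> real ^ 'n \<Rightarrow> real ^ 'n \<Rightarrow> real" where
  "bump k r c x = (max 0 (1 - (norm (x - c))\<^sup>2 / r\<^sup>2)) ^ Suc k"

lemma bump_centre: "bump k r c c = 1"
  by (simp add: bump_def)

lemma bump_argument_nonpos: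
  assumes "r > 0" "r \<le> norm (x - c)"
  shows "max 0 (1 - (norm (x - c))\<^sup>2 / r\<^sup>2) = 0"
proof -
  have "r\<^sup>2 \<le> (norm (x - c))\<^sup>2" by (rule power_mono) (use assms in auto)
  then show ?thesis using assms(1) by (simp add: field_simps)
qed

lemma bump_outside: "r > 0 \<Longrightarrow> r \<le> norm (x - c) \<Longrightarrow> bump k r c x = 0"
  unfolding bump_def by (subst bump_argument_nonpos) auto

text \<open>The index is the centre of the bump, so one bound serves all centres. The ball of radius
  2 is an open domain that contains the closed unit ball.\<close>

lemma unif_C_bump:
  "unif_C k (\<lambda>c. if c \<in> cball 0 1 then ball 0 2 else {}) (bump k r :: real ^ 'n \<Rightarrow> real ^ 'n \<Rightarrow> real)"
proof -
  let ?U = "\<lambda>c :: real ^ 'n. if c \<in> cball 0 1 then ball 0 2 else {} :: (real ^ 'n) set"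
  have op: "open (?U c)" for c by simp
  have d: "unif_C k ?U (\<lambda>c x. x - c)"
    by (intro unif_C_minus unif_C_bounded_linear[where D = 2] bounded_linear_ident unif_C_const[where C = 1])
       (auto split: if_splits)
  have "unif_C k ?U (\<lambda>c x. 1 - (1 / r\<^sup>2) * ((x - c) \<bullet> (x - c)))"
    by (intro unif_C_minus unif_C_mult unif_C_inner d unif_C_const[where C = 1] unif_C_const[where C = "\<bar>1 / r\<^sup>2\<bar>"]) auto
  from unif_C_pos_part_power[OF this, of "Suc k"] show ?thesis
    by (simp add: bump_def[abs_def] power2_norm_eq_inner)
qed

lemma bump_derivative:
  assumes "k \<ge> 1"
  shows "(bump k r c has_derivative
    (\<lambda>v. - (2 * real (Suc k) / r\<^sup>2) * (max 0 (1 - (norm (x - c))\<^sup>2 / r\<^sup>2)) ^ k * ((x - c) \<bullet> v))) (at x)"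
proof -
  let ?u = "\<lambda>x. 1 - (norm (x - c))\<^sup>2 / r\<^sup>2"
  have 1: "(?u has_derivative (\<lambda>v. - (2 / r\<^sup>2) * ((x - c) \<bullet> v))) (at x)"
  proof -
    have "((\<lambda>x. 1 - q * ((x - c) \<bullet> (x - c))) has_derivative (\<lambda>v. - (q * (2 * ((x - c) \<bullet> v))))) (at x)" for q
      by (auto intro!: derivative_eq_intros simp: inner_commute)
    from this[of "1 / r\<^sup>2"] show ?thesis by (simp add: power2_norm_eq_inner)
  qed
  have 2: "((\<lambda>t. (max 0 t) ^ Suc k) has_derivative (\<lambda>h. h * (real (Suc k) * (max 0 (?u x)) ^ k))) (at (?u x))"
    using pos_part_power_derivative[OF assms, of "?u x"]
    by (simp add: has_field_derivative_def mult.commute[of _ "real (Suc k) * _"] del: of_nat_Suc power_Suc)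
  from diff_chain_at[OF 1 2] show ?thesis
    by (simp add: o_def bump_def[abs_def] mult_ac del: of_nat_Suc power_Suc)
qed

lemma gradient_bump:
  assumes "k \<ge> 1" "x \<in> cball 0 1"
  shows "gradient (cball 0 1) (bump k r c) x
    = (- (2 * real (Suc k) / r\<^sup>2) * (max 0 (1 - (norm (x - c))\<^sup>2 / r\<^sup>2)) ^ k) *\<^sub>R (x - c)"
proof -
  have "frechet_derivative (bump k r c) (at x within cball 0 1) =
    (\<lambda>v. - (2 * real (Suc k) / r\<^sup>2) * (max 0 (1 - (norm (x - c))\<^sup>2 / r\<^sup>2)) ^ k * ((x - c) \<bullet> v))"
    by (rule full_tangent_frechet_derivative[OF full_tangent_cball assms(2) has_derivative_at_withinI[OF bump_derivative[OF assms(1)]]]) simp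
  then show ?thesis by (simp add: gradient_def vec_eq_iff inner_axis)
qed

lemma norm_gradient_bump_le:
  assumes "k \<ge> 1" "x \<in> cball 0 1"
  shows "norm (gradient (cball 0 1) (bump k r c) x) \<le> 2 * real (Suc k) / r\<^sup>2 * norm (x - c)"
proof -
  let ?m = "max 0 (1 - (norm (x - c))\<^sup>2 / r\<^sup>2)"
  have "?m ^ k \<le> 1" by (rule power_le_one) auto
  then have "2 * real (Suc k) / r\<^sup>2 * ?m ^ k \<le> 2 * real (Suc k) / r\<^sup>2 * 1" by (intro mult_left_mono) auto
  then have "2 * real (Suc k) / r\<^sup>2 * ?m ^ k * norm (x - c) \<le> 2 * real (Suc k) / r\<^sup>2 * norm (x - c)"
    by (intro mult_right_mono) auto
  then show ?thesis unfolding gradient_bump[OF assms] by (simp add: abs_mult del: of_nat_Suc)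
qed

lemma gradient_bump_outside:
  assumes "k \<ge> 1" "x \<in> cball 0 1" "r > 0" "r \<le> norm (x - c)"
  shows "gradient (cball 0 1) (bump k r c) x = 0"
  unfolding gradient_bump[OF assms(1,2)] bump_argument_nonpos[OF assms(3,4)] using assms(1) by (simp add: zero_power)

lemma Ck_norm_restrict:
  assumes "full_tangent U" "U \<subseteq> V" "Ck_on k V f" "1 \<le> k" "Ck_norm k V f \<le> ereal M"
  shows "Ck_norm k U f \<le> ereal M"
  unfolding Ck_norm_le_iff[OF assms(4)]
proof (intro allI impI ballI)
  fix vs :: "'a list" and x
  assume *: "1 \<le> length vs" "length vs \<le> k" "\<forall>v\<in>set vs. norm v \<le> 1" "x \<in> U"
  have "norm (nderiv V f vs x) \<le> M"
    using assms(5) * assms(2) unfolding Ck_norm_le_iff[OF assms(4)] by blast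
  then show "norm (nderiv U f vs x) \<le> M"
    using nderiv_restrict[OF assms(1,2,3) *(2,4)] by simp
qed

lemma bump_Ck:
  assumes "k \<ge> 1"
  obtains M where "M > 0" "\<And>c :: real ^ 'n. c \<in> cball 0 1 \<Longrightarrow> Ck_on k (cball 0 1) (bump k r c)"
    "\<And>c :: real ^ 'n. c \<in> cball 0 1 \<Longrightarrow> Ck_norm k (cball 0 1) (bump k r c) \<le> ereal M"
proof -
  obtain M where M: "M > 0" "\<And>c :: real ^ 'n. Ck_norm k (if c \<in> cball 0 1 then ball 0 2 else {}) (bump k r c) \<le> ereal M"
    using unif_C_Ck_norm[OF unif_C_bump assms] by blast
  have sub: "cball 0 1 \<subseteq> ball (0 :: real ^ 'n) 2" by auto
  have full: "full_tangent (cball (0 :: real ^ 'n) 1)" by (rule full_tangent_cball) simp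
  have Ck: "Ck_on k (ball 0 2) (bump k r c)" if "c \<in> cball 0 1" for c :: "real ^ 'n"
    using unif_C_imp_Ck_on[OF unif_C_bump, of k c r] that by simp
  show ?thesis
  proof (rule that[OF M(1) Ck_on_restrict[OF full sub Ck] Ck_norm_restrict[OF full sub Ck assms]])
    show "Ck_norm k (ball 0 2) (bump k r c) \<le> ereal M" if "c \<in> cball 0 1" for c :: "real ^ 'n"
      using M(2)[of c] that by simp
  qed
qed

text \<open>The tilt is a combination of these functions, so \<open>M\<close> controls its C^k
  norm.\<close>

lemma coordinate_Ck:
  assumes "k \<ge> 1"
  obtains M where "M > 0" "\<And>j :: 'n. Ck_on k (cball 0 1) (\<lambda>x :: real ^ 'n. x $ j)"
    "\<And>j :: 'n. Ck_norm k (cball 0 1) (\<lambda>x :: real ^ 'n. x $ j) \<le> ereal M"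
proof -
  have "unif_C k (\<lambda>j :: 'n. ball (0 :: real ^ 'n) 2) (\<lambda>j x. 0 + x $ j)"
  proof (rule unif_C_affine[where C = 1 and D = 2])
    show "norm (0 + x $ j) \<le> 2" if "x \<in> ball 0 2" for x :: "real ^ 'n" and j
      using component_le_norm_cart[of x j] that by simp
  qed (auto simp: bounded_linear_vec_nth component_le_norm_cart)
  then have u: "unif_C k (\<lambda>j :: 'n. ball (0 :: real ^ 'n) 2) (\<lambda>j x. x $ j)" by simp
  obtain M where M: "M > 0" "\<And>j :: 'n. Ck_norm k (ball 0 2) (\<lambda>x :: real ^ 'n. x $ j) \<le> ereal M"
    using unif_C_Ck_norm[OF u assms] by blast
  have sub: "cball 0 1 \<subseteq> ball (0 :: real ^ 'n) 2" by auto
  have full: "full_tangent (cball (0 :: real ^ 'n) 1)" by (rule full_tangent_cball) simp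
  note Ck = unif_C_imp_Ck_on[OF u]
  show ?thesis
    by (rule that[OF M(1) Ck_on_restrict[OF full sub Ck] Ck_norm_restrict[OF full sub Ck assms M(2)]])
qed

section \<open>Norms, gradients and Hessians of sums\<close>

lemma Ck_norm_sum:
  assumes U: "full_tangent U" and k: "1 \<le> k" and S: "finite S"
    and f: "\<And>s. s \<in> S \<Longrightarrow> Ck_on k U (f s)" "\<And>s. s \<in> S \<Longrightarrow> Ck_norm k U (f s) \<le> ereal M"
    and c: "(\<Sum>s\<in>S. \<bar>c s\<bar>) * M \<le> a"
  shows "Ck_norm k U (\<lambda>x. \<Sum>s\<in>S. c s *\<^sub>R f s x) \<le> ereal a"
  unfolding Ck_norm_le_iff[OF k]
proof (intro allI impI ballI)
  fix vs :: "'a list" and x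
  assume *: "1 \<le> length vs" "length vs \<le> k" "\<forall>v\<in>set vs. norm v \<le> 1" "x \<in> U"
  have "nderiv U (\<lambda>x. \<Sum>s\<in>S. c s *\<^sub>R f s x) vs x = (\<Sum>s\<in>S. c s *\<^sub>R nderiv U (f s) vs x)"
    using Ck_on_sum[OF U S, of k f c] f(1) * by blast
  also have "norm \<dots> \<le> (\<Sum>s\<in>S. \<bar>c s\<bar> * M)"
  proof (rule sum_norm_le)
    fix s assume s: "s \<in> S"
    have "norm (nderiv U (f s) vs x) \<le> M" using f(2)[OF s] * unfolding Ck_norm_le_iff[OF k] by blast
    then show "norm (c s *\<^sub>R nderiv U (f s) vs x) \<le> \<bar>c s\<bar> * M" by (simp add: mult_left_mono)
  qed
  finally show "norm (nderiv U (\<lambda>x. \<Sum>s\<in>S. c s *\<^sub>R f s x) vs x) \<le> a"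
    using c by (simp add: sum_distrib_right)
qed

lemma nderiv_add:
  assumes "full_tangent U" "Ck_on k U f" "Ck_on k U g" "length vs \<le> k" "x \<in> U"
  shows "nderiv U (\<lambda>x. f x + g x) vs x = nderiv U f vs x + nderiv U g vs x"
  using nderiv_add_scaleR[OF assms, of 1] by simp

lemma Ck_on_add:
  assumes "full_tangent U" "Ck_on k U f" "Ck_on k U g"
  shows "Ck_on k U (\<lambda>x. f x + g x)"
  using Ck_on_add_scaleR[OF assms, of 1] by simp

lemma Ck_norm_add:
  assumes U: "full_tangent U" and f: "Ck_on k U f" "Ck_norm k U f \<le> ereal a"
    and g: "Ck_on k U g" "Ck_norm k U g \<le> ereal b" and k: "1 \<le> k" and ab: "a + b \<le> c"
  shows "Ck_norm k U (\<lambda>x. f x + g x) \<le> ereal c"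
  unfolding Ck_norm_le_iff[OF k]
proof (intro allI impI ballI)
  fix vs :: "'a list" and x
  assume *: "1 \<le> length vs" "length vs \<le> k" "\<forall>v\<in>set vs. norm v \<le> 1" "x \<in> U"
  have "norm (nderiv U f vs x) \<le> a" "norm (nderiv U g vs x) \<le> b"
    using f(2) g(2) * unfolding Ck_norm_le_iff[OF k] by blast+
  then show "norm (nderiv U (\<lambda>x. f x + g x) vs x) \<le> c"
    unfolding nderiv_add[OF U f(1) g(1) *(2,4)] using ab by (meson add_mono norm_triangle_le order_trans)
qed

lemma gradient_add:
  assumes "full_tangent U" "Ck_on k U f" "Ck_on k U g" "1 \<le> k" "x \<in> U"
  shows "gradient U (\<lambda>x. f x + g x) x = gradient U f x + gradient U g x"
  using nderiv_add[OF assms(1-3) _ assms(5), of "[axis _ 1]"] assms(4)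
  by (simp add: gradient_def vec_eq_iff)

lemma Hessian_add:
  assumes "full_tangent U" "Ck_on k U f" "Ck_on k U g" "2 \<le> k" "x \<in> U"
  shows "Hessian U (\<lambda>x. f x + g x) x = Hessian U f x + Hessian U g x"
  using nderiv_add[OF assms(1-3) _ assms(5), of "[axis _ 1, axis _ 1]"] assms(4)
  by (simp add: Hessian_def vec_eq_iff del: nderiv.simps)

lemma gradient_sum:
  assumes "full_tangent U" "finite S" "\<And>s. s \<in> S \<Longrightarrow> Ck_on k U (f s)" "1 \<le> k" "x \<in> U"
  shows "gradient U (\<lambda>x. \<Sum>s\<in>S. c s *\<^sub>R f s x) x = (\<Sum>s\<in>S. c s *\<^sub>R gradient U (f s) x)"
proof -
  have "nderiv U (\<lambda>x. \<Sum>s\<in>S. c s *\<^sub>R f s x) [v] x = (\<Sum>s\<in>S. c s *\<^sub>R nderiv U (f s) [v] x)" for v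
    using Ck_on_sum[OF assms(1,2), of k f c] assms(3-5) by (simp del: nderiv.simps)
  then show ?thesis by (simp add: gradient_def vec_eq_iff del: nderiv.simps)
qed

lemma norm_Hessian_le:
  fixes f :: "real ^ 'n \<Rightarrow> real"
  assumes U: "full_tangent U" and f: "Ck_on k U f" "2 \<le> k" "Ck_norm k U f \<le> ereal M" and x: "x \<in> U"
  shows "norm (Hessian U f x *v v) \<le> M * norm v"
proof (rule linear_bound_unit_ball[OF matrix_vector_mul_linear[of "Hessian U f x"]])
  have k: "1 \<le> k" using f(2) by simp
  fix v :: "real ^ 'n" assume v: "norm v \<le> 1"
  let ?z = "Hessian U f x *v v"
  have b: "norm (nderiv U f [w, v] x) \<le> M" if "norm w \<le> 1" for w
  proof -
    have "1 \<le> length [w, v]" "length [w, v] \<le> k" "\<forall>u\<in>set [w, v]. norm u \<le> 1" using that v f(2) by auto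
    then show ?thesis using f(3) x unfolding Ck_norm_le_iff[OF k] by blast
  qed
  \<comment> \<open>Testing against \<open>?z\<close> itself recovers its norm from the bound on the
    bilinear form.\<close>
  have "norm ((\<lambda>w. w \<bullet> ?z) ?z) \<le> M * norm ?z"
  proof (rule linear_bound_unit_ball[where \<phi> = "\<lambda>w. w \<bullet> ?z" and v = ?z])
    show "linear (\<lambda>w. w \<bullet> ?z)" by (rule bounded_linear.linear[OF bounded_linear_inner_left])
    show "norm (w \<bullet> ?z) \<le> M" if "norm w \<le> 1" for w
      using b[OF that] nderiv_Hessian[OF U f(1,2) x, of w v] by (simp del: nderiv.simps)
  qed
  then have "norm ?z * norm ?z \<le> M * norm ?z"
    by (simp add: power2_norm_eq_inner[symmetric] power2_eq_square)
  moreover have "0 \<le> M" using b[of 0] norm_ge_zero order_trans by force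
  ultimately show "norm ?z \<le> M" by (cases "?z = 0") auto
qed

text \<open>The points are taken in increasing order of \<open>v\<close> and raised by
  \<open>g\<close> times their rank. This keeps the order and opens gaps of at least
  \<open>g\<close>.\<close>

lemma separate_values:
  fixes v :: "'a \<Rightarrow> real"
  assumes "finite C" "g \<ge> 0"
  shows "\<exists>t. (\<forall>c\<in>C. 0 \<le> t c \<and> t c + g \<le> g * real (card C)) \<and>
    (\<forall>c\<in>C. \<forall>c'\<in>C. c \<noteq> c' \<longrightarrow> g \<le> \<bar>(v c + t c) - (v c' + t c')\<bar>)"
  using assms(1)
proof (induction C rule: finite_ranking_induct[where f = v])
  case empty
  show ?case by simp
next
  case (insert x S)
  show ?case
  proof (cases "x \<in> S")
    case True
    then show ?thesis using insert.IH by (simp add: insert_absorb)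
  next
    case False
    from insert.IH obtain t where t1: "\<forall>c\<in>S. 0 \<le> t c \<and> t c + g \<le> g * real (card S)"
      and t2: "\<forall>c\<in>S. \<forall>c'\<in>S. c \<noteq> c' \<longrightarrow> g \<le> \<bar>(v c + t c) - (v c' + t c')\<bar>"
      by (elim exE conjE)
    have t: "0 \<le> t c \<and> t c + g \<le> g * real (card S)" if "c \<in> S" for c using t1 that by simp
    have tt: "g \<le> \<bar>(v c + t c) - (v c' + t c')\<bar>" if "c \<in> S" "c' \<in> S" "c \<noteq> c'" for c c'
      using t2 that by simp
    define s where "s = t(x := g * real (card S))"
    have s: "s x = g * real (card S)" "\<And>c. c \<in> S \<Longrightarrow> s c = t c" using False by (auto simp: s_def)
    have card: "real (card (insert x S)) = real (card S) + 1" using False insert.hyps(1) by simp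
    have gap: "g \<le> (v x + s x) - (v c + s c)" if "c \<in> S" for c
      using insert.hyps(2)[OF that] t[OF that] s that by simp
    show ?thesis
    proof (intro exI[of _ s] conjI ballI impI)
      fix c assume c: "c \<in> insert x S"
      show "0 \<le> s c" using c s t assms(2) by auto
      show "s c + g \<le> g * real (card (insert x S))"
      proof (cases "c = x")
        case True
        then show ?thesis unfolding card by (simp add: s distrib_left)
      next
        case False
        then have "c \<in> S" using c by simp
        then show ?thesis unfolding card using t[of c] s(2)[of c] assms(2) by (simp add: distrib_left)
      qed
      fix c' assume c': "c' \<in> insert x S" "c \<noteq> c'"
      consider "c = x" "c' \<in> S" | "c' = x" "c \<in> S" | "c \<in> S" "c' \<in> S" using c c' by auto
      then show "g \<le> \<bar>(v c + s c) - (v c' + s c')\<bar>"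
      proof cases
        case 1
        then show ?thesis unfolding 1(1) using gap[OF 1(2)] by linarith
      next
        case 2
        then show ?thesis unfolding 2(1) using gap[OF 2(2)] by linarith
      next
        case 3
        then show ?thesis using tt[OF 3 c'(2)] s(2)[OF 3(1)] s(2)[OF 3(2)] by simp
      qed
    qed
  qed
qed

text \<open>The linear function x -> -(a . x), written as a combination of coordinate functions so
  that \<open>Ck_norm_sum\<close> applies. It shifts the gradient by -a and leaves the Hessian
  alone.\<close>

lemma tilt_Ck:
  fixes a :: "real ^ 'n"
  assumes k: "k \<ge> 2"
  defines "t \<equiv> (\<lambda>x :: real ^ 'n. \<Sum>j\<in>UNIV. (- a $ j) *\<^sub>R x $ j)"
  shows "Ck_on k (cball 0 1) t" "x \<in> cball 0 1 \<Longrightarrow> gradient (cball 0 1) t x = - a"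
    "x \<in> cball 0 1 \<Longrightarrow> Hessian (cball 0 1) t x = 0"
proof -
  have k1: "k \<ge> 1" using k by simp
  have full: "full_tangent (cball (0 :: real ^ 'n) 1)" by (rule full_tangent_cball) simp
  obtain M where "\<And>j :: 'n. Ck_on k (cball 0 1) (\<lambda>x :: real ^ 'n. x $ j)"
    by (rule coordinate_Ck[OF k1]) blast
  then show "Ck_on k (cball 0 1) t"
    unfolding t_def using Ck_on_sum[OF full, of UNIV k "\<lambda>j x. x $ j" "\<lambda>j. - a $ j"] by simp
  have d: "nderiv (cball 0 1) t [v] y = - (a \<bullet> v)" if "y \<in> cball 0 1" for v y
  proof -
    have "(t has_derivative (\<lambda>v. - (a \<bullet> v))) (at y)"
    proof -
      have "t = (\<lambda>x. - (a \<bullet> x))" by (simp add: t_def inner_vec_def sum_negf fun_eq_iff)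
      then show ?thesis by (auto intro!: derivative_eq_intros)
    qed
    from full_tangent_frechet_derivative[OF full that has_derivative_at_withinI[OF this]] show ?thesis by simp
  qed
  show "gradient (cball 0 1) t x = - a" if "x \<in> cball 0 1"
    using d[OF that] by (simp add: gradient_def vec_eq_iff inner_axis del: nderiv.simps)
  have "nderiv (cball 0 1) t [w, v] x = 0" if x: "x \<in> cball 0 1" for w v
  proof -
    have "(nderiv (cball 0 1) t [v] has_derivative (\<lambda>_. 0)) (at x within cball 0 1)"
      by (rule has_derivative_transform[OF x _ has_derivative_const[of "- (a \<bullet> v)"]]) (rule d)
    from full_tangent_frechet_derivative[OF full x this] show ?thesis by simp
  qed
  then show "Hessian (cball 0 1) t x = 0" if "x \<in> cball 0 1"
    using that by (simp add: Hessian_def vec_eq_iff del: nderiv.simps)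
qed

section \<open>Assembling the constants\<close>

definition tame_critical_points :: "real \<Rightarrow> real \<Rightarrow> real \<Rightarrow> nat \<Rightarrow> (real ^ 'n \<Rightarrow> real) \<Rightarrow> bool" where
  "tame_critical_points \<theta> \<psi> d N f \<longleftrightarrow> nondegenerate \<theta> f \<and> finite (critical_points (cball 0 1) f) \<and>
    card (critical_points (cball 0 1) f) \<le> N \<and>
    (\<forall>x\<in>critical_points (cball 0 1) f. \<forall>y\<in>critical_points (cball 0 1) f. x \<noteq> y \<longrightarrow>
      d \<le> norm (x - y) \<and> \<psi> \<le> \<bar>f x - f y\<bar>)"

lemma tame_perturbation:
  fixes k :: nat and K \<epsilon> :: real
  assumes k: "k \<ge> 3" and K: "K \<ge> 0" and \<epsilon>: "\<epsilon> > 0"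
  shows "\<exists>\<theta> \<psi> d N. 0 < \<theta> \<and> \<theta> \<le> 1 \<and> 0 < \<psi> \<and> 0 < d \<and>
    (\<forall>f0 :: real ^ 'n \<Rightarrow> real. Ck_on k (cball 0 1) f0 \<and> Ck_norm k (cball 0 1) f0 \<le> ereal K \<longrightarrow>
      (\<exists>h. Ck_on k (cball 0 1) h \<and> Ck_norm k (cball 0 1) h \<le> ereal \<epsilon> \<and>
        tame_critical_points \<theta> \<psi> d N (\<lambda>x. f0 x + h x)))"
proof -
  let ?B = "cball (0 :: real ^ 'n) 1"
  have full: "full_tangent ?B" by (rule full_tangent_cball) simp
  have k1: "1 \<le> k" and k2: "2 \<le> k" using k by auto
  define n where "n = real CARD('n)"
  have n: "n \<ge> 1" by (simp add: n_def Suc_le_eq)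
  obtain M1 where M1: "M1 > 0" "\<And>j :: 'n. Ck_on k ?B (\<lambda>x. x $ j)" "\<And>j :: 'n. Ck_norm k ?B (\<lambda>x. x $ j) \<le> ereal M1"
    by (rule coordinate_Ck[OF k1]) blast
  \<comment> \<open>Half of \<open>\<epsilon>\<close> is spent on the tilt, whose norm is at most
    \<open>n * \<alpha> * M1\<close>; the other half is for the bumps.\<close>
  define \<alpha> where "\<alpha> = \<epsilon> / (2 * n * M1)"
  have \<alpha>: "\<alpha> > 0" using \<epsilon> n M1(1) by (simp add: \<alpha>_def)
  have nK: "n * K \<ge> 0" using n K by simp
  obtain \<theta> where \<theta>: "\<theta> > 0" "\<theta> \<le> 1" and sard: "\<forall>(G :: real ^ 'n \<Rightarrow> real ^ 'n) H D.
    (\<forall>x\<in>?B. \<forall>y\<in>?B. norm (G y - G x) \<le> (n * K) * norm (y - x)) \<and>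
    (\<forall>x\<in>?B. \<forall>y\<in>?B. norm (G y - G x - D x (y - x)) \<le> (n * K) * (norm (y - x))\<^sup>2) \<and>
    (\<forall>x\<in>?B. \<forall>v w. w \<bullet> D x v = v \<bullet> (H x *v w)) \<longrightarrow>
    (\<exists>a. norm a \<le> \<alpha> \<and> (\<forall>x\<in>?B. norm (G x - a) \<le> \<theta> \<longrightarrow>
       (\<forall>v. \<theta> * norm v \<le> norm (H x *v v)) \<and> norm x \<le> 1 - \<theta>))"
    using quantitative_sard[OF nK \<alpha>, where 'n = 'n] by (elim exE conjE)
  define K1 where "K1 = K + \<epsilon>"
  have K1: "K1 > 0" using K \<epsilon> by (simp add: K1_def)
  define L where "L = n * K1"
  have L: "L > 0" using n K1 by (simp add: L_def)
  \<comment> \<open>The radius of the bumps. By \<open>Lr\<close> the Hessian of \<open>f1\<close>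
    varies by at most \<open>\<theta> / 4\<close> over a bump, and bumps at different critical
    points are disjoint (\<open>d2r\<close>). The bound \<open>\<theta> / 2\<close> keeps them off
    the sphere.\<close>
  define r where "r = min (\<theta> / 2) (\<theta> / (4 * L))"
  have r: "r > 0" "r \<le> \<theta> / 2" "r \<le> \<theta> / (4 * L)" using \<theta> L by (auto simp: r_def)
  have Lr: "L * r \<le> \<theta> / 4" using mult_left_mono[OF r(3), of L] L by simp
  \<comment> \<open>The separation that \<open>critical_points_separated\<close> provides.\<close>
  define d where "d = \<theta> / L"
  have d: "d > 0" using \<theta> L by (simp add: d_def)
  have d2r: "2 * r \<le> d" using Lr L \<theta>(1) by (simp add: d_def field_simps)
  obtain Nm where Nm: "\<And>C :: (real ^ 'n) set. C \<subseteq> ?B \<Longrightarrow> (\<And>x y. x \<in> C \<Longrightarrow> y \<in> C \<Longrightarrow> x \<noteq> y \<Longrightarrow> d \<le> norm (x - y)) \<Longrightarrow>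
    finite C \<and> card C \<le> Nm"
    by (rule separated_finite[OF d]) blast
  \<comment> \<open>The summand 1 keeps the divisors below positive when \<open>Nm\<close> is
    0.\<close>
  define N1 where "N1 = real Nm + 1"
  have N1: "N1 > 0" by (simp add: N1_def)
  obtain Mb where Mb: "Mb > 0" "\<And>c :: real ^ 'n. c \<in> ?B \<Longrightarrow> Ck_on k ?B (bump k r c)"
    "\<And>c :: real ^ 'n. c \<in> ?B \<Longrightarrow> Ck_norm k ?B (bump k r c) \<le> ereal Mb"
    by (rule bump_Ck[OF k1]) blast
  define Cb where "Cb = 2 * real (Suc k) / r\<^sup>2"
  have Cb: "Cb > 0" using r by (simp add: Cb_def)
  \<comment> \<open>The maximal height of a bump. The three bounds control the C^k norm of the sum
    of all bumps, the Hessian of that sum, and the gradient of a single bump relative to |x -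
    c|.\<close>
  define \<tau> where "\<tau> = min (\<epsilon> / (2 * N1 * Mb)) (min (\<theta> / (4 * N1 * Mb)) (\<theta> / (4 * Cb)))"
  have \<tau>: "\<tau> > 0" using \<epsilon> \<theta> N1 Mb Cb by (simp add: \<tau>_def)
  have \<tau>\<epsilon>: "N1 * \<tau> * Mb \<le> \<epsilon> / 2"
  proof -
    have "\<tau> \<le> \<epsilon> / (2 * N1 * Mb)" by (simp add: \<tau>_def)
    then show ?thesis using N1 Mb(1) by (simp add: field_simps)
  qed
  have \<tau>\<theta>: "N1 * \<tau> * Mb \<le> \<theta> / 4"
  proof -
    have "\<tau> \<le> \<theta> / (4 * N1 * Mb)" by (simp add: \<tau>_def)
    then show ?thesis using N1 Mb(1) by (simp add: field_simps)
  qed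
  have \<tau>C: "\<tau> * Cb \<le> \<theta> / 4"
  proof -
    have "\<tau> \<le> \<theta> / (4 * Cb)" by (simp add: \<tau>_def)
    then show ?thesis using Cb by (simp add: field_simps)
  qed
  \<comment> \<open>At most \<open>Nm\<close> shifts in steps of \<open>g\<close> do not exceed
    \<open>\<tau>\<close>.\<close>
  define g where "g = \<tau> / N1"
  have g: "g > 0" using \<tau> N1 by (simp add: g_def)
  \<comment> \<open>The second bound is the hypothesis of \<open>near_critical_point\<close> for
    radius \<open>r / 2\<close>, used in \<open>close\<close> to exclude small gradients away from
    the bumps.\<close>
  define \<theta>' where "\<theta>' = min (\<theta> / 2) (\<theta> * r / 4)"
  have \<theta>': "\<theta>' > 0" "\<theta>' \<le> \<theta> / 2" "\<theta>' \<le> \<theta> * r / 4" using \<theta> r by (auto simp: \<theta>'_def)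
  have "\<exists>h. Ck_on k ?B h \<and> Ck_norm k ?B h \<le> ereal \<epsilon> \<and> tame_critical_points \<theta>' g d Nm (\<lambda>x. f0 x + h x)"
    if f0: "Ck_on k ?B f0" "Ck_norm k ?B f0 \<le> ereal K" for f0 :: "real ^ 'n \<Rightarrow> real"
  proof -
    have "\<exists>a. norm a \<le> \<alpha> \<and> (\<forall>x\<in>?B. norm (gradient ?B f0 x - a) \<le> \<theta> \<longrightarrow>
       (\<forall>v. \<theta> * norm v \<le> norm (Hessian ?B f0 x *v v)) \<and> norm x \<le> 1 - \<theta>)"
    proof (rule sard[rule_format, where D = "gradient_deriv ?B f0"], intro conjI ballI allI)
      fix x y :: "real ^ 'n" assume xy: "x \<in> ?B" "y \<in> ?B"
      show "norm (gradient ?B f0 y - gradient ?B f0 x) \<le> n * K * norm (y - x)"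
        by (rule gradient_lipschitz[OF full convex_cball f0(1) k f0(2) K _ xy]) (simp add: n_def)
      have "norm (gradient ?B f0 y - gradient ?B f0 x - gradient_deriv ?B f0 x (y - x)) \<le> n * K * norm (y - x) * norm (y - x)"
        by (rule gradient_taylor[OF full convex_cball f0(1) k f0(2) K _ xy(1) xy(2) xy(1)]) (auto simp: n_def)
      then show "norm (gradient ?B f0 y - gradient ?B f0 x - gradient_deriv ?B f0 x (y - x)) \<le> n * K * (norm (y - x))\<^sup>2"
        by (simp add: power2_eq_square)
    qed (rule inner_gradient_deriv[OF full f0(1) k2])
    then obtain a where a: "norm a \<le> \<alpha>" and and_a: "\<And>x. x \<in> ?B \<Longrightarrow> norm (gradient ?B f0 x - a) \<le> \<theta> \<Longrightarrow>
       (\<forall>v. \<theta> * norm v \<le> norm (Hessian ?B f0 x *v v)) \<and> norm x \<le> 1 - \<theta>" by blast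
    define p where "p = (\<lambda>x :: real ^ 'n. \<Sum>j\<in>UNIV. (- a $ j) *\<^sub>R x $ j)"
    note tilt = tilt_Ck[OF k2, where a = a, folded p_def]
    have pn: "Ck_norm k ?B p \<le> ereal (\<epsilon> / 2)"
      unfolding p_def
    proof (rule Ck_norm_sum[OF full k1 finite M1(2,3)])
      have "(\<Sum>j\<in>UNIV. \<bar>- a $ j\<bar>) \<le> (\<Sum>j\<in>(UNIV :: 'n set). \<alpha>)"
        using component_le_norm_cart[of a] a by (intro sum_mono) (smt (verit) abs_minus)
      then have "(\<Sum>j\<in>UNIV. \<bar>- a $ j\<bar>) \<le> n * \<alpha>" by (simp add: n_def)
      then have "(\<Sum>j\<in>UNIV. \<bar>- a $ j\<bar>) * M1 \<le> n * \<alpha> * M1" using M1(1) by (intro mult_right_mono) auto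
      also have "\<dots> = \<epsilon> / 2" using n M1(1) by (simp add: \<alpha>_def)
      finally show "(\<Sum>j\<in>UNIV. \<bar>- a $ j\<bar>) * M1 \<le> \<epsilon> / 2" .
    qed
    define f1 where "f1 = (\<lambda>x. f0 x + p x)"
    have f1: "Ck_on k ?B f1" unfolding f1_def by (rule Ck_on_add[OF full f0(1) tilt(1)])
    have f1n: "Ck_norm k ?B f1 \<le> ereal K1" unfolding f1_def
      by (rule Ck_norm_add[OF full f0 tilt(1) pn k1]) (use \<epsilon> in \<open>simp add: K1_def\<close>)
    have g1: "gradient ?B f1 x = gradient ?B f0 x - a" if "x \<in> ?B" for x
      unfolding f1_def gradient_add[OF full f0(1) tilt(1) k1 that] tilt(2)[OF that] by simp
    have H1: "Hessian ?B f1 x = Hessian ?B f0 x" if "x \<in> ?B" for x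
      unfolding f1_def Hessian_add[OF full f0(1) tilt(1) k2 that] tilt(3)[OF that] by simp
    have nd1: "nondegenerate \<theta> f1"
      unfolding nondegenerate_def using and_a g1 H1 by metis
    define C where "C = critical_points ?B f1"
    have memC: "x \<in> C \<longleftrightarrow> x \<in> ?B \<and> gradient ?B f1 x = 0" for x
      unfolding C_def by (rule critical_points_iff_gradient[OF f1 k1])
    have K1': "K1 \<ge> 0" using K1 by simp
    note sep = critical_points_separated[OF nd1 \<theta>(1) f1 k f1n K1', folded n_def C_def L_def]
    have sepd: "d \<le> norm (x - y)" if "x \<in> C" "y \<in> C" "x \<noteq> y" for x y
      using sep(2)[OF that] L by (simp add: d_def field_simps)
    have finC: "finite C" "card C \<le> Nm" using Nm[of C] sepd memC by blast+
    obtain t where t: "\<And>c. c \<in> C \<Longrightarrow> 0 \<le> t c \<and> t c + g \<le> g * real (card C)"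
      and tsep: "\<And>c c'. c \<in> C \<Longrightarrow> c' \<in> C \<Longrightarrow> c \<noteq> c' \<Longrightarrow> g \<le> \<bar>(f1 c + t c) - (f1 c' + t c')\<bar>"
      using separate_values[OF finC(1) less_imp_le[OF g], of f1] by metis
    have t\<tau>: "t c \<le> \<tau>" if "c \<in> C" for c
    proof -
      have "t c \<le> g * real (card C)" using t[OF that] g by linarith
      also have "\<dots> \<le> g * N1" using finC(2) g by (intro mult_left_mono) (auto simp: N1_def)
      finally show ?thesis using N1 by (simp add: g_def)
    qed
    have CB: "c \<in> ?B" if "c \<in> C" for c using memC that by blast
    have Cin: "norm c \<le> 1 - \<theta>" "\<theta> * norm v \<le> norm (Hessian ?B f1 c *v v)" if "c \<in> C" for c v
      using nondegenerateD[OF nd1 \<theta>(1) f1 k2 CB[OF that]] memC[of c] that \<theta>(1) by auto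
    define b where "b = (\<lambda>x. \<Sum>c\<in>C. t c *\<^sub>R bump k r c x)"
    have b: "Ck_on k ?B b"
      unfolding b_def using Ck_on_sum[OF full finC(1), of k "bump k r" t] Mb(2) CB by blast
    have sumt: "(\<Sum>c\<in>C. \<bar>t c\<bar>) * Mb \<le> N1 * \<tau> * Mb"
    proof -
      have "(\<Sum>c\<in>C. \<bar>t c\<bar>) \<le> (\<Sum>c\<in>C. \<tau>)" using t t\<tau> by (intro sum_mono) auto
      also have "\<dots> = real (card C) * \<tau>" by simp
      also have "\<dots> \<le> N1 * \<tau>" using finC(2) \<tau> by (intro mult_right_mono) (auto simp: N1_def)
      finally show ?thesis using Mb(1) by (intro mult_right_mono) auto
    qed
    have bn: "Ck_norm k ?B b \<le> ereal (N1 * \<tau> * Mb)"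
      unfolding b_def by (rule Ck_norm_sum[OF full k1 finC(1) Mb(2,3) sumt]) (use CB in auto)
    define h where "h = (\<lambda>x. p x + b x)"
    have h: "Ck_on k ?B h" unfolding h_def by (rule Ck_on_add[OF full tilt(1) b])
    have hn: "Ck_norm k ?B h \<le> ereal \<epsilon>" unfolding h_def
      by (rule Ck_norm_add[OF full tilt(1) pn b bn k1]) (use \<tau>\<epsilon> in simp)
    define f where "f = (\<lambda>x. f0 x + h x)"
    have ff: "f = (\<lambda>x. f1 x + b x)" by (simp add: f_def f1_def h_def add.assoc)
    have f: "Ck_on k ?B f" unfolding ff by (rule Ck_on_add[OF full f1 b])
    have gf: "gradient ?B f x = gradient ?B f1 x + (\<Sum>c\<in>C. t c *\<^sub>R gradient ?B (bump k r c) x)" if "x \<in> ?B" for x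
    proof -
      have "gradient ?B b x = (\<Sum>c\<in>C. t c *\<^sub>R gradient ?B (bump k r c) x)"
        unfolding b_def by (rule gradient_sum[OF full finC(1) Mb(2) k1 that]) (rule CB)
      then show ?thesis unfolding ff gradient_add[OF full f1 b k1 that] by simp
    qed
    have away: "gradient ?B f x = gradient ?B f1 x" if x: "x \<in> ?B" and far: "\<And>c. c \<in> C \<Longrightarrow> r \<le> norm (x - c)" for x
      unfolding gf[OF x] using gradient_bump_outside[OF k1 x r(1) far] by simp
    have other: "r \<le> norm (x - c')" if c: "c \<in> C" "c' \<in> C" "c' \<noteq> c" and x: "norm (x - c) < r" for x c c'
      using sepd[OF c(2,1,3)] x d2r norm_triangle_ineq[of "c' - x" "x - c"] by (simp add: norm_minus_commute)
    have near: "gradient ?B f x = gradient ?B f1 x + t c *\<^sub>R gradient ?B (bump k r c) x"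
      if x: "x \<in> ?B" and c: "c \<in> C" "norm (x - c) < r" for x c
    proof -
      have "(\<Sum>c\<in>C. t c *\<^sub>R gradient ?B (bump k r c) x) = (\<Sum>c\<in>{c}. t c *\<^sub>R gradient ?B (bump k r c) x)"
        by (rule sum.mono_neutral_right)
           (use finC c gradient_bump_outside[OF k1 x r(1) other[OF c(1) _ _ c(2)]] in auto)
      then show ?thesis unfolding gf[OF x] by simp
    qed
    \<comment> \<open>On a bump the gradient of \<open>f1\<close> has size at least 3/4 theta |x -
      c|, and that of the scaled bump at most 1/4 theta |x - c|. So \<open>c\<close> remains the
      only zero there.\<close>
    have near_low: "\<theta> / 2 * norm (x - c) \<le> norm (gradient ?B f x)"
      if x: "x \<in> ?B" and c: "c \<in> C" "norm (x - c) < r" for x c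
    proof -
      have "L * norm (x - c) \<le> \<theta> / 4" using mult_left_mono[OF less_imp_le[OF c(2)], of L] L Lr by linarith
      then have "3 / 4 * \<theta> * norm (x - c) \<le> (\<theta> - L * norm (x - c)) * norm (x - c)"
        by (intro mult_right_mono) auto
      also have "\<dots> \<le> norm (gradient ?B f1 x)" by (rule sep(1)[OF c(1) x])
      finally have 1: "3 / 4 * \<theta> * norm (x - c) \<le> norm (gradient ?B f1 x)" .
      have "norm (t c *\<^sub>R gradient ?B (bump k r c) x) \<le> \<tau> * (Cb * norm (x - c))"
        using t[OF c(1)] t\<tau>[OF c(1)] norm_gradient_bump_le[OF k1 x, of r c] unfolding norm_scaleR Cb_def
        by (intro mult_mono) auto
      also have "\<dots> \<le> \<theta> / 4 * norm (x - c)" using mult_right_mono[OF \<tau>C norm_ge_zero[of "x - c"]] by (simp add: mult.assoc)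
      finally have 2: "norm (t c *\<^sub>R gradient ?B (bump k r c) x) \<le> \<theta> / 4 * norm (x - c)" .
      have "norm (gradient ?B f1 x) - norm (t c *\<^sub>R gradient ?B (bump k r c) x) \<le> norm (gradient ?B f x)"
        unfolding near[OF x c] using norm_diff_ineq[of "gradient ?B f1 x" "t c *\<^sub>R gradient ?B (bump k r c) x"] by simp
      with 1 2 show ?thesis by simp
    qed
    \<comment> \<open>Away from the bumps \<open>f\<close> and \<open>f1\<close> have the same
      gradient, and a small one would put a critical point of \<open>f1\<close> within
      \<open>r / 2\<close>.\<close>
    have close: "\<exists>c\<in>C. norm (x - c) < r" if x: "x \<in> ?B" "norm (gradient ?B f x) \<le> \<theta>'" for x
    proof (rule ccontr)
      assume "\<not> ?thesis"
      then have "r \<le> norm (x - c)" if "c \<in> C" for c using that by force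
      note far = this
      have gx: "norm (gradient ?B f1 x) \<le> \<theta>'" using away[OF x(1) far] x(2) by simp
      have r2: "0 < r / 2" "r / 2 \<le> \<theta>" "real CARD('n) * K1 * (r / 2) \<le> \<theta> / 2"
        using r \<theta>(1) Lr unfolding L_def n_def by auto
      obtain x' where "x' \<in> C" "dist x x' \<le> r / 2"
        by (rule near_critical_point[OF nd1 \<theta>(1) f1 k f1n K1' r2 x(1)])
           (use gx \<theta>' \<theta>(1) in \<open>auto simp: C_def\<close>)
      then show False using far[of x'] r(1) by (simp add: dist_norm)
    qed
    have ndf: "nondegenerate \<theta>' f"
      unfolding nondegenerate_def
    proof (intro ballI impI conjI allI)
      fix x assume x: "x \<in> ?B" "norm (gradient ?B f x) \<le> \<theta>'"
      obtain c where c: "c \<in> C" "norm (x - c) < r" using close[OF x] by blast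
      have "norm x \<le> norm c + norm (x - c)" using norm_triangle_ineq[of c "x - c"] by simp
      then show "norm x \<le> 1 - \<theta>'" using Cin(1)[OF c(1)] c(2) r(2) \<theta>'(2) by linarith
      fix v
      have H: "Hessian ?B f x *v v = Hessian ?B f1 x *v v + Hessian ?B b x *v v"
        unfolding ff Hessian_add[OF full f1 b k2 x(1)] by (simp add: matrix_vector_mult_add_rdistrib)
      have "norm (Hessian ?B b x *v v) \<le> N1 * \<tau> * Mb * norm v" by (rule norm_Hessian_le[OF full b k2 bn x(1)])
      also have "\<dots> \<le> \<theta> / 4 * norm v" using \<tau>\<theta> by (intro mult_right_mono) auto
      finally have 1: "norm (Hessian ?B b x *v v) \<le> \<theta> / 4 * norm v" .
      have "norm (Hessian ?B f1 x *v v - Hessian ?B f1 c *v v) \<le> L * norm (x - c) * norm v"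
        by (rule Hessian_lipschitz[OF full convex_cball f1 k f1n K1' _ CB[OF c(1)] x(1)]) (simp add: L_def n_def)
      also have "\<dots> \<le> \<theta> / 4 * norm v"
      proof -
        have "L * norm (x - c) \<le> \<theta> / 4" using mult_left_mono[OF less_imp_le[OF c(2)], of L] L Lr by linarith
        then show ?thesis by (intro mult_right_mono) auto
      qed
      finally have 2: "norm (Hessian ?B f1 x *v v - Hessian ?B f1 c *v v) \<le> \<theta> / 4 * norm v" .
      \<comment> \<open>Of \<open>\<theta>\<close>, one quarter is lost in moving from
        \<open>c\<close> to \<open>x\<close> and another to the bumps; half remains.\<close>
      have "\<theta> * norm v \<le> norm (Hessian ?B f1 c *v v)" by (rule Cin(2)[OF c(1)])
      moreover have "norm (Hessian ?B f1 c *v v) \<le> norm (Hessian ?B f x *v v)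
          + norm (Hessian ?B b x *v v) + norm (Hessian ?B f1 x *v v - Hessian ?B f1 c *v v)"
      proof -
        have e: "Hessian ?B f1 c *v v = (Hessian ?B f x *v v - Hessian ?B b x *v v) - (Hessian ?B f1 x *v v - Hessian ?B f1 c *v v)"
          unfolding H by simp
        show ?thesis
          using arg_cong[OF e, of norm] norm_triangle_ineq4[of "Hessian ?B f x *v v - Hessian ?B b x *v v" "Hessian ?B f1 x *v v - Hessian ?B f1 c *v v"]
            norm_triangle_ineq4[of "Hessian ?B f x *v v" "Hessian ?B b x *v v"] by linarith
      qed
      ultimately have "\<theta> / 2 * norm v \<le> norm (Hessian ?B f x *v v)" using 1 2 by simp
      moreover have "\<theta>' * norm v \<le> \<theta> / 2 * norm v" using \<theta>'(2) by (intro mult_right_mono) auto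
      ultimately show "\<theta>' * norm v \<le> norm (Hessian ?B f x *v v)" by linarith
    qed
    \<comment> \<open>The bumps leave the critical set unchanged, so the separation and the count
      carry over from \<open>f1\<close>.\<close>
    have crit: "critical_points ?B f = C"
    proof (intro equalityI subsetI)
      fix x assume "x \<in> critical_points ?B f"
      then have x: "x \<in> ?B" "gradient ?B f x = 0" using critical_points_iff_gradient[OF f k1] by auto
      then obtain c where c: "c \<in> C" "norm (x - c) < r" using close[of x] \<theta>'(1) by auto
      have "\<theta> / 2 * norm (x - c) \<le> 0" using near_low[OF x(1) c] x(2) by simp
      then have "norm (x - c) \<le> 0" using \<theta>(1) by (simp add: mult_le_0_iff)
      then show "x \<in> C" using c(1) by simp
    next
      fix c assume c: "c \<in> C"
      have "gradient ?B (bump k r c) c = 0"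
        using norm_gradient_bump_le[OF k1 CB[OF c], of r c] by simp
      then have "gradient ?B f c = 0" using near[OF CB[OF c] c] r(1) memC[of c] c by simp
      then show "c \<in> critical_points ?B f" using critical_points_iff_gradient[OF f k1] CB[OF c] by simp
    qed
    \<comment> \<open>At a critical point only its own bump is nonzero, with value 1, so the
      prescribed shifts are realized exactly.\<close>
    have val: "f c = f1 c + t c" if c: "c \<in> C" for c
    proof -
      have "(\<Sum>c'\<in>C. t c' *\<^sub>R bump k r c' c) = (\<Sum>c'\<in>{c}. t c' *\<^sub>R bump k r c' c)"
        by (rule sum.mono_neutral_right) (use finC c bump_outside[OF r(1) other[OF c]] r(1) in auto)
      then show ?thesis by (simp add: ff b_def bump_centre)
    qed
    have "d \<le> norm (x - y) \<and> g \<le> \<bar>f x - f y\<bar>" if "x \<in> C" "y \<in> C" "x \<noteq> y" for x y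
      using that sepd tsep[of x y] val[of x] val[of y] by auto
    then have "tame_critical_points \<theta>' g d Nm f"
      unfolding tame_critical_points_def crit using ndf finC by blast
    then show ?thesis using h hn unfolding f_def by blast
  qed
  then show ?thesis
    using \<theta>' \<theta> g d by (intro exI[of _ \<theta>'] exI[of _ g] exI[of _ d] exI[of _ Nm]) auto
qed

section \<open>The constants of the theorem\<close>

lemma sigma_min_ge:
  fixes A :: "real ^ 'n ^ 'n"
  assumes "\<And>v. \<theta> * norm v \<le> norm (A *v v)"
  shows "\<theta> \<le> sigma_min A"
  unfolding sigma_min_def
proof (rule cINF_greatest)
  show "sphere (0 :: real ^ 'n) 1 \<noteq> {}" by simp
  show "\<theta> \<le> norm (A *v x)" if "x \<in> sphere 0 1" for x using assms[of x] that by simp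
qed

text \<open>Conditions (i) to (v) with plain real constants, so that a single use of choice turns
  these into functions of K and epsilon.\<close>

definition quantitative_morse ::
  "nat \<Rightarrow> (nat \<Rightarrow> 'n) \<Rightarrow> (real ^ 'n \<Rightarrow> real) \<Rightarrow> real \<Rightarrow> real \<Rightarrow> real \<Rightarrow> real \<Rightarrow> real \<Rightarrow> real \<Rightarrow> real \<Rightarrow> bool" where
  "quantitative_morse k e f \<psi>\<^sub>1 \<psi>\<^sub>2 \<delta> d M N \<eta> \<longleftrightarrow> (let B = cball 0 1; C = critical_points B f in
    (\<forall>x\<in>C. sigma_min (Hessian B f x) \<ge> \<psi>\<^sub>1) \<and>
    (\<forall>x\<in>C. \<forall>x'\<in>C. x \<noteq> x' \<longrightarrow> norm (x - x') \<ge> d) \<and>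
    finite C \<and> real (card C) \<le> N \<and>
    (\<forall>x\<in>C. \<forall>x'\<in>C. x \<noteq> x' \<longrightarrow> \<bar>f x - f x'\<bar> \<ge> \<psi>\<^sub>2) \<and>
    (\<forall>x\<in>C. ball x \<delta> \<subseteq> B \<and>
      (\<exists>(\<phi> :: real ^ 'n \<Rightarrow> real ^ 'n) l c. l \<le> CARD('n) \<and>
        Ck_diffeo_onto_image (k - 1) (ball x \<delta>) \<phi> \<and>
        Ck_norm (k - 1) (ball x \<delta>) \<phi> \<le> ereal M \<and>
        (\<forall>y\<in>\<phi> ` ball x \<delta>. (f \<circ> inv_into (ball x \<delta>) \<phi>) y = morse_form e l y + c))) \<and>
    (\<forall>x\<in>B. onorm (frechet_derivative f (at x within B)) \<le> \<eta> \<longrightarrow> (\<exists>x'\<in>C. x \<in> ball x' \<delta>)))"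

lemma quantitative_morse_constants:
  fixes k :: nat and e :: "nat \<Rightarrow> 'n::finite" and K \<epsilon> :: real
  assumes k: "k \<ge> 3" and e: "bij_betw e {1..CARD('n)} UNIV" and K: "K \<ge> 0" and \<epsilon>: "\<epsilon> > 0"
  shows "\<exists>\<psi>\<^sub>1 \<psi>\<^sub>2 \<psi>\<^sub>3 d M N \<eta>. \<psi>\<^sub>1 > 0 \<and> \<psi>\<^sub>2 > 0 \<and> \<psi>\<^sub>3 > 0 \<and> d > 0 \<and> M > 0 \<and> N > 0 \<and> \<eta> > 0 \<and>
    (\<forall>f0. Ck_on k (cball 0 1) f0 \<and> Ck_norm k (cball 0 1) f0 \<le> ereal K \<longrightarrow>
      (\<exists>h. Ck_on k (cball 0 1) h \<and> Ck_norm k (cball 0 1) h \<le> ereal \<epsilon> \<and>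
        quantitative_morse k e (\<lambda>x. f0 x + h x) \<psi>\<^sub>1 \<psi>\<^sub>2 \<psi>\<^sub>3 d M N \<eta>))"
proof -
  let ?B = "cball (0 :: real ^ 'n) 1"
  have full: "full_tangent ?B" by (rule full_tangent_cball) simp
  have k1: "1 \<le> k" and k2: "2 \<le> k" using k by auto
  have "k = Suc (Suc (Suc (k - 3)))" using k by simp
  then obtain m where m: "k = Suc (Suc (Suc m))" by blast
  obtain \<theta> \<psi> d N where \<theta>: "0 < \<theta>" "\<theta> \<le> 1" and \<psi>: "0 < \<psi>" and d: "0 < d" and pert:
    "\<forall>f0 :: real ^ 'n \<Rightarrow> real. Ck_on k ?B f0 \<and> Ck_norm k ?B f0 \<le> ereal K \<longrightarrow>
      (\<exists>h. Ck_on k ?B h \<and> Ck_norm k ?B h \<le> ereal \<epsilon> \<and> tame_critical_points \<theta> \<psi> d N (\<lambda>x. f0 x + h x))"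
    using tame_perturbation[OF k K \<epsilon>, where 'n = 'n] by (elim exE conjE)
  define K1 where "K1 = K + \<epsilon>"
  have K1: "K1 > 0" "K1 \<ge> 0" using K \<epsilon> by (auto simp: K1_def)
  define L where "L = real CARD('n) * K1"
  have L: "L > 0" using K1 by (simp add: L_def)
  obtain \<delta> M where \<delta>: "\<delta> > 0" "\<delta> \<le> \<theta>" and M: "M > 0" and morse:
    "\<forall>f x0. Ck_on k ?B f \<and> Ck_norm k ?B f \<le> ereal K1 \<and>
      ball x0 \<theta> \<subseteq> ?B \<and> (\<forall>v. nderiv ?B f [v] x0 = 0) \<and> (\<forall>v. \<theta> * norm v \<le> norm (Hessian ?B f x0 *v v)) \<longrightarrow>
      (\<exists>\<phi> l c. l \<le> CARD('n) \<and> Ck_diffeo_onto_image (k - 1) (ball x0 \<delta>) \<phi> \<and>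
        Ck_norm (k - 1) (ball x0 \<delta>) \<phi> \<le> ereal M \<and>
        (\<forall>y\<in>\<phi> ` ball x0 \<delta>. (f \<circ> inv_into (ball x0 \<delta>) \<phi>) y = morse_form e l y + c))"
    using uniform_morse[OF full bounded_cball \<theta>(1) e, of m K1] unfolding m diff_Suc_1 by (elim exE conjE)
  \<comment> \<open>Half of \<open>\<delta>\<close> leaves room for the strict inequality of the
    open ball in (v); the other bound is the contraction condition of
    \<open>near_critical_point\<close>.\<close>
  define r where "r = min (\<delta> / 2) (\<theta> / (2 * L))"
  have r: "0 < r" "r \<le> \<theta>" "r < \<delta>" "r \<le> \<theta> / (2 * L)" using \<delta> \<theta> L by (auto simp: r_def)
  have Lr: "real CARD('n) * K1 * r \<le> \<theta> / 2"
    using mult_left_mono[OF r(4), of L] L K1(1) by (simp add: L_def)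
  \<comment> \<open>The second bound is the starting condition of the Newton iteration, the first
    one makes \<open>nondegenerate\<close> apply.\<close>
  define \<eta> where "\<eta> = min \<theta> (\<theta> * r / 2)"
  have \<eta>: "\<eta> > 0" "\<eta> \<le> \<theta>" "\<eta> \<le> \<theta> * r / 2" using \<theta> r by (auto simp: \<eta>_def)
  show ?thesis
  \<comment> \<open>The bound on the number of critical points has to be positive while
    \<open>N\<close> may be 0, hence \<open>real N + 1\<close>.\<close>
  proof (rule exI[of _ \<theta>], rule exI[of _ \<psi>], rule exI[of _ \<delta>], rule exI[of _ d], rule exI[of _ M],
      rule exI[of _ "real N + 1"], rule exI[of _ \<eta>], intro conjI allI impI \<theta> \<psi> \<delta> d M \<eta>; (elim conjE)?)
    fix f0 :: "real ^ 'n \<Rightarrow> real" assume f0: "Ck_on k ?B f0" "Ck_norm k ?B f0 \<le> ereal K"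
    then obtain h where h: "Ck_on k ?B h" "Ck_norm k ?B h \<le> ereal \<epsilon>"
      and tame: "tame_critical_points \<theta> \<psi> d N (\<lambda>x. f0 x + h x)"
      using pert by blast
    define f where "f = (\<lambda>x. f0 x + h x)"
    have f: "Ck_on k ?B f" unfolding f_def by (rule Ck_on_add[OF full f0(1) h(1)])
    have fn: "Ck_norm k ?B f \<le> ereal K1" unfolding f_def
      by (rule Ck_norm_add[OF full f0 h k1]) (simp add: K1_def)
    let ?C = "critical_points ?B f"
    have nd: "nondegenerate \<theta> f" and fin: "finite ?C" "card ?C \<le> N"
      and sep: "\<forall>x\<in>?C. \<forall>y\<in>?C. x \<noteq> y \<longrightarrow> d \<le> norm (x - y) \<and> \<psi> \<le> \<bar>f x - f y\<bar>"
      using tame unfolding f_def[symmetric] tame_critical_points_def by blast+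
    have C: "x \<in> ?B" "gradient ?B f x = 0" if "x \<in> ?C" for x
      using that critical_points_iff_gradient[OF f k1] by auto
    have Cnd: "norm x \<le> 1 - \<theta>" "\<theta> * norm v \<le> norm (Hessian ?B f x *v v)" if "x \<in> ?C" for x v
      using nondegenerateD[OF nd \<theta>(1) f k2 C(1)[OF that]] C(2)[OF that] \<theta>(1) by auto
    have sub: "ball x \<theta> \<subseteq> ?B" if "x \<in> ?C" for x
    proof
      fix y assume "y \<in> ball x \<theta>"
      then have "norm y \<le> norm x + \<theta>" using norm_triangle_ineq2[of y x] by (simp add: dist_norm norm_minus_commute)
      then show "y \<in> ?B" using Cnd(1)[OF that] by simp
    qed
    have iv: "ball x \<delta> \<subseteq> ?B \<and>
            (\<exists>(\<phi> :: real ^ 'n \<Rightarrow> real ^ 'n) l c. l \<le> CARD('n) \<and>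
              Ck_diffeo_onto_image (k - 1) (ball x \<delta>) \<phi> \<and>
              Ck_norm (k - 1) (ball x \<delta>) \<phi> \<le> ereal M \<and>
              (\<forall>y\<in>\<phi> ` ball x \<delta>. (f \<circ> inv_into (ball x \<delta>) \<phi>) y = morse_form e l y + c))" if x: "x \<in> ?C" for x
    proof
      show "ball x \<delta> \<subseteq> ?B" using sub[OF x] \<delta>(2) by (meson order_trans subset_ball)
      have "nderiv ?B f [v] x = 0" for v using nderiv_gradient[OF f k1 C(1)[OF x], of v] C(2)[OF x] by simp
      then show "\<exists>(\<phi> :: real ^ 'n \<Rightarrow> real ^ 'n) l c. l \<le> CARD('n) \<and>
              Ck_diffeo_onto_image (k - 1) (ball x \<delta>) \<phi> \<and>
              Ck_norm (k - 1) (ball x \<delta>) \<phi> \<le> ereal M \<and>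
              (\<forall>y\<in>\<phi> ` ball x \<delta>. (f \<circ> inv_into (ball x \<delta>) \<phi>) y = morse_form e l y + c)"
        by (intro morse[rule_format]) (use f fn sub[OF x] Cnd(2)[OF x] in blast)
    qed
    have v: "\<exists>x'\<in>?C. x \<in> ball x' \<delta>"
      if x: "x \<in> ?B" and o: "onorm (frechet_derivative f (at x within ?B)) \<le> \<eta>" for x
    proof -
      have gx: "norm (gradient ?B f x) \<le> \<eta>" using norm_gradient_le_onorm[OF f k1 x] o by linarith
      obtain x' where "x' \<in> ?C" "dist x x' \<le> r"
        by (rule near_critical_point[OF nd \<theta>(1) f k fn K1(2) r(1,2) Lr x]) (use gx \<eta> in auto)
      then show ?thesis using r(3) by (force simp: dist_commute)
    qed
    have i: "\<theta> \<le> sigma_min (Hessian ?B f x)" if "x \<in> ?C" for x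
      by (rule sigma_min_ge) (rule Cnd(2)[OF that])
    have "quantitative_morse k e f \<theta> \<psi> \<delta> d M (real N + 1) \<eta>"
      unfolding quantitative_morse_def Let_def using i iv v fin sep by auto
    then show "\<exists>h. Ck_on k ?B h \<and> Ck_norm k ?B h \<le> ereal \<epsilon> \<and>
        quantitative_morse k e (\<lambda>x. f0 x + h x) \<theta> \<psi> \<delta> d M (real N + 1) \<eta>"
      using h unfolding f_def by blast
  qed simp
qed

theorem theorem4p4:
  fixes k :: nat and e :: "nat \<Rightarrow> 'n::finite" and B :: "(real ^ 'n) set"
  assumes "k \<ge> 3"
    and "bij_betw e {1..CARD('n)} UNIV"
  defines "B \<equiv> cball 0 1"
  shows "\<exists>\<psi>\<^sub>1 \<psi>\<^sub>2 \<psi>\<^sub>3 d M N \<eta> :: real \<Rightarrow> real \<Rightarrow> real.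
    (\<forall>K\<ge>0. \<forall>\<epsilon>>0. \<psi>\<^sub>1 K \<epsilon> > 0 \<and> \<psi>\<^sub>2 K \<epsilon> > 0 \<and> \<psi>\<^sub>3 K \<epsilon> > 0 \<and> d K \<epsilon> > 0 \<and>
      M K \<epsilon> > 0 \<and> N K \<epsilon> > 0 \<and> \<eta> K \<epsilon> > 0) \<and>
    (\<forall>K\<ge>0. \<forall>f0 :: real ^ 'n \<Rightarrow> real. Ck_on k B f0 \<and> Ck_norm k B f0 \<le> ereal K \<longrightarrow>
      (\<forall>\<epsilon>>0. \<exists>h :: real ^ 'n \<Rightarrow> real. Ck_on k B h \<and> Ck_norm k B h \<le> ereal \<epsilon> \<and>
        (let f = (\<lambda>x. f0 x + h x); C = critical_points B f; \<delta> = \<psi>\<^sub>3 K \<epsilon> in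
          (\<forall>x\<in>C. sigma_min (Hessian B f x) \<ge> \<psi>\<^sub>1 K \<epsilon>) \<and>
          (\<forall>x\<in>C. \<forall>x'\<in>C. x \<noteq> x' \<longrightarrow> norm (x - x') \<ge> d K \<epsilon>) \<and>
          finite C \<and> real (card C) \<le> N K \<epsilon> \<and>
          (\<forall>x\<in>C. \<forall>x'\<in>C. x \<noteq> x' \<longrightarrow> \<bar>f x - f x'\<bar> \<ge> \<psi>\<^sub>2 K \<epsilon>) \<and>
          (\<forall>x\<in>C. ball x \<delta> \<subseteq> B \<and>
            (\<exists>(\<phi> :: real ^ 'n \<Rightarrow> real ^ 'n) l c. l \<le> CARD('n) \<and>
              Ck_diffeo_onto_image (k - 1) (ball x \<delta>) \<phi> \<and>
              Ck_norm (k - 1) (ball x \<delta>) \<phi> \<le> ereal (M K \<epsilon>) \<and>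
              (\<forall>y\<in>\<phi> ` ball x \<delta>. (f \<circ> inv_into (ball x \<delta>) \<phi>) y = morse_form e l y + c))) \<and>
          (\<forall>x\<in>B. onorm (frechet_derivative f (at x within B)) \<le> \<eta> K \<epsilon> \<longrightarrow>
            (\<exists>x'\<in>C. x \<in> ball x' \<delta>)))))"
proof -
  \<comment> \<open>The seven constants form one tuple, so that they are chosen together for each K
    and epsilon; only then are its components turned into separate functions.\<close>
  define P where "P K \<epsilon> c = (case c of (\<psi>\<^sub>1, \<psi>\<^sub>2, \<psi>\<^sub>3, d, M, N, \<eta>) \<Rightarrow>
    \<psi>\<^sub>1 > 0 \<and> \<psi>\<^sub>2 > 0 \<and> \<psi>\<^sub>3 > 0 \<and> d > 0 \<and> M > 0 \<and> N > 0 \<and> \<eta> > 0 \<and>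
    (\<forall>f0 :: real ^ 'n \<Rightarrow> real. Ck_on k B f0 \<and> Ck_norm k B f0 \<le> ereal K \<longrightarrow>
      (\<exists>h. Ck_on k B h \<and> Ck_norm k B h \<le> ereal \<epsilon> \<and>
        quantitative_morse k e (\<lambda>x. f0 x + h x) \<psi>\<^sub>1 \<psi>\<^sub>2 \<psi>\<^sub>3 d M N \<eta>)))"
    for K \<epsilon> :: real and c :: "real \<times> real \<times> real \<times> real \<times> real \<times> real \<times> real"
  have "\<exists>c. P K \<epsilon> c" if K\<epsilon>: "K \<ge> 0" "\<epsilon> > 0" for K \<epsilon>
  proof -
    obtain \<psi>\<^sub>1 \<psi>\<^sub>2 \<psi>\<^sub>3 d M N \<eta> where "P K \<epsilon> (\<psi>\<^sub>1, \<psi>\<^sub>2, \<psi>\<^sub>3, d, M, N, \<eta>)"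
      using quantitative_morse_constants[OF assms(1,2) K\<epsilon>] unfolding P_def B_def prod.case by (elim exE)
    then show ?thesis by blast
  qed
  then obtain c where c: "\<And>K \<epsilon>. K \<ge> 0 \<Longrightarrow> \<epsilon> > 0 \<Longrightarrow> P K \<epsilon> (c K \<epsilon>)" by metis
  define c1 where "c1 K \<epsilon> = fst (c K \<epsilon>)" for K \<epsilon>
  define c2 where "c2 K \<epsilon> = fst (snd (c K \<epsilon>))" for K \<epsilon>
  define c3 where "c3 K \<epsilon> = fst (snd (snd (c K \<epsilon>)))" for K \<epsilon>
  define c4 where "c4 K \<epsilon> = fst (snd (snd (snd (c K \<epsilon>))))" for K \<epsilon>
  define c5 where "c5 K \<epsilon> = fst (snd (snd (snd (snd (c K \<epsilon>)))))" for K \<epsilon>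
  define c6 where "c6 K \<epsilon> = fst (snd (snd (snd (snd (snd (c K \<epsilon>))))))" for K \<epsilon>
  define c7 where "c7 K \<epsilon> = snd (snd (snd (snd (snd (snd (c K \<epsilon>))))))" for K \<epsilon>
  have "c K \<epsilon> = (c1 K \<epsilon>, c2 K \<epsilon>, c3 K \<epsilon>, c4 K \<epsilon>, c5 K \<epsilon>, c6 K \<epsilon>, c7 K \<epsilon>)" for K \<epsilon>
    by (simp add: c1_def c2_def c3_def c4_def c5_def c6_def c7_def)
  then have main: "P K \<epsilon> (c1 K \<epsilon>, c2 K \<epsilon>, c3 K \<epsilon>, c4 K \<epsilon>, c5 K \<epsilon>, c6 K \<epsilon>, c7 K \<epsilon>)" if "K \<ge> 0" "\<epsilon> > 0" for K \<epsilon>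
    using c[OF that] by simp
  show ?thesis
    unfolding Let_def
    by (rule exI[of _ c1], rule exI[of _ c2], rule exI[of _ c3], rule exI[of _ c4], rule exI[of _ c5],
        rule exI[of _ c6], rule exI[of _ c7]) (use main[unfolded P_def prod.case quantitative_morse_def Let_def B_def[symmetric]] in blast)
qed

end
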